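(* (a) (Exact representation.) There is a family of monotone functions $f:\{0,1\}^n\to\{\pm1\}$ (for infinitely many $n$) with optimal decision tree size $s=\Theta(n)$ such that $\textsc{TopDownDTSize}(f)\ge 2^{\Omega(s)}$. (b) (Approximate representation.) For every $\varepsilon\in(0,\frac12)$ and every function $s(n)\le 2^{\tilde{O}(n^{4/5})}$, there is a monotone $f:\{0,1\}^n\to\{\pm1\}$ with optimal decision tree size $s$ such that $\textsc{TopDownDTSize}(f,\varepsilon)\ge s^{\tilde{\Omega}((\log s)^{1/4})}$. These lower bounds hold even if ties in $\textsc{BuildTopDownDT}$ are broken in the most favorable way.
   Context: $f$ is monotone if $f(x)\le f(y)$ whenever $x_i\le y_i$ for all $i$. Decision tree size is the number of leaves; the optimal decision tree size of $f$ is the least size of a tree computing $f$ exactly; logarithms are base 2. $\mathrm{Inf}_i(g)=\Pr_{\mathbf{x}}[g(\mathbf{x})\ne g(\mathbf{x}^{\oplus i})]$ with $\mathbf{x}$ uniform and $\mathbf{x}^{\oplus i}$ being $\mathbf{x}$ with coordinate $i$ flipped. A bare tree is a decision tree with unlabeled leaves; for a leaf $\ell$, $f_\ell$ is the restriction of $f$ by the path to $\ell$ and $|\ell|$ its depth. The $f$-completion labels each leaf $\ell$ by $\mathrm{sign}(\mathbb{E}[f_\ell])$. $T$ is an $\varepsilon$-approximation of $f$ if $\Pr_{\mathbf{x}}[T(\mathbf{x})\ne f(\mathbf{x})]\le\varepsilon$. $\textsc{BuildTopDownDT}(f,\varepsilon)$: start with the one-leaf bare tree $T^\circ$; while the $f$-completion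 of $T^\circ$ is not an $\varepsilon$-approximation of $f$, for each leaf $\ell$ let $x_{i(\ell)}$ maximize $\mathrm{Inf}_i(f_\ell)$, set $\mathrm{score}(\ell)=2^{-|\ell|}\mathrm{Inf}_{i(\ell)}(f_\ell)$, and replace a highest-score leaf $\ell^\star$ by a query to $x_{i(\ell^\star)}$; output the $f$-completion. $\textsc{TopDownDTSize}(f,\varepsilon)$ is the size of the output, and $\textsc{TopDownDTSize}(f)=\textsc{TopDownDTSize}(f,0)$. *)

theory Defs
  imports "HOL-Probability.Probability"
begin

definition hypercube :: "nat \<Rightarrow> (nat \<Rightarrow> bool) set" where
  "hypercube n = {..<n} \<rightarrow>\<^sub>E UNIV"

definition uniform_cube :: "nat \<Rightarrow> (nat \<Rightarrow> bool) pmf" where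
  "uniform_cube n = pmf_of_set (hypercube n)"

(* A function f : {0,1}^n -> {-1,1} is represented by a map whose values outside
   hypercube n are irrelevant. *)
definition monotone_pm_function :: "nat \<Rightarrow> ((nat \<Rightarrow> bool) \<Rightarrow> real) \<Rightarrow> bool" where
  "monotone_pm_function n f \<longleftrightarrow> f \<in> hypercube n \<rightarrow> {-1, 1} \<and> mono_on (hypercube n) f"

definition influence :: "nat \<Rightarrow> nat \<Rightarrow> ((nat \<Rightarrow> bool) \<Rightarrow> real) \<Rightarrow> real" where
  "influence n i g = measure_pmf.prob (uniform_cube n) {x. g x \<noteq> g (x(i := \<not> x i))}"

(* In Query i l r the subtree l is taken when the i-th bit is 0 and r when it is 1.
   Decision trees have type real dtree, bare trees have type unit dtree. *)
datatype 'a dtree = Leaf 'a | Query nat "'a dtree" "'a dtree"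

primrec eval_dtree :: "'a dtree \<Rightarrow> (nat \<Rightarrow> bool) \<Rightarrow> 'a" where
  "eval_dtree (Leaf a) x = a"
| "eval_dtree (Query i l r) x = (if x i then eval_dtree r x else eval_dtree l x)"

primrec dtree_size :: "'a dtree \<Rightarrow> nat" where
  "dtree_size (Leaf a) = 1"
| "dtree_size (Query i l r) = dtree_size l + dtree_size r"

primrec dtree_vars :: "'a dtree \<Rightarrow> nat set" where
  "dtree_vars (Leaf a) = {}"
| "dtree_vars (Query i l r) = insert i (dtree_vars l \<union> dtree_vars r)"

definition optimal_dt_size :: "nat \<Rightarrow> ((nat \<Rightarrow> bool) \<Rightarrow> real) \<Rightarrow> nat" where
  "optimal_dt_size n f =
     (LEAST m. \<exists>T. dtree_vars T \<subseteq> {..<n} \<and> (\<forall>x\<in>hypercube n. eval_dtree T x = f x) \<and>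
                   dtree_size T = m)"

definition approximates :: "nat \<Rightarrow> real \<Rightarrow> real dtree \<Rightarrow> ((nat \<Rightarrow> bool) \<Rightarrow> real) \<Rightarrow> bool" where
  "approximates n \<epsilon> T f \<longleftrightarrow>
     measure_pmf.prob (uniform_cube n) {x. eval_dtree T x \<noteq> f x} \<le> \<epsilon>"

(* A leaf is identified with its root-to-leaf path, the list of queried variables
   and answers starting at the root; its depth is the length of this list. *)
primrec leaf_paths :: "'a dtree \<Rightarrow> (nat \<times> bool) list set" where
  "leaf_paths (Leaf a) = {[]}"
| "leaf_paths (Query i l r) = (#) (i, False) ` leaf_paths l \<union> (#) (i, True) ` leaf_paths r"

(* Restrictions stay functions of all n bits: fixed bits are overwritten. This changes
   neither the expectation nor the influences of the free variables, and the fixed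
   variables get influence 0. *)
definition restrict_var ::
  "((nat \<Rightarrow> bool) \<Rightarrow> real) \<Rightarrow> nat \<Rightarrow> bool \<Rightarrow> (nat \<Rightarrow> bool) \<Rightarrow> real" where
  "restrict_var f i b = (\<lambda>x. f (x(i := b)))"

fun restrict_path ::
  "((nat \<Rightarrow> bool) \<Rightarrow> real) \<Rightarrow> (nat \<times> bool) list \<Rightarrow> (nat \<Rightarrow> bool) \<Rightarrow> real" where
  "restrict_path f [] = f"
| "restrict_path f ((i, b) # p) = restrict_path (restrict_var f i b) p"

(* The value at 0 is a convention: on a leaf with mean 0 either label errs with
   probability exactly 1/2. *)
definition pm_sign :: "real \<Rightarrow> real" where
  "pm_sign t = (if t \<ge> 0 then 1 else - 1)"

primrec completion :: "nat \<Rightarrow> unit dtree \<Rightarrow> ((nat \<Rightarrow> bool) \<Rightarrow> real) \<Rightarrow> real dtree" where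
  "completion n (Leaf u) f = Leaf (pm_sign (measure_pmf.expectation (uniform_cube n) f))"
| "completion n (Query i l r) f =
     Query i (completion n l (restrict_var f i False)) (completion n r (restrict_var f i True))"

fun split_leaf :: "unit dtree \<Rightarrow> (nat \<times> bool) list \<Rightarrow> nat \<Rightarrow> unit dtree" where
  "split_leaf (Leaf u) p i = Query i (Leaf ()) (Leaf ())"
| "split_leaf (Query j l r) [] i = Query j l r"
| "split_leaf (Query j l r) ((k, b) # p) i =
     (if b then Query j l (split_leaf r p i) else Query j (split_leaf l p i) r)"

(* The bare trees that can occur during a run of BuildTopDownDT(f, eps). Ties, both between
   variables and between leaves, are resolved nondeterministically in every round:
   v assigns to each leaf a variable of maximal influence, and p is a leaf of maximal score. *)
inductive top_down_tree :: "nat \<Rightarrow> ((nat \<Rightarrow> bool) \<Rightarrow> real) \<Rightarrow> real \<Rightarrow> unit dtree \<Rightarrow> bool"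
  for n :: nat and f :: "(nat \<Rightarrow> bool) \<Rightarrow> real" and \<epsilon> :: real where
  start: "top_down_tree n f \<epsilon> (Leaf ())"
| step: "top_down_tree n f \<epsilon> (split_leaf T p (v p))"
  if "top_down_tree n f \<epsilon> T"
    and "\<not> approximates n \<epsilon> (completion n T f) f"
    and "\<forall>q\<in>leaf_paths T. is_arg_max (\<lambda>i. influence n i (restrict_path f q)) (\<lambda>i. i < n) (v q)"
    and "is_arg_max (\<lambda>q. (1 / 2) ^ length q * influence n (v q) (restrict_path f q))
           (\<lambda>q. q \<in> leaf_paths T) p"

definition top_down_outputs :: "nat \<Rightarrow> ((nat \<Rightarrow> bool) \<Rightarrow> real) \<Rightarrow> real \<Rightarrow> real dtree set" where
  "top_down_outputs n f \<epsilon> =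
     {completion n T f | T. top_down_tree n f \<epsilon> T \<and> approximates n \<epsilon> (completion n T f) f}"

(* The size of the output under the most favorable tie-breaking. *)
definition top_down_dt_size :: "nat \<Rightarrow> ((nat \<Rightarrow> bool) \<Rightarrow> real) \<Rightarrow> real \<Rightarrow> nat" where
  "top_down_dt_size n f \<epsilon> = (LEAST m. \<exists>T\<in>top_down_outputs n f \<epsilon>. dtree_size T = m)"

(* Soft asymptotic bounds, up to factors polylogarithmic in the bounding function. They are
   one-sided and without absolute values, so that a function in soft_Omega g really is
   eventually large (the library's bigomega would admit negative functions). *)
definition soft_O :: "(nat \<Rightarrow> real) \<Rightarrow> (nat \<Rightarrow> real) set" where
  "soft_O g = {h. \<exists>C>0. \<exists>k::nat. \<forall>\<^sub>F m in sequentially. h m \<le> C * g m * log 2 (g m) ^ k}"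

definition soft_Omega :: "(nat \<Rightarrow> real) \<Rightarrow> (nat \<Rightarrow> real) set" where
  "soft_Omega g = {h. \<exists>c>0. \<exists>k::nat. \<forall>\<^sub>F m in sequentially. h m \<ge> c * g m / log 2 (g m) ^ k}"

end

theory Submission
  imports Defs "HOL-Real_Asymp.Real_Asymp"
begin

text \<open>The scores play no role: every tree built by the algorithm is greedy, i.e. each internal node
  queries a variable of maximal positive influence on the current restriction, and both lower bounds
  hold for all greedy trees.

  Exact representation: a misleading variable of slightly larger influence is put on top of a
  selector, so that every greedy tree asks for it first and then still has to represent the next
  level in both branches. The size doubles with every level, although asking for the selector first
  needs only one copy of the next level.

  Approximate representation: the core \<open>H\<close> is true if at least two tribes (conjunctions of \<open>w\<close>
  variables) are satisfied, or if exactly one is satisfied and the majority vote of the block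
  belonging to this tribe is positive. A variable of a tribe has influence about \<open>2\<^sup>-\<^sup>w\<close>, whereas a
  variable of a block is more influential as long as the vote of the block is nearly balanced. The sum
  over the blocks of the squared imbalances grows by at most 1 in expectation per query; hence with
  high probability a greedy tree makes about \<open>2\<^bsup>5w/4\<^esup>\<close> queries before it touches a tribe, and before
  that it knows nothing about \<open>H\<close>. An optimal tree evaluates the tribes first and needs depth only
  about \<open>w 2\<^sup>w\<close>. Gate variables \<open>U\<close>, \<open>Z\<close> combine \<open>H\<close> with a function \<open>g\<close> on further variables, such that
  \<open>H\<close> dominates on average while the optimal size is exactly that of \<open>g\<close> plus a constant; choosing \<open>g\<close>
  freely realises every size.\<close>

section \<open>Means over the cube\<close>

text \<open>The exponent 5/4 stems from \<open>B = 2 ^ (w div 4)\<close> blocks with about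
  \<open>2 * 2 ^ w\<close> variables each. They occupy about 2^(5w/4) variables; as log s is 2^w up
  to polylogarithmic factors, these fit into n just when log s stays below n^(4/5), and 2^(5w/4)
  forced queries yield size s to the power (log s)^(1/4). A variable of a balanced block has
  influence of order 1 / (B * 2^(w/2)), which leaves ample room above 2^-w. As every epsilon below
  1/2 must be covered, ignorance of the tribes has to force an error close to 1/2. Even full
  knowledge of all blocks must not help: if exactly one tribe is satisfied, its block is uniformly
  distributed, and the B votes are independent and fair, so any guess agrees with only about B/2 +
  O(sqrt B) of them. The obstacle to realising s exactly is that the optimal size of H is unknown.
  The gate circumvents this: it adds a cost that is unknown, but the same for every nonconstant g of
  sufficient size, and g is chosen to make up the difference.\<close>

definition cube_mean :: "nat \<Rightarrow> ((nat \<Rightarrow> bool) \<Rightarrow> real) \<Rightarrow> real" where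
  "cube_mean n g = (\<Sum>x\<in>hypercube n. g x) / 2 ^ n"

definition cube_prob :: "nat \<Rightarrow> ((nat \<Rightarrow> bool) \<Rightarrow> bool) \<Rightarrow> real" where
  "cube_prob n Q = cube_mean n (\<lambda>x. of_bool (Q x))"

lemma finite_hypercube [simp]: "finite (hypercube n)"
  by (simp add: hypercube_def finite_PiE)

lemma card_hypercube: "card (hypercube n) = 2 ^ n"
  by (simp add: hypercube_def card_PiE)

lemma hypercube_nonempty [simp]: "hypercube n \<noteq> {}"
  by (metis card_hypercube card.empty power_not_zero zero_neq_numeral)

lemma update_in_hypercube: "x \<in> hypercube n \<Longrightarrow> i < n \<Longrightarrow> x(i := b) \<in> hypercube n"
  by (auto simp: hypercube_def PiE_iff extensional_def)

lemma prob_uniform_cube: "measure_pmf.prob (uniform_cube n) {x. Q x} = cube_prob n Q"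
proof -
  have "measure_pmf.prob (uniform_cube n) {x. Q x}
      = real (card (hypercube n \<inter> {x. Q x})) / real (card (hypercube n))"
    unfolding uniform_cube_def by (simp add: measure_pmf_of_set)
  also have "real (card (hypercube n \<inter> {x. Q x})) = (\<Sum>x\<in>hypercube n. of_bool (Q x))"
    by (simp add: Int_def sum.If_cases of_bool_def)
  finally show ?thesis
    by (simp add: cube_prob_def cube_mean_def card_hypercube)
qed

lemma expectation_uniform_cube: "measure_pmf.expectation (uniform_cube n) g = cube_mean n g"
  unfolding uniform_cube_def
  by (simp add: integral_pmf_of_set card_hypercube cube_mean_def)

lemma influence_eq: "influence n i g = cube_prob n (\<lambda>x. g x \<noteq> g (x(i := \<not> x i)))"
  by (simp add: influence_def prob_uniform_cube)

lemma cube_mean_cong: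
  "(\<And>x. x \<in> hypercube n \<Longrightarrow> f x = g x) \<Longrightarrow> cube_mean n f = cube_mean n g"
  by (simp add: cube_mean_def cong: sum.cong)

lemma cube_mean_add: "cube_mean n (\<lambda>x. f x + g x) = cube_mean n f + cube_mean n g"
  by (simp add: cube_mean_def sum.distrib add_divide_distrib)

lemma cube_mean_diff: "cube_mean n (\<lambda>x. f x - g x) = cube_mean n f - cube_mean n g"
  by (simp add: cube_mean_def sum_subtractf diff_divide_distrib)

lemma cube_mean_cmult: "cube_mean n (\<lambda>x. c * f x) = c * cube_mean n f"
  by (simp add: cube_mean_def sum_distrib_left)

lemma cube_mean_const [simp]: "cube_mean n (\<lambda>x. c) = c"
  by (simp add: cube_mean_def card_hypercube)

lemma cube_mean_sum: "cube_mean n (\<lambda>x. \<Sum>i\<in>I. f i x) = (\<Sum>i\<in>I. cube_mean n (f i))"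
  unfolding cube_mean_def sum_divide_distrib[symmetric] by (subst sum.swap) simp

lemma cube_mean_mono:
  "(\<And>x. x \<in> hypercube n \<Longrightarrow> f x \<le> g x) \<Longrightarrow> cube_mean n f \<le> cube_mean n g"
  by (simp add: cube_mean_def divide_right_mono sum_mono)

lemma cube_prob_mono:
  "(\<And>x. x \<in> hypercube n \<Longrightarrow> P x \<Longrightarrow> Q x) \<Longrightarrow> cube_prob n P \<le> cube_prob n Q"
  by (auto simp: cube_prob_def intro: cube_mean_mono)

lemma cube_prob_const [simp]: "cube_prob n (\<lambda>x. b) = of_bool b"
  by (simp add: cube_prob_def)

lemma cube_prob_nonneg [simp]: "0 \<le> cube_prob n Q"
  using cube_prob_mono[of n "\<lambda>_. False" Q] by simp

lemma cube_prob_le_1 [simp]: "cube_prob n Q \<le> 1"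
  using cube_prob_mono[of n Q "\<lambda>_. True"] by simp

lemma cube_prob_not: "cube_prob n (\<lambda>x. \<not> Q x) = 1 - cube_prob n Q"
  using cube_mean_diff[of n "\<lambda>_. 1" "\<lambda>x. of_bool (Q x)"]
  by (simp add: cube_prob_def of_bool_not_iff)

lemma cube_prob_eq_0_iff: "cube_prob n Q = 0 \<longleftrightarrow> (\<forall>x\<in>hypercube n. \<not> Q x)"
  unfolding cube_prob_def cube_mean_def by (auto simp: sum_nonneg_eq_0_iff)

lemma cube_mean_split:
  assumes "i < n"
  shows "cube_mean n g
    = (cube_mean n (\<lambda>x. g (x(i := False))) + cube_mean n (\<lambda>x. g (x(i := True)))) / 2"
proof -
  define flip where "flip = (\<lambda>x::nat \<Rightarrow> bool. x(i := \<not> x i))"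
  have bij: "bij_betw flip (hypercube n) (hypercube n)"
    by (rule bij_betw_byWitness[where f' = flip])
      (auto simp: flip_def update_in_hypercube assms fun_eq_iff)
  have "(\<Sum>x\<in>hypercube n. g (x(i := False))) + (\<Sum>x\<in>hypercube n. g (x(i := True)))
      = (\<Sum>x\<in>hypercube n. g x + g (flip x))"
    unfolding sum.distrib[symmetric]
  proof (rule sum.cong)
    fix x
    show "g (x(i := False)) + g (x(i := True)) = g x + g (flip x)"
    proof (cases "x i")
      case True
      then have "x(i := True) = x" by (intro ext) auto
      then show ?thesis using True by (simp add: flip_def)
    next
      case False
      then have "x(i := False) = x" by (intro ext) auto
      then show ?thesis using False by (simp add: flip_def)
    qed
  qed simp
  also have "\<dots> = 2 * (\<Sum>x\<in>hypercube n. g x)"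
    using sum.reindex_bij_betw[OF bij, of g] by (simp add: sum.distrib)
  finally show ?thesis
    by (simp add: cube_mean_def flip: add_divide_distrib)
qed

lemma cube_prob_split:
  assumes "i < n"
  shows "cube_prob n Q
    = (cube_prob n (\<lambda>x. Q (x(i := False))) + cube_prob n (\<lambda>x. Q (x(i := True)))) / 2"
  unfolding cube_prob_def by (rule cube_mean_split[OF assms])

lemma cube_prob_coordinate: "i < n \<Longrightarrow> cube_prob n (\<lambda>x. x i = b) = 1 / 2"
  by (subst cube_prob_split[of i]) auto

text \<open>Quantified over all assignments and not only over the cube, so that updating or
  overriding coordinates never leaves its scope.\<close>

definition depends_only :: "nat set \<Rightarrow> ((nat \<Rightarrow> bool) \<Rightarrow> 'a) \<Rightarrow> bool" where
  "depends_only S g \<longleftrightarrow> (\<forall>x y. (\<forall>i\<in>S. x i = y i) \<longrightarrow> g x = g y)"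

lemma depends_onlyI:
  "(\<And>x y. (\<And>i. i \<in> S \<Longrightarrow> x i = y i) \<Longrightarrow> g x = g y) \<Longrightarrow> depends_only S g"
  unfolding depends_only_def by blast

lemma depends_onlyD:
  "depends_only S g \<Longrightarrow> (\<And>i. i \<in> S \<Longrightarrow> x i = y i) \<Longrightarrow> g x = g y"
  unfolding depends_only_def by blast

lemma depends_only_update: "depends_only S g \<Longrightarrow> i \<notin> S \<Longrightarrow> g (x(i := b)) = g x"
  by (rule depends_onlyD) auto

lemma depends_only_mono: "depends_only S g \<Longrightarrow> S \<subseteq> S' \<Longrightarrow> depends_only S' g"
  by (auto simp: depends_only_def subset_iff)

lemma depends_only_comp: "depends_only S g \<Longrightarrow> depends_only S (\<lambda>x. h (g x))"
  unfolding depends_only_def by metis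

lemma depends_only_comp2:
  "depends_only S f \<Longrightarrow> depends_only S g \<Longrightarrow> depends_only S (\<lambda>x. h (f x) (g x))"
  unfolding depends_only_def by metis

text \<open>Independence. Averaging out the coordinates of \<open>S\<close> one by one makes
  \<open>f\<close> constant and never touches \<open>g\<close>; only \<open>S\<close> has to be
  finite, so \<open>S'\<close> may be a complement.\<close>

lemma cube_mean_mult:
  assumes "finite S" "S \<subseteq> {..<n}" "S \<inter> S' = {}" "depends_only S f" "depends_only S' g"
  shows "cube_mean n (\<lambda>x. f x * g x) = cube_mean n f * cube_mean n g"
  using assms
proof (induction S arbitrary: f rule: finite_induct)
  case empty
  then have "f = (\<lambda>_. f (\<lambda>_. True))"
    unfolding depends_only_def by fast
  then obtain c where "f = (\<lambda>_. c)" ..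
  then show ?case
    by (simp add: cube_mean_cmult)
next
  case (insert i S)
  have i: "i < n" "i \<notin> S'"
    using insert.prems by auto
  have dep: "depends_only S (\<lambda>x. f (x(i := b)))" for b
    using insert.prems(3) by (force simp: depends_only_def)
  have *: "cube_mean n (\<lambda>x. f (x(i := b)) * g (x(i := b)))
      = cube_mean n (\<lambda>x. f (x(i := b))) * cube_mean n g" for b
    using insert.IH[of "\<lambda>x. f (x(i := b))"] dep insert.prems i
    by (simp add: depends_only_update[OF insert.prems(4)])
  show ?case
    unfolding cube_mean_split[OF i(1), of "\<lambda>x. f x * g x"] cube_mean_split[OF i(1), of f] *
    by (simp add: distrib_right)
qed

lemma cube_prob_conj:
  assumes "finite S" "S \<subseteq> {..<n}" "S \<inter> S' = {}" "depends_only S P" "depends_only S' Q"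
  shows "cube_prob n (\<lambda>x. P x \<and> Q x) = cube_prob n P * cube_prob n Q"
  using cube_mean_mult[OF assms(1-3) depends_only_comp[OF assms(4)] depends_only_comp[OF assms(5)],
      of of_bool of_bool]
  by (simp add: cube_prob_def of_bool_conj)

lemma cube_prob_all_eq:
  assumes "finite S" "S \<subseteq> {..<n}"
  shows "cube_prob n (\<lambda>x. \<forall>i\<in>S. x i = b) = 1 / 2 ^ card S"
  using assms
proof (induction S rule: finite_induct)
  case (insert i S)
  have "cube_prob n (\<lambda>x. x i = b \<and> (\<forall>j\<in>S. x j = b))
      = cube_prob n (\<lambda>x. x i = b) * cube_prob n (\<lambda>x. \<forall>j\<in>S. x j = b)"
    using insert by (intro cube_prob_conj[of "{i}" n S]) (auto simp: depends_only_def)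
  then show ?case
    using insert by (simp add: cube_prob_coordinate)
qed simp

text \<open>Averaging over one more coordinate is Pascal's rule.\<close>

lemma cube_prob_card_eq:
  assumes "finite S" "S \<subseteq> {..<n}"
  shows "cube_prob n (\<lambda>x. card {i \<in> S. x i} = m) = real (card S choose m) / 2 ^ card S"
  using assms
proof (induction S arbitrary: m rule: finite_induct)
  case empty
  then show ?case by (cases m) auto
next
  case (insert i S)
  have i: "i < n" using insert by auto
  have F: "{j \<in> insert i S. (x(i := False)) j} = {j \<in> S. x j}" for x :: "nat \<Rightarrow> bool"
    using insert by auto
  have "{j \<in> insert i S. (x(i := True)) j} = insert i {j \<in> S. x j}" for x :: "nat \<Rightarrow> bool"
    using insert by auto
  then have T: "card {j \<in> insert i S. (x(i := True)) j} = Suc (card {j \<in> S. x j})"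
    for x :: "nat \<Rightarrow> bool"
    using insert by simp
  show ?case
  proof (cases m)
    case 0
    then show ?thesis
      unfolding cube_prob_split[OF i, of "\<lambda>x. card {j \<in> insert i S. x j} = m"] F T
      using insert.IH[of 0] insert.hyps insert.prems by (simp del: card_0_eq)
  next
    case (Suc k)
    then show ?thesis
      unfolding cube_prob_split[OF i, of "\<lambda>x. card {j \<in> insert i S. x j} = m"] F T
      using insert.IH[of k] insert.IH[of m] insert.hyps insert.prems
      by (simp add: field_simps del: card_0_eq)
  qed
qed

text \<open>Flipping all bits preserves the uniform distribution; this makes the votes of the blocks
  fair in \<open>cube_prob_maj\<close>.\<close>

lemma cube_mean_complement:
  "cube_mean n g = cube_mean n (\<lambda>x. g (\<lambda>i. if i < n then \<not> x i else x i))"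
proof -
  define neg where "neg = (\<lambda>x i. if i < n then \<not> x i else (x i :: bool))"
  have "bij_betw neg (hypercube n) (hypercube n)"
    by (rule bij_betw_byWitness[where f' = neg])
      (auto simp: neg_def hypercube_def fun_eq_iff PiE_iff extensional_def)
  from sum.reindex_bij_betw[OF this, of g] show ?thesis
    by (simp add: cube_mean_def neg_def)
qed

section \<open>Greedy trees\<close>

text \<open>Positive influence is demanded because it rules out repeated queries
  (\<open>greedy_read_once\<close>) and thereby bounds the size of greedy trees by
  \<open>2 ^ n\<close>.\<close>

primrec greedy :: "nat \<Rightarrow> 'a dtree \<Rightarrow> ((nat \<Rightarrow> bool) \<Rightarrow> real) \<Rightarrow> bool" where
  "greedy n (Leaf u) f \<longleftrightarrow> True"
| "greedy n (Query i l r) f \<longleftrightarrow> i < n \<and> 0 < influence n i f \<and>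
     (\<forall>k<n. influence n k f \<le> influence n i f) \<and>
     greedy n l (restrict_var f i False) \<and> greedy n r (restrict_var f i True)"

primrec read_once :: "'a dtree \<Rightarrow> bool" where
  "read_once (Leaf u) \<longleftrightarrow> True"
| "read_once (Query i l r) \<longleftrightarrow>
     i \<notin> dtree_vars l \<and> i \<notin> dtree_vars r \<and> read_once l \<and> read_once r"

lemma finite_dtree_vars [simp]: "finite (dtree_vars T)"
  by (induction T) auto

lemma dtree_size_pos [simp]: "0 < dtree_size T"
  by (induction T) auto

lemma eval_dtree_cong:
  "(\<And>i. i \<in> dtree_vars T \<Longrightarrow> x i = y i) \<Longrightarrow> eval_dtree T x = eval_dtree T y"
  by (induction T) auto

lemma eval_dtree_update: "i \<notin> dtree_vars T \<Longrightarrow> eval_dtree T (x(i := b)) = eval_dtree T x"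
  by (rule eval_dtree_cong) auto

lemma size_le_pow_vars: "read_once T \<Longrightarrow> dtree_size T \<le> 2 ^ card (dtree_vars T)"
proof (induction T)
  case (Query i l r)
  let ?V = "dtree_vars l \<union> dtree_vars r"
  have "dtree_size T \<le> 2 ^ card ?V" if "dtree_size T \<le> 2 ^ card (dtree_vars T)"
    "dtree_vars T \<subseteq> ?V" for T :: "'a dtree"
    by (rule order_trans[OF that(1)]) (auto intro!: card_mono[OF _ that(2)])
  then have "dtree_size l \<le> 2 ^ card ?V" "dtree_size r \<le> 2 ^ card ?V"
    using Query by auto
  then show ?case
    using Query.prems by simp
qed simp

lemma influence_nonneg: "0 \<le> influence n i f"
  by (simp add: influence_eq)

lemma influence_eq_0: "depends_only (- {i}) f \<Longrightarrow> influence n i f = 0"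
  by (simp add: influence_eq depends_only_update)

lemma depends_only_restrict_var: "depends_only (- {i}) (restrict_var f i b)"
  unfolding depends_only_def restrict_var_def
  by (intro allI impI arg_cong[of _ _ f] ext) auto

lemma depends_only_restrict_var_other:
  "depends_only S f \<Longrightarrow> depends_only S (restrict_var f k b)"
  unfolding restrict_var_def by (rule depends_onlyI) (erule depends_onlyD, simp)

lemma greedy_irrelevant: "greedy n T f \<Longrightarrow> depends_only (- {i}) f \<Longrightarrow> i \<notin> dtree_vars T"
  by (induction T arbitrary: f)
    (auto dest: depends_only_restrict_var_other influence_eq_0[where n = n])

lemma greedy_read_once: "greedy n T f \<Longrightarrow> read_once T"
  by (induction T arbitrary: f) (auto dest: greedy_irrelevant[OF _ depends_only_restrict_var])

lemma greedy_vars: "greedy n T f \<Longrightarrow> dtree_vars T \<subseteq> {..<n}"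
  by (induction T arbitrary: f) auto

lemma greedy_size: assumes "greedy n T f" shows "dtree_size T \<le> 2 ^ n"
proof -
  have "card (dtree_vars T) \<le> n"
    using card_mono[OF _ greedy_vars[OF assms]] by simp
  then show ?thesis
    using size_le_pow_vars[OF greedy_read_once[OF assms]]
    by (meson order_trans power_increasing one_le_numeral)
qed

lemma greedy_split_leaf:
  assumes "greedy n T f" "p \<in> leaf_paths T" "i < n" "0 < influence n i (restrict_path f p)"
    "\<forall>k<n. influence n k (restrict_path f p) \<le> influence n i (restrict_path f p)"
  shows "greedy n (split_leaf T p i) f"
  using assms by (induction T arbitrary: f p) auto

lemma dtree_size_split_leaf:
  "p \<in> leaf_paths T \<Longrightarrow> dtree_size (split_leaf T p i) = Suc (dtree_size T)"
  by (induction T arbitrary: p) auto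

lemma dtree_size_completion [simp]: "dtree_size (completion n T f) = dtree_size T"
  by (induction T arbitrary: f) auto

lemma dtree_vars_completion [simp]: "dtree_vars (completion n T f) = dtree_vars T"
  by (induction T arbitrary: f) auto

lemma finite_leaf_paths [simp]: "finite (leaf_paths T)"
  by (induction T) auto

lemma leaf_paths_nonempty [simp]: "leaf_paths T \<noteq> {}"
  by (induction T) auto

lemma influence_eq_0_iff:
  "influence n i f = 0 \<longleftrightarrow> (\<forall>x\<in>hypercube n. f x = f (x(i := \<not> x i)))"
  by (auto simp: influence_eq cube_prob_eq_0_iff)

lemma constant_if_no_influence:
  assumes "\<And>i. i < n \<Longrightarrow> influence n i f = 0" "x \<in> hypercube n" "y \<in> hypercube n"
  shows "f x = f y"
proof -
  \<comment> \<open>Hybrids from \<open>x = h 0\<close> to \<open>y = h n\<close>: neighbours differ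
    in at most one bit, and that bit has no influence.\<close>
  define h where "h k = (\<lambda>j. if j < k then y j else x j)" for k
  have h: "h k \<in> hypercube n" if "k \<le> n" for k
    using assms that by (auto simp: h_def hypercube_def PiE_iff extensional_def)
  have "f (h k) = f x" if "k \<le> n" for k
    using that
  proof (induction k)
    case (Suc k)
    have "h (Suc k) = h k \<or> h (Suc k) = (h k)(k := \<not> h k k)"
      by (cases "y k = x k") (auto simp: h_def fun_eq_iff less_Suc_eq)
    then have "f (h (Suc k)) = f (h k)"
      using assms(1)[of k] h[of k] Suc.prems unfolding influence_eq_0_iff by auto
    then show ?case
      using Suc by simp
  qed (simp add: h_def)
  moreover have "h n = y"
    using assms(2,3) by (auto simp: h_def fun_eq_iff hypercube_def PiE_iff extensional_def)
  ultimately show ?thesis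
    by (metis order_refl)
qed

lemma pm_sign_mean_of_constant:
  assumes "f \<in> hypercube n \<rightarrow> {-1, 1}" "\<And>i. i < n \<Longrightarrow> influence n i f = 0" "x \<in> hypercube n"
  shows "pm_sign (measure_pmf.expectation (uniform_cube n) f) = f x"
proof -
  have "measure_pmf.expectation (uniform_cube n) f = cube_mean n (\<lambda>_. f x)"
    unfolding expectation_uniform_cube
    by (intro cube_mean_cong constant_if_no_influence[OF assms(2)] assms(3)) auto
  moreover have "f x = -1 \<or> f x = 1"
    using assms(1,3) by auto
  ultimately show ?thesis
    by (auto simp: pm_sign_def)
qed

lemma completion_exact:
  assumes "dtree_vars T \<subseteq> {..<n}" "f \<in> hypercube n \<rightarrow> {-1, 1}"
    "\<And>p i. p \<in> leaf_paths T \<Longrightarrow> i < n \<Longrightarrow> influence n i (restrict_path f p) = 0"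
    "x \<in> hypercube n"
  shows "eval_dtree (completion n T f) x = f x"
  using assms
proof (induction T arbitrary: f)
  case (Leaf u)
  then show ?case
    using pm_sign_mean_of_constant[of f n x] by simp
next
  case (Query i l r)
  let ?T = "if x i then r else l"
  have "restrict_var f i b \<in> hypercube n \<rightarrow> {-1, 1}" for b
    using Query.prems(1,2) by (auto simp: restrict_var_def intro!: update_in_hypercube Pi_mem[OF Query.prems(2)])
  then have "eval_dtree (completion n ?T (restrict_var f i (x i))) x = restrict_var f i (x i) x"
    using Query.IH(1)[of "restrict_var f i False"] Query.IH(2)[of "restrict_var f i True"]
      Query.prems(1,4) Query.prems(3)[of "(i, x i) # p" for p] by auto
  then show ?case
    by (auto simp: restrict_var_def split: if_splits)
qed

section \<open>From the algorithm to greedy trees\<close>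

lemma approximates_iff:
  "approximates n \<epsilon> T f \<longleftrightarrow> cube_prob n (\<lambda>x. eval_dtree T x \<noteq> f x) \<le> \<epsilon>"
  by (simp add: approximates_def prob_uniform_cube)

text \<open>The point is that a split variable has positive influence: if the highest score were 0,
  all influences at all leaves would vanish, the completion would be exact, and the loop would
  already have stopped.\<close>

lemma top_down_tree_greedy:
  assumes "top_down_tree n f \<epsilon> T" "f \<in> hypercube n \<rightarrow> {-1, 1}" "0 \<le> \<epsilon>"
  shows "greedy n T f"
  using assms(1)
proof (induction rule: top_down_tree.induct)
  case (step T v p)
  let ?I = "\<lambda>q i. influence n i (restrict_path f q)"
  have p: "p \<in> leaf_paths T"
    using step(4) by (simp add: is_arg_max_def)
  have score: "(1 / 2) ^ length q * ?I q (v q) \<le> (1 / 2) ^ length p * ?I p (v p)"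
    if "q \<in> leaf_paths T" for q
    using step(4) that unfolding is_arg_max_def by (meson not_less)
  have v1: "v q < n" if "q \<in> leaf_paths T" for q
    using bspec[OF step(3) that] by (simp add: is_arg_max_def)
  have v2: "?I q k \<le> ?I q (v q)" if "q \<in> leaf_paths T" "k < n" for q k
    using bspec[OF step(3) that(1)] that(2) unfolding is_arg_max_def by (meson not_less)
  have "?I p (v p) \<noteq> 0"
  proof
    assume 0: "?I p (v p) = 0"
    have "?I q i = 0" if q: "q \<in> leaf_paths T" and i: "i < n" for q i
    proof -
      have "(1 / 2) ^ length q * ?I q (v q) \<le> 0"
        using score[OF q] 0 by simp
      then have "?I q (v q) \<le> 0"
        using mult_pos_pos[of "(1 / 2) ^ length q" "?I q (v q)"] by fastforce
      then show ?thesis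
        using v2[OF q i] influence_nonneg[of n i "restrict_path f q"] by simp
    qed
    then have "cube_prob n (\<lambda>x. eval_dtree (completion n T f) x \<noteq> f x) = 0"
      unfolding cube_prob_eq_0_iff
      using completion_exact[OF greedy_vars[OF step(5)] assms(2)] by blast
    then show False
      using step(2) assms(3) by (simp add: approximates_iff)
  qed
  then have "0 < ?I p (v p)"
    using influence_nonneg[of n "v p" "restrict_path f p"] by linarith
  then show ?case
    using greedy_split_leaf[OF step(5) p v1[OF p]] v2[OF p] by simp
qed simp

lemma ex_is_arg_max_finite:
  fixes f :: "'a \<Rightarrow> real"
  assumes "finite S" "S \<noteq> {}"
  shows "\<exists>x. is_arg_max f (\<lambda>x. x \<in> S) x"
proof -
  obtain x where "x \<in> S" "f x = Max (f ` S)"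
    using Max_in[of "f ` S"] assms by fastforce
  then show ?thesis
    using assms by (auto simp: is_arg_max_def not_less intro!: exI[of _ x])
qed

text \<open>Termination, needed because \<open>LEAST\<close> says nothing about an empty set. Greedy
  trees have at most \<open>2 ^ n\<close> leaves, and a largest tree that occurs cannot be split any
  more, so its completion approximates \<open>f\<close>.\<close>

lemma top_down_outputs_nonempty:
  assumes "0 < n" "f \<in> hypercube n \<rightarrow> {-1, 1}" "0 \<le> \<epsilon>"
  shows "top_down_outputs n f \<epsilon> \<noteq> {}"
proof -
  let ?R = "{T. top_down_tree n f \<epsilon> T}"
  have fin: "finite (dtree_size ` ?R)"
    by (rule finite_subset[of _ "{..2 ^ n}"])
      (auto dest: greedy_size[OF top_down_tree_greedy[OF _ assms(2,3)]])
  have "Leaf () \<in> ?R"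
    by (auto intro: top_down_tree.start)
  then have "Max (dtree_size ` ?R) \<in> dtree_size ` ?R"
    by (intro Max_in[OF fin]) blast
  then obtain T where T: "T \<in> ?R" "\<And>T'. T' \<in> ?R \<Longrightarrow> dtree_size T' \<le> dtree_size T"
    using Max_ge[OF fin] by fastforce
  have "approximates n \<epsilon> (completion n T f) f"
  proof (rule ccontr)
    assume na: "\<not> approximates n \<epsilon> (completion n T f) f"
    have "\<exists>i. is_arg_max (\<lambda>i. influence n i (restrict_path f q)) (\<lambda>i. i < n) i" for q
      using ex_is_arg_max_finite[of "{..<n}" "\<lambda>i. influence n i (restrict_path f q)"] assms(1)
      by auto
    then obtain v
      where v: "is_arg_max (\<lambda>i. influence n i (restrict_path f q)) (\<lambda>i. i < n) (v q)" for q
      by metis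
    obtain p where p: "is_arg_max (\<lambda>q. (1 / 2) ^ length q * influence n (v q) (restrict_path f q))
        (\<lambda>q. q \<in> leaf_paths T) p"
      using ex_is_arg_max_finite[OF finite_leaf_paths leaf_paths_nonempty] by metis
    have "split_leaf T p (v p) \<in> ?R"
      using top_down_tree.step[of n f \<epsilon> T v p] T(1) na v p by auto
    then show False
      using T(2) dtree_size_split_leaf[of p T "v p"] p by (fastforce simp: is_arg_max_def)
  qed
  then show ?thesis
    using T(1) by (auto simp: top_down_outputs_def)
qed

text \<open>The only contact of the lower bounds with the algorithm: a bound for all greedy trees
  covers every way of breaking ties.\<close>

lemma top_down_dt_size_ge:
  assumes "0 < n" "f \<in> hypercube n \<rightarrow> {-1, 1}" "0 \<le> \<epsilon>"
    and "\<And>T :: unit dtree. greedy n T f \<Longrightarrow> approximates n \<epsilon> (completion n T f) f \<Longrightarrow> b \<le> real (dtree_size T)"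
  shows "b \<le> real (top_down_dt_size n f \<epsilon>)"
proof -
  have "\<exists>m. \<exists>T\<in>top_down_outputs n f \<epsilon>. dtree_size T = m"
    using top_down_outputs_nonempty[OF assms(1-3)] by auto
  then have "\<exists>T\<in>top_down_outputs n f \<epsilon>. dtree_size T = top_down_dt_size n f \<epsilon>"
    unfolding top_down_dt_size_def by (rule LeastI_ex)
  then show ?thesis
    using assms(4) top_down_tree_greedy[OF _ assms(2,3)]
    by (fastforce simp: top_down_outputs_def)
qed

definition exact_on :: "nat \<Rightarrow> unit dtree \<Rightarrow> ((nat \<Rightarrow> bool) \<Rightarrow> real) \<Rightarrow> bool" where
  "exact_on n T f \<longleftrightarrow> (\<forall>x\<in>hypercube n. eval_dtree (completion n T f) x = f x)"

lemma exact_on_iff: "exact_on n T f \<longleftrightarrow> approximates n 0 (completion n T f) f"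
  unfolding approximates_iff exact_on_def
  using cube_prob_nonneg[of n "\<lambda>x. eval_dtree (completion n T f) x \<noteq> f x"]
    cube_prob_eq_0_iff[of n "\<lambda>x. eval_dtree (completion n T f) x \<noteq> f x"] by linarith

lemma exact_on_Query:
  assumes "greedy n (Query i l r) f" "exact_on n (Query i l r) f"
  shows "exact_on n l (restrict_var f i False)" "exact_on n r (restrict_var f i True)"
proof -
  have i: "i < n" "i \<notin> dtree_vars l" "i \<notin> dtree_vars r"
    using assms(1) greedy_read_once[OF assms(1)] by auto
  have ex: "eval_dtree (completion n (Query i l r) f) (x(i := b)) = f (x(i := b))"
    if "x \<in> hypercube n" for x b
    using assms(2) update_in_hypercube[OF that i(1), of b] unfolding exact_on_def by blast
  show "exact_on n l (restrict_var f i False)"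
    unfolding exact_on_def using ex[of _ False] i
    by (auto simp: eval_dtree_update restrict_var_def)
  show "exact_on n r (restrict_var f i True)"
    unfolding exact_on_def using ex[of _ True] i
    by (auto simp: eval_dtree_update restrict_var_def)
qed

lemma exact_on_Leaf:
  assumes "exact_on n (Leaf u) f" "i < n"
  shows "influence n i f = 0"
  unfolding influence_eq_0_iff
proof
  fix x
  assume x: "x \<in> hypercube n"
  then show "f x = f (x(i := \<not> x i))"
    using assms(1) update_in_hypercube[OF x assms(2)] unfolding exact_on_def
    by (metis completion.simps(1) eval_dtree.simps(1))
qed

section \<open>Optimal size of monotone functions\<close>

lemma depends_only_coordinate: "i \<in> S \<Longrightarrow> depends_only S (\<lambda>x. x i)"
  by (simp add: depends_only_def)

lemma depends_only_conj:
  "depends_only S P \<Longrightarrow> depends_only S Q \<Longrightarrow> depends_only S (\<lambda>x. P x \<and> Q x)"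
  by (rule depends_only_comp2)

lemma depends_only_disj:
  "depends_only S P \<Longrightarrow> depends_only S Q \<Longrightarrow> depends_only S (\<lambda>x. P x \<or> Q x)"
  by (rule depends_only_comp2)

definition pm :: "bool \<Rightarrow> real" where
  "pm b = (if b then 1 else - 1)"

lemma pm_eq_iff [simp]: "pm a = pm b \<longleftrightarrow> a = b"
  by (auto simp: pm_def)

text \<open>Boolean trees over arbitrary variables, correct on all assignments: this keeps
  \<open>n\<close> out of the size calculations. \<open>optimal_dt_size_pm\<close> transfers the
  results.\<close>

definition dt_size :: "((nat \<Rightarrow> bool) \<Rightarrow> bool) \<Rightarrow> nat" where
  "dt_size F = (LEAST m. \<exists>T. eval_dtree T = F \<and> dtree_size T = m)"

lemma dt_size_le: "eval_dtree T = F \<Longrightarrow> dt_size F \<le> dtree_size T"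
  unfolding dt_size_def by (rule Least_le) auto

lemma dtree_size_eq_1D: "dtree_size T = 1 \<Longrightarrow> \<exists>u. T = Leaf u"
proof (cases T)
  case (Query i l r)
  then show "dtree_size T = 1 \<Longrightarrow> ?thesis"
    using dtree_size_pos[of l] dtree_size_pos[of r] by simp
qed simp

lemma dt_size_const: "dt_size (\<lambda>_. b) = 1"
proof -
  have "dt_size (\<lambda>_. b) \<le> 1"
    using dt_size_le[of "Leaf b"] by (simp add: fun_eq_iff)
  moreover have "\<exists>m. \<exists>T. eval_dtree T = (\<lambda>_. b) \<and> dtree_size T = m"
    by (auto simp: fun_eq_iff intro!: exI[of _ "Leaf b"])
  then have "\<exists>T. eval_dtree T = (\<lambda>_. b) \<and> dtree_size T = dt_size (\<lambda>_. b)"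
    unfolding dt_size_def by (rule LeastI_ex)
  ultimately show ?thesis
    by (metis dtree_size_pos le_antisym less_eq_Suc_le One_nat_def)
qed

lemma ex_dtree:
  assumes "finite S" "depends_only S F"
  shows "\<exists>T. eval_dtree T = F \<and> dtree_size T \<le> 2 ^ card S"
  using assms
proof (induction S arbitrary: F rule: finite_induct)
  case empty
  then have "F = (\<lambda>_. F (\<lambda>_. True))"
    unfolding depends_only_def by fast
  then obtain c where "F = (\<lambda>_. c)" ..
  then have "eval_dtree (Leaf c) = F"
    by (simp add: fun_eq_iff)
  then show ?case
    by (intro exI[of _ "Leaf c"]) simp
next
  case (insert i S)
  have "depends_only S (\<lambda>x. F (x(i := b)))" for b
    by (rule depends_onlyI, rule depends_onlyD[OF insert.prems]) auto
  then have "\<exists>T. eval_dtree T = (\<lambda>x. F (x(i := b))) \<and> dtree_size T \<le> 2 ^ card S" for b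
    by (rule insert.IH)
  then obtain T where T: "eval_dtree (T b) = (\<lambda>x. F (x(i := b)))" "dtree_size (T b) \<le> 2 ^ card S"
    for b by metis
  have upd: "x(i := x i) = x" for x :: "nat \<Rightarrow> bool" by simp
  have "eval_dtree (Query i (T False) (T True)) x = F x" for x
    using upd[of x] by (cases "x i") (auto simp: T)
  then show ?case
    using T(2)[of True] T(2)[of False] insert.hyps
    by (intro exI[of _ "Query i (T False) (T True)"]) auto
qed

lemma dt_size_witness:
  assumes "finite S" "depends_only S F"
  obtains T where "eval_dtree T = F" "dtree_size T = dt_size F"
proof -
  have "\<exists>m. \<exists>T. eval_dtree T = F \<and> dtree_size T = m"
    using ex_dtree[OF assms] by blast
  then have "\<exists>T. eval_dtree T = F \<and> dtree_size T = dt_size F"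
    unfolding dt_size_def by (rule LeastI_ex)
  then show ?thesis
    using that by blast
qed

primrec relevant_part :: "nat set \<Rightarrow> 'a dtree \<Rightarrow> 'a dtree" where
  "relevant_part S (Leaf u) = Leaf u"
| "relevant_part S (Query i l r) =
     (if i \<in> S then Query i (relevant_part S l) (relevant_part S r) else relevant_part S l)"

lemma eval_relevant_part:
  "eval_dtree (relevant_part S T) x = eval_dtree T (\<lambda>i. i \<in> S \<and> x i)"
  by (induction T) auto

lemma dtree_vars_relevant_part: "dtree_vars (relevant_part S T) \<subseteq> S"
  by (induction T) auto

lemma dtree_size_relevant_part: "dtree_size (relevant_part S T) \<le> dtree_size T"
  by (induction T) auto

lemma eval_dtree_map: "eval_dtree (map_dtree h T) x = h (eval_dtree T x)"
  by (induction T) auto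

lemma dtree_vars_map [simp]: "dtree_vars (map_dtree h T) = dtree_vars T"
  by (induction T) auto

lemma dtree_size_map [simp]: "dtree_size (map_dtree h T) = dtree_size T"
  by (induction T) auto

lemma optimal_dt_size_pm:
  assumes "depends_only {..<n} F"
  shows "optimal_dt_size n (\<lambda>x. pm (F x)) = dt_size F"
proof (rule antisym)
  obtain T where T: "eval_dtree T = F" "dtree_size T = dt_size F"
    using dt_size_witness[OF _ assms] by blast
  let ?T = "relevant_part {..<n} T"
  have "eval_dtree ?T x = F x" for x
    unfolding eval_relevant_part T by (rule depends_onlyD[OF assms]) auto
  then have "optimal_dt_size n (\<lambda>x. pm (F x)) \<le> dtree_size (map_dtree pm ?T)"
    unfolding optimal_dt_size_def
    by (intro Least_le exI[of _ "map_dtree pm ?T"])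
      (use dtree_vars_relevant_part in \<open>auto simp: eval_dtree_map\<close>)
  also have "\<dots> \<le> dt_size F"
    using dtree_size_relevant_part[of "{..<n}" T] T by simp
  finally show "optimal_dt_size n (\<lambda>x. pm (F x)) \<le> dt_size F" .
  let ?P = "\<lambda>m. \<exists>T. dtree_vars T \<subseteq> {..<n} \<and> (\<forall>x\<in>hypercube n. eval_dtree T x = pm (F x)) \<and>
    dtree_size T = m"
  have "?P (dtree_size (map_dtree pm ?T))"
    using \<open>\<And>x. eval_dtree ?T x = F x\<close> dtree_vars_relevant_part[of "{..<n}" T]
    by (intro exI[of _ "map_dtree pm ?T"]) (simp add: eval_dtree_map)
  then have "?P (optimal_dt_size n (\<lambda>x. pm (F x)))"
    unfolding optimal_dt_size_def by (rule LeastI)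
  then obtain T' where T': "dtree_vars T' \<subseteq> {..<n}"
    "\<And>x. x \<in> hypercube n \<Longrightarrow> eval_dtree T' x = pm (F x)"
    "dtree_size T' = optimal_dt_size n (\<lambda>x. pm (F x))"
    by blast
  have "eval_dtree (map_dtree (\<lambda>v. v = 1) T') x = F x" for x
  proof -
    \<comment> \<open>A tree over \<open>{..<n}\<close> cannot distinguish \<open>x\<close> from its
      restriction, which lies in the cube.\<close>
    let ?x = "restrict x {..<n}"
    have "eval_dtree (map_dtree (\<lambda>v. v = 1) T') x = (eval_dtree T' ?x = 1)"
      using T'(1) unfolding eval_dtree_map
      by (intro arg_cong[of _ _ "\<lambda>v. v = 1"] eval_dtree_cong) auto
    also have "\<dots> = F ?x"
      by (subst T'(2)) (auto simp: hypercube_def pm_def)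
    also have "\<dots> = F x"
      by (rule depends_onlyD[OF assms]) auto
    finally show ?thesis .
  qed
  then show "dt_size F \<le> optimal_dt_size n (\<lambda>x. pm (F x))"
    using dt_size_le[of "map_dtree (\<lambda>v. v = 1) T'" F] T'(3) by (simp add: fun_eq_iff)
qed

section \<open>Leaves that are reached under a restriction\<close>

primrec leaf_of :: "'a dtree \<Rightarrow> (nat \<Rightarrow> bool) \<Rightarrow> (nat \<times> bool) list" where
  "leaf_of (Leaf u) x = []"
| "leaf_of (Query i l r) x = (i, x i) # (if x i then leaf_of r x else leaf_of l x)"

lemma leaf_of_in_leaf_paths: "leaf_of T x \<in> leaf_paths T"
  by (induction T) auto

lemma card_leaf_paths: "card (leaf_paths T) \<le> dtree_size T"
proof (induction T)
  case (Query i l r)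
  have "card (leaf_paths (Query i l r))
      \<le> card ((#) (i, False) ` leaf_paths l) + card ((#) (i, True) ` leaf_paths r)"
    by (simp add: card_Un_le)
  also have "\<dots> \<le> card (leaf_paths l) + card (leaf_paths r)"
    by (intro add_mono card_image_le) auto
  finally show ?case
    using Query.IH by simp
qed simp

lemma card_leaf_of_le: "card (leaf_of T ` S) \<le> dtree_size T"
  by (rule order_trans[OF card_mono card_leaf_paths]) (auto simp: leaf_of_in_leaf_paths)

lemma finite_leaf_of_image [simp]: "finite (leaf_of T ` S)"
  by (rule finite_subset[OF _ finite_leaf_paths[of T]]) (auto simp: leaf_of_in_leaf_paths)

lemma eval_dtree_mix:
  assumes "leaf_of T x = leaf_of T y" "\<And>i. z i = x i \<or> z i = y i"
  shows "eval_dtree T z = eval_dtree T x"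
  using assms(1)
proof (induction T)
  case (Query i l r)
  then have xy: "x i = y i" by simp
  then have "z i = x i"
    using assms(2)[of i] by simp
  then show ?case
    using Query xy by (cases "x i") simp_all
qed simp

text \<open>Pruning the branches that contradict the fixed values keeps exactly the leaves reached
  by consistent inputs. Counting them as an image of \<open>leaf_of\<close> allows several
  restrictions of the same tree to be compared later. The case \<open>D = {}\<close> makes a tree
  read-once.\<close>

lemma reached_subtree:
  "\<exists>T'. read_once T' \<and> dtree_vars T' \<inter> D = {} \<and>
     (\<forall>x. (\<forall>i\<in>D. x i = a i) \<longrightarrow> eval_dtree T' x = eval_dtree T x) \<and>
     dtree_size T' = card (leaf_of T ` {x. \<forall>i\<in>D. x i = a i})"
proof (induction T arbitrary: D a)
  case (Leaf u)
  have "leaf_of (Leaf u) ` {x. \<forall>i\<in>D. x i = a i} = {[]}"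
    by (auto simp: image_def intro!: exI[of _ a])
  then show ?case
    by (intro exI[of _ "Leaf u"]) auto
next
  case (Query i l r)
  let ?S = "\<lambda>D a. {x. \<forall>i\<in>D. x i = (a i :: bool)}"
  show ?case
  proof (cases "i \<in> D")
    case True
    let ?T = "if a i then r else l"
    have "leaf_of (Query i l r) ` ?S D a = (#) (i, a i) ` leaf_of ?T ` ?S D a"
      unfolding image_image by (rule image_cong) (use True in auto)
    moreover have "card ((#) (i, a i) ` leaf_of ?T ` ?S D a) = card (leaf_of ?T ` ?S D a)"
      by (rule card_image) auto
    moreover obtain T' where "read_once T'" "dtree_vars T' \<inter> D = {}"
        "\<forall>x. (\<forall>i\<in>D. x i = a i) \<longrightarrow> eval_dtree T' x = eval_dtree ?T x"
        "dtree_size T' = card (leaf_of ?T ` ?S D a)"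
      using Query.IH(1)[of D a] Query.IH(2)[of D a] by (cases "a i") auto
    ultimately show ?thesis
      using True by (intro exI[of _ T']) auto
  next
    case False
    \<comment> \<open>From here on \<open>i\<close> counts as fixed, so further queries to it are
      pruned as well and the result is read-once.\<close>
    let ?D = "insert i D"
    obtain T0 where T0: "read_once T0" "dtree_vars T0 \<inter> ?D = {}"
        "\<forall>x. (\<forall>j\<in>?D. x j = (a(i := False)) j) \<longrightarrow> eval_dtree T0 x = eval_dtree l x"
        "dtree_size T0 = card (leaf_of l ` ?S ?D (a(i := False)))"
      using Query.IH(1)[of ?D "a(i := False)"] by auto
    obtain T1 where T1: "read_once T1" "dtree_vars T1 \<inter> ?D = {}"
        "\<forall>x. (\<forall>j\<in>?D. x j = (a(i := True)) j) \<longrightarrow> eval_dtree T1 x = eval_dtree r x"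
        "dtree_size T1 = card (leaf_of r ` ?S ?D (a(i := True)))"
      using Query.IH(2)[of ?D "a(i := True)"] by auto
    have "?S D a = ?S ?D (a(i := False)) \<union> ?S ?D (a(i := True))"
      using False by auto
    then have e1: "leaf_of (Query i l r) ` ?S D a
        = (#) (i, False) ` leaf_of l ` ?S ?D (a(i := False)) \<union>
          (#) (i, True) ` leaf_of r ` ?S ?D (a(i := True))"
      unfolding image_image by (simp only: image_Un) (intro arg_cong2[of _ _ _ _ "(\<union>)"] image_cong; auto)
    have e2: "card ((#) (i, False) ` leaf_of l ` ?S ?D (a(i := False)) \<union>
          (#) (i, True) ` leaf_of r ` ?S ?D (a(i := True)))
        = card ((#) (i, False) ` leaf_of l ` ?S ?D (a(i := False))) +
        card ((#) (i, True) ` leaf_of r ` ?S ?D (a(i := True)))"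
      by (rule card_Un_disjoint) auto
    have e3: "card ((#) (i, b) ` leaf_of T ` S) = card (leaf_of T ` S)" for b and T :: "'a dtree" and S
      by (rule card_image) auto
    have "card (leaf_of (Query i l r) ` ?S D a) = dtree_size (Query i T0 T1)"
      unfolding e1 e2 e3 dtree_size.simps T0(4) T1(4) ..
    moreover have "eval_dtree (Query i T0 T1) x = eval_dtree (Query i l r) x"
      if "\<forall>j\<in>D. x j = a j" for x
      using T0(3) T1(3) that False by (auto simp: fun_upd_def)
    ultimately show ?thesis
      using T0(1,2) T1(1,2) False by (intro exI[of _ "Query i T0 T1"]) auto
  qed
qed

lemma dt_size_le_reached:
  assumes "\<And>x. G x = eval_dtree T (override_on x a D)"
  shows "dt_size G \<le> card (leaf_of T ` {x. \<forall>i\<in>D. x i = a i})"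
proof -
  obtain T' where T': "dtree_vars T' \<inter> D = {}"
      "\<And>x. (\<forall>i\<in>D. x i = a i) \<Longrightarrow> eval_dtree T' x = eval_dtree T x"
      "dtree_size T' = card (leaf_of T ` {x. \<forall>i\<in>D. x i = a i})"
    using reached_subtree[of D a T] by blast
  have "eval_dtree T' x = G x" for x
  proof -
    have "eval_dtree T' x = eval_dtree T' (override_on x a D)"
      using T'(1) by (intro eval_dtree_cong) (auto simp: override_on_def)
    then show ?thesis
      using T'(2)[of "override_on x a D"] assms by simp
  qed
  then show ?thesis
    using dt_size_le[of T' G] T'(3) by (simp add: fun_eq_iff)
qed

lemma read_once_witness:
  assumes "finite S" "depends_only S F"
  obtains T where "eval_dtree T = F" "dtree_size T = dt_size F" "read_once T"
proof -
  obtain T where T: "eval_dtree T = F" "dtree_size T = dt_size F"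
    using dt_size_witness[OF assms] .
  obtain T' where T': "read_once T'" "eval_dtree T' = F"
      "dtree_size T' = card (leaf_of T ` UNIV)"
    using reached_subtree[of "{}" "\<lambda>_. True" T] T(1) by (auto simp: fun_eq_iff)
  have "dtree_size T' = dt_size F"
    using dt_size_le[OF T'(2)] T'(3) card_leaf_of_le[of T UNIV] T(2) by linarith
  then show ?thesis
    using T' that by blast
qed

text \<open>Gadgets that change the optimal size by an exactly known amount. Two inputs that reach the
  same leaf can be mixed coordinatewise without leaving that leaf; this separates the leaves
  belonging to different restrictions.\<close>

definition monotone_nonconst :: "((nat \<Rightarrow> bool) \<Rightarrow> bool) \<Rightarrow> bool" where
  "monotone_nonconst F \<longleftrightarrow> mono F \<and> F (\<lambda>_. True) \<and> \<not> F (\<lambda>_. False)"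

lemma dt_size_and:
  assumes S: "finite S" "depends_only S F" and z: "z \<notin> S" and F: "monotone_nonconst F"
  shows "dt_size (\<lambda>x. x z \<and> F x) = dt_size F + 1"
proof (rule antisym)
  let ?G = "\<lambda>x. x z \<and> F x"
  obtain TF where TF: "eval_dtree TF = F" "dtree_size TF = dt_size F"
    using dt_size_witness[OF S] .
  show "dt_size ?G \<le> dt_size F + 1"
    using dt_size_le[of "Query z (Leaf False) TF" ?G] TF by (auto simp: fun_eq_iff)
  have "depends_only (insert z S) ?G"
    by (intro depends_only_conj depends_only_coordinate depends_only_mono[OF S(2)]) auto
  then obtain T where T: "eval_dtree T = ?G" "dtree_size T = dt_size ?G"
    using dt_size_witness[of "insert z S" ?G] S(1) by blast
  let ?A = "leaf_of T ` {x. \<forall>i\<in>{z}. x i = True}"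
  \<comment> \<open>All ones except at \<open>z\<close>, with value 0. If it shared a leaf with an
    input that has \<open>z = 1\<close>, then \<open>z\<close> could be raised without leaving the
    leaf, which gives value 1.\<close>
  define x0 where "x0 = (\<lambda>i. i \<noteq> z)"
  have "dt_size F \<le> card ?A"
    by (rule dt_size_le_reached[of F T "\<lambda>_. True" "{z}"])
      (auto simp: T override_on_def intro!: depends_onlyD[OF S(2)] dest: z[THEN notE])
  moreover have "leaf_of T x0 \<notin> ?A"
  proof
    assume "leaf_of T x0 \<in> ?A"
    then obtain y where y: "leaf_of T x0 = leaf_of T y" "y z" by auto
    have "eval_dtree T (\<lambda>_. True) = eval_dtree T x0"
      by (rule eval_dtree_mix[OF y(1)]) (use y(2) in \<open>auto simp: x0_def\<close>)
    then show False
      using F by (simp add: T x0_def monotone_nonconst_def)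
  qed
  moreover have "card (insert (leaf_of T x0) ?A) \<le> dtree_size T"
    using card_leaf_of_le[of T "insert x0 {x. \<forall>i\<in>{z}. x i = True}"] by simp
  ultimately show "dt_size F + 1 \<le> dt_size ?G"
    using T(2) by simp
qed

text \<open>This is the majority of \<open>z\<close>, \<open>w\<close> and \<open>F\<close>. The
  inputs with only \<open>z\<close> set and those with only \<open>w\<close> set each need the
  leaves of a tree for \<open>F\<close>, and no leaf serves both; the cases \<open>z = w = 0\<close>
  and \<open>z = w = 1\<close> need one further leaf each.\<close>

lemma dt_size_maj:
  assumes S: "finite S" "depends_only S F" and zw: "z \<notin> S" "w \<notin> S" "z \<noteq> w"
    and F: "monotone_nonconst F"
  shows "dt_size (\<lambda>x. x z \<and> x w \<or> x z \<and> F x \<or> x w \<and> F x) = 2 * dt_size F + 2"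
proof (rule antisym)
  let ?G = "\<lambda>x. x z \<and> x w \<or> x z \<and> F x \<or> x w \<and> F x"
  obtain TF where TF: "eval_dtree TF = F" "dtree_size TF = dt_size F"
    using dt_size_witness[OF S] .
  show "dt_size ?G \<le> 2 * dt_size F + 2"
    using dt_size_le[of "Query z (Query w (Leaf False) TF) (Query w TF (Leaf True))" ?G] TF
    by (auto simp: fun_eq_iff mult_2)
  have "depends_only (insert z (insert w S)) ?G"
    by (intro depends_only_conj depends_only_disj depends_only_coordinate depends_only_mono[OF S(2)]) auto
  then obtain T where T: "eval_dtree T = ?G" "dtree_size T = dt_size ?G"
    using dt_size_witness[of "insert z (insert w S)" ?G] S(1) by auto
  let ?D = "\<lambda>b. {x. \<forall>i\<in>{z, w}. x i = (if i = z then b else \<not> b)}"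
  let ?A = "\<lambda>b. leaf_of T ` ?D b"
  \<comment> \<open>\<open>x0\<close> and \<open>x1\<close> have the values 0 and 1, but their other
    coordinates are extreme in the opposite direction: making \<open>z\<close> and \<open>w\<close>
    different lets \<open>F\<close> decide and flips the value.\<close>
  define x0 where "x0 = (\<lambda>i. i \<noteq> z \<and> i \<noteq> w)"
  define x1 where "x1 = (\<lambda>i. i = z \<or> i = w)"
  have upd: "F (override_on x a {z, w}) = F x" for x a
    by (rule depends_onlyD[OF S(2)]) (use zw in \<open>auto simp: override_on_def\<close>)
  have A: "dt_size F \<le> card (?A b)" for b
    by (rule dt_size_le_reached[of F T "\<lambda>i. if i = z then b else \<not> b" "{z, w}"])
      (unfold T upd, use zw(3) in \<open>auto simp: override_on_def\<close>)
  have F1: "F x" if "\<And>i. i \<in> S \<Longrightarrow> x i" for x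
    using F depends_onlyD[OF S(2), of x "\<lambda>_. True"] that by (simp add: monotone_nonconst_def)
  have F0: "\<not> F x" if "\<And>i. i \<in> S \<Longrightarrow> \<not> x i" for x
    using F depends_onlyD[OF S(2), of x "\<lambda>_. False"] that by (simp add: monotone_nonconst_def)
  have x0: "leaf_of T x0 \<notin> ?A b" for b
  proof
    assume "leaf_of T x0 \<in> ?A b"
    then obtain y where y: "leaf_of T x0 = leaf_of T y" "y z = b" "y w = (\<not> b)"
      using zw(3) by auto
    have "eval_dtree T (x0(z := b, w := \<not> b)) = eval_dtree T x0"
      by (rule eval_dtree_mix[OF y(1)]) (use y(2,3) in auto)
    moreover have "F (x0(z := b, w := \<not> b))"
      by (rule F1) (use zw in \<open>auto simp: x0_def\<close>)
    ultimately show False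
      using zw by (cases b) (auto simp: T x0_def)
  qed
  have x1: "leaf_of T x1 \<notin> ?A b" for b
  proof
    assume "leaf_of T x1 \<in> ?A b"
    then obtain y where y: "leaf_of T x1 = leaf_of T y" "y z = b" "y w = (\<not> b)"
      using zw(3) by auto
    have "eval_dtree T (x1(z := b, w := \<not> b)) = eval_dtree T x1"
      by (rule eval_dtree_mix[OF y(1)]) (use y(2,3) in auto)
    moreover have "\<not> F (x1(z := b, w := \<not> b))"
      by (rule F0) (use zw in \<open>auto simp: x1_def\<close>)
    ultimately show False
      using zw by (cases b) (auto simp: T x1_def)
  qed
  have x01: "leaf_of T x0 \<noteq> leaf_of T x1"
    using eval_dtree_mix[of T x0 x1 x1] by (auto simp: T x0_def x1_def)
  have disj: "?A True \<inter> ?A False = {}"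
  proof (rule equals0I)
    fix p
    assume "p \<in> ?A True \<inter> ?A False"
    then obtain x y where xy: "leaf_of T x = leaf_of T y" "x z" "\<not> x w" "\<not> y z" "y w"
      using zw(3) by auto
    \<comment> \<open>Without leaving the common leaf one could pass to \<open>z = w = 1\<close> and
      to \<open>z = w = 0\<close>, where the values are 1 and 0.\<close>
    have "eval_dtree T (x(w := True)) = eval_dtree T x"
      by (rule eval_dtree_mix[OF xy(1)]) (use xy in auto)
    moreover have "eval_dtree T (x(z := False)) = eval_dtree T x"
      by (rule eval_dtree_mix[OF xy(1)]) (use xy in auto)
    ultimately show False
      using xy zw(3) by (simp add: T)
  qed
  have "card (?A True) + card (?A False) + 2
      = card (insert (leaf_of T x0) (insert (leaf_of T x1) (?A True \<union> ?A False)))"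
    using x0[of True] x0[of False] x1[of True] x1[of False] x01 card_Un_disjoint[OF _ _ disj]
    by simp
  also have "\<dots> \<le> dtree_size T"
    using card_leaf_of_le[of T "insert x0 (insert x1 (?D True \<union> ?D False))"]
    by (simp add: image_Un)
  finally show "2 * dt_size F + 2 \<le> dt_size ?G"
    using A[of True] A[of False] T(2) by simp
qed

section \<open>Monotone functions of every prescribed optimal size\<close>

lemma ex_dt_size_linear:
  assumes "2 \<le> t" "finite V" "t - 1 \<le> card V"
  shows "\<exists>g. depends_only V g \<and> monotone_nonconst g \<and> dt_size g = t"
  using assms
proof (induction t arbitrary: V rule: nat_induct_at_least)
  case base
  then obtain v where v: "v \<in> V"
    by fastforce
  let ?g = "\<lambda>x :: nat \<Rightarrow> bool. x v"
  have dep: "depends_only {v} ?g"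
    by (simp add: depends_only_def)
  obtain T where T: "eval_dtree T = ?g" "dtree_size T = dt_size ?g"
    using dt_size_witness[OF _ dep] by auto
  have "dtree_size T \<noteq> 1"
  proof
    assume "dtree_size T = 1"
    then obtain u where "T = Leaf u"
      using dtree_size_eq_1D by blast
    then show False
      using fun_cong[OF T(1), of "\<lambda>_. True"] fun_cong[OF T(1), of "\<lambda>_. False"] by auto
  qed
  moreover have "dt_size ?g \<le> 2"
    using dt_size_le[of "Query v (Leaf False) (Leaf True)" ?g] by (simp add: fun_eq_iff numeral_2_eq_2)
  ultimately have "dt_size ?g = 2"
    using T(2) dtree_size_pos[of T] by linarith
  then show ?case
    using v depends_only_mono[OF dep, of V]
    by (intro exI[of _ ?g]) (simp add: monotone_nonconst_def mono_def le_fun_def)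
next
  case (Suc t)
  have "V \<noteq> {}"
    using Suc.hyps Suc.prems by (intro notI) simp
  then obtain v where v: "v \<in> V" by blast
  then have "t - 1 \<le> card (V - {v})"
    using Suc.prems by simp
  then obtain g where g: "depends_only (V - {v}) g" "monotone_nonconst g" "dt_size g = t"
    using Suc.IH[of "V - {v}"] Suc.prems by auto
  let ?g = "\<lambda>x. x v \<and> g x"
  have "dt_size ?g = Suc t"
    using dt_size_and[OF _ g(1) _ g(2), of v] Suc.prems g(3) by simp
  moreover have "depends_only V ?g"
    by (intro depends_only_conj depends_only_coordinate[OF v] depends_only_mono[OF g(1)]) auto
  moreover have "monotone_nonconst ?g"
    using g(2) by (auto simp: monotone_nonconst_def mono_def le_fun_def)
  ultimately show ?case by blast
qed

text \<open>Binary expansion of \<open>t\<close>: the majority gadget turns size \<open>t'\<close>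
  into \<open>2 * t' + 2\<close>, and a conjunction adds 1 if \<open>t\<close> is odd. One bit costs
  three variables, \<open>z\<close> and \<open>w\<close> for the majority and \<open>u\<close> for
  the conjunction.\<close>

lemma ex_dt_size:
  assumes "2 \<le> t" "t \<le> 2 ^ k" "finite V" "3 * k - 2 \<le> card V"
  shows "\<exists>g. depends_only V g \<and> monotone_nonconst g \<and> dt_size g = t"
  using assms
proof (induction k arbitrary: t V)
  case (Suc k)
  show ?case
  \<comment> \<open>Below 6 the halved size \<open>t div 2 - 1\<close> would drop under 2, the
    smallest size of a nonconstant function; here a conjunction of \<open>t - 1\<close> variables
    has few enough variables.\<close>
  proof (cases "t \<le> 5")
    case True
    have "t - 1 \<le> 3 * Suc k - 2"
    proof (cases "k \<le> 1")
      case True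
      then have "k = 0 \<or> k = 1" by auto
      then show ?thesis using Suc.prems by auto
    qed (use True in simp)
    then show ?thesis
      using Suc.prems by (intro ex_dt_size_linear) auto
  next
    case False
    have "k \<noteq> 0"
      using False Suc.prems(2) by (cases k) auto
    then have "3 \<le> card V"
      using Suc.prems(4) by simp
    then obtain A where A: "A \<subseteq> V" "card A = 3"
      by (meson obtain_subset_with_card_n)
    then obtain u z w where uzw: "A = {u, z, w}" "u \<noteq> z" "u \<noteq> w" "z \<noteq> w"
      unfolding card_3_iff by blast
    define W where "W = V - A"
    have W: "finite W" "3 * k - 2 \<le> card W" "W \<subseteq> V" "u \<notin> W" "z \<notin> W" "w \<notin> W"
      using Suc.prems A uzw \<open>k \<noteq> 0\<close> by (auto simp: W_def card_Diff_subset finite_subset)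
    define t' where "t' = t div 2 - 1"
    have "2 \<le> t'" "t' \<le> 2 ^ k"
      using False Suc.prems(2) unfolding t'_def power_Suc by linarith+
    then obtain g where g: "depends_only W g" "monotone_nonconst g" "dt_size g = t'"
      using Suc.IH[of t' W] W by auto
    let ?m = "\<lambda>x. x z \<and> x w \<or> x z \<and> g x \<or> x w \<and> g x"
    have m: "dt_size ?m = 2 * t' + 2"
      using dt_size_maj[OF W(1) g(1) W(5,6) uzw(4) g(2)] g(3) by simp
    have depm: "depends_only (insert z (insert w W)) ?m"
      by (intro depends_only_conj depends_only_disj depends_only_coordinate depends_only_mono[OF g(1)]) auto
    have monom: "monotone_nonconst ?m"
      using g(2) unfolding monotone_nonconst_def mono_def le_fun_def le_bool_def by blast
    have sub: "insert z (insert w W) \<subseteq> V"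
      using A uzw W by auto
    show ?thesis
    proof (cases "even t")
      case True
      then have "2 * t' + 2 = t"
        using False by (auto simp: t'_def)
      then show ?thesis
        using m depm monom depends_only_mono[OF _ sub] by blast
    next
      case odd: False
      then have "2 * t' + 3 = t"
        using False by (auto simp: t'_def elim!: oddE)
      moreover have "dt_size (\<lambda>x. x u \<and> ?m x) = dt_size ?m + 1"
        by (rule dt_size_and[OF _ depm _ monom]) (use W uzw in auto)
      moreover have "monotone_nonconst (\<lambda>x. x u \<and> ?m x)"
        using monom unfolding monotone_nonconst_def mono_def le_fun_def le_bool_def by blast
      moreover have "depends_only V (\<lambda>x. x u \<and> ?m x)"
        using A(1) uzw(1)
        by (intro depends_only_conj depends_only_coordinate depends_only_mono[OF depm sub]) auto
      ultimately show ?thesis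
        using m by (intro exI[of _ "\<lambda>x. x u \<and> ?m x"]) simp
    qed
  qed
qed simp

section \<open>Optimal size of gated functions\<close>

text \<open>A monotone multiplexer. On a typical input \<open>U\<close> is not all 1 and
  \<open>Z\<close> is not all 0, and then \<open>H\<close> decides; \<open>g\<close> is visible only
  if both exceptions occur. The two mixed cases are filled with constants that keep the function
  monotone.\<close>

definition gated :: "nat set \<Rightarrow> nat set \<Rightarrow> ((nat \<Rightarrow> bool) \<Rightarrow> bool) \<Rightarrow> ((nat \<Rightarrow> bool) \<Rightarrow> bool) \<Rightarrow>
    (nat \<Rightarrow> bool) \<Rightarrow> bool" where
  "gated U Z H g x \<longleftrightarrow> (\<forall>i\<in>U. x i) \<and> (\<exists>i\<in>Z. x i) \<or> (\<exists>i\<in>Z. x i) \<and> H x \<or> (\<forall>i\<in>U. x i) \<and> g x"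

text \<open>The cost of a way to certify that all of \<open>U\<close> is 1 and all of \<open>Z\<close> is 0: the variables are
  queried one after the other, and each query that deviates is followed by an optimal tree.\<close>

inductive path_cost :: "((nat \<Rightarrow> bool) \<Rightarrow> bool) \<Rightarrow> nat set \<Rightarrow> nat set \<Rightarrow> nat \<Rightarrow> bool"
  for H :: "(nat \<Rightarrow> bool) \<Rightarrow> bool" where
  finished: "path_cost H {} {} 0"
| query_one: "i \<in> U \<Longrightarrow> path_cost H (U - {i}) Z c \<Longrightarrow>
    path_cost H U Z (c + dt_size (\<lambda>x. (\<exists>j\<in>Z. x j) \<and> H x))"
| query_zero: "i \<in> Z \<Longrightarrow> path_cost H U (Z - {i}) c \<Longrightarrow>
    path_cost H U Z (c + dt_size (\<lambda>x. (\<forall>j\<in>U. x j) \<or> H x))"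

lemma path_cost_zeros: "finite Z \<Longrightarrow> path_cost H {} Z (card Z)"
proof (induction Z rule: finite_induct)
  case (insert i Z)
  have "path_cost H {} (insert i Z - {i}) (card Z)"
    using insert by simp
  from path_cost.query_zero[of i, OF _ this] show ?case
    using insert by (simp add: dt_size_const)
qed (simp add: path_cost.finished)

lemma path_cost_ones: "finite U \<Longrightarrow> path_cost H U {} (card U)"
proof (induction U rule: finite_induct)
  case (insert i U)
  have "path_cost H (insert i U - {i}) {} (card U)"
    using insert by simp
  from path_cost.query_one[of i, OF _ this] show ?case
    using insert by (simp add: dt_size_const)
qed (simp add: path_cost.finished)

text \<open>One admissible order, so that the minimum below is attained. Once all of
  \<open>U\<close> is confirmed, a 1 in \<open>Z\<close> makes the function constant, hence each
  query to \<open>Z\<close> costs a single leaf.\<close>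

lemma path_cost_ones_first:
  assumes "finite U" "finite Z"
  shows "path_cost H U Z (card Z + card U * dt_size (\<lambda>x. (\<exists>j\<in>Z. x j) \<and> H x))"
  using assms(1)
proof (induction U rule: finite_induct)
  case (insert i U)
  let ?s = "dt_size (\<lambda>x. (\<exists>j\<in>Z. x j) \<and> H x)"
  have "path_cost H (insert i U - {i}) Z (card Z + card U * ?s)"
    using insert by simp
  from path_cost.query_one[of i, OF _ this] show ?case
    using insert by (simp add: algebra_simps)
qed (simp add: path_cost_zeros assms(2))

definition least_path_cost :: "((nat \<Rightarrow> bool) \<Rightarrow> bool) \<Rightarrow> nat set \<Rightarrow> nat set \<Rightarrow> nat" where
  "least_path_cost H U Z = (LEAST c. path_cost H U Z c)"

lemma least_path_cost_le: "path_cost H U Z c \<Longrightarrow> least_path_cost H U Z \<le> c"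
  unfolding least_path_cost_def by (rule Least_le)

lemma least_path_cost: "finite U \<Longrightarrow> finite Z \<Longrightarrow> path_cost H U Z (least_path_cost H U Z)"
  unfolding least_path_cost_def by (rule LeastI) (rule path_cost_ones_first)

lemma depends_only_ex: "Z \<subseteq> S \<Longrightarrow> depends_only S (\<lambda>x. \<exists>j\<in>Z. x j)"
  by (auto simp: depends_only_def subset_iff)

lemma depends_only_all: "U \<subseteq> S \<Longrightarrow> depends_only S (\<lambda>x. \<forall>j\<in>U. x j)"
  by (auto simp: depends_only_def subset_iff)

lemma dt_size_ex_and_le:
  assumes S: "finite S" "depends_only S H" and Z: "finite Z"
  shows "dt_size (\<lambda>x. (\<exists>j\<in>Z. x j) \<and> H x) \<le> card Z * dt_size H + 1"
  using Z
proof (induction Z rule: finite_induct)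
  case (insert i Z)
  obtain TH where TH: "eval_dtree TH = H" "dtree_size TH = dt_size H"
    using dt_size_witness[OF S] .
  have "depends_only (Z \<union> S) (\<lambda>x. (\<exists>j\<in>Z. x j) \<and> H x)"
    by (intro depends_only_conj depends_only_ex depends_only_mono[OF S(2)]) auto
  then obtain T where T: "eval_dtree T = (\<lambda>x. (\<exists>j\<in>Z. x j) \<and> H x)"
      "dtree_size T = dt_size (\<lambda>x. (\<exists>j\<in>Z. x j) \<and> H x)"
    using dt_size_witness[of "Z \<union> S"] insert S by blast
  have "eval_dtree (Query i T TH) = (\<lambda>x. (\<exists>j\<in>insert i Z. x j) \<and> H x)"
    using T TH by (auto simp: fun_eq_iff)
  from dt_size_le[OF this] show ?case
    using insert T TH by simp
qed (simp add: dt_size_const)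

lemma gated_upper:
  assumes "path_cost H U Z c" "finite S" "depends_only S H" "depends_only V g" "finite V"
    "finite U" "finite Z"
  shows "\<exists>T. eval_dtree T = gated U Z H g \<and> dtree_size T = c + dt_size g"
  using assms(1,6,7)
proof (induction rule: path_cost.induct)
  case finished
  then show ?case
    using dt_size_witness[OF assms(5,4)] by (auto simp: gated_def fun_eq_iff)
next
  case (query_one i U Z c)
  obtain T where T: "eval_dtree T = gated (U - {i}) Z H g" "dtree_size T = c + dt_size g"
    using query_one by auto
  have "depends_only (Z \<union> S) (\<lambda>x. (\<exists>j\<in>Z. x j) \<and> H x)"
    by (intro depends_only_conj depends_only_ex depends_only_mono[OF assms(3)]) auto
  then obtain T' where T': "eval_dtree T' = (\<lambda>x. (\<exists>j\<in>Z. x j) \<and> H x)"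
      "dtree_size T' = dt_size (\<lambda>x. (\<exists>j\<in>Z. x j) \<and> H x)"
    using dt_size_witness[of "Z \<union> S"] query_one.prems assms(2) by blast
  have "eval_dtree (Query i T' T) = gated U Z H g"
    using query_one.hyps(1) by (fastforce simp: gated_def T T' fun_eq_iff)
  then show ?case
    using T(2) T'(2) by (intro exI[of _ "Query i T' T"]) simp
next
  case (query_zero i Z U c)
  obtain T where T: "eval_dtree T = gated U (Z - {i}) H g" "dtree_size T = c + dt_size g"
    using query_zero by auto
  have "depends_only (U \<union> S) (\<lambda>x. (\<forall>j\<in>U. x j) \<or> H x)"
    by (intro depends_only_disj depends_only_all depends_only_mono[OF assms(3)]) auto
  then obtain T' where T': "eval_dtree T' = (\<lambda>x. (\<forall>j\<in>U. x j) \<or> H x)"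
      "dtree_size T' = dt_size (\<lambda>x. (\<forall>j\<in>U. x j) \<or> H x)"
    using dt_size_witness[of "U \<union> S"] query_zero.prems assms(2) by blast
  have "eval_dtree (Query i T T') = gated U Z H g"
    using query_zero.hyps(1) by (fastforce simp: gated_def T T' fun_eq_iff)
  then show ?case
    using T(2) T'(2) by (intro exI[of _ "Query i T T'"]) simp
qed

text \<open>Leaves consistent with all of \<open>U\<close> being 1 and all of \<open>Z\<close> being
  0, the only situation in which \<open>g\<close> is visible.\<close>

primrec gate_leaves :: "nat set \<Rightarrow> nat set \<Rightarrow> 'a dtree \<Rightarrow> nat" where
  "gate_leaves U Z (Leaf u) = 1"
| "gate_leaves U Z (Query i l r) =
     (if i \<in> U then gate_leaves U Z r else if i \<in> Z then gate_leaves U Z l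
      else gate_leaves U Z l + gate_leaves U Z r)"

text \<open>Some consistent path asks only variables of \<open>U\<close>, \<open>Z\<close> and
  \<open>V\<close>, hence learns nothing about \<open>H\<close>.\<close>

primrec unblocked :: "nat set \<Rightarrow> nat set \<Rightarrow> nat set \<Rightarrow> 'a dtree \<Rightarrow> bool" where
  "unblocked U Z V (Leaf u) \<longleftrightarrow> True"
| "unblocked U Z V (Query i l r) \<longleftrightarrow>
     (if i \<in> U then unblocked U Z V r else if i \<in> Z then unblocked U Z V l
      else i \<in> V \<and> (unblocked U Z V l \<or> unblocked U Z V r))"

text \<open>Extracts a tree for \<open>g\<close> from a tree for \<open>gated\<close>, once for each
  value \<open>c\<close> assigned to all variables outside \<open>U\<close>, \<open>Z\<close> and
  \<open>V\<close>.\<close>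

primrec gate_subtree :: "nat set \<Rightarrow> nat set \<Rightarrow> nat set \<Rightarrow> bool \<Rightarrow> 'a dtree \<Rightarrow> 'a dtree" where
  "gate_subtree U Z V c (Leaf u) = Leaf u"
| "gate_subtree U Z V c (Query i l r) =
     (if i \<in> U then gate_subtree U Z V c r else if i \<in> Z then gate_subtree U Z V c l
      else if i \<in> V then Query i (gate_subtree U Z V c l) (gate_subtree U Z V c r)
      else if c then gate_subtree U Z V c r else gate_subtree U Z V c l)"

lemma gate_leaves_le: "gate_leaves U Z T \<le> dtree_size T"
  by (induction T) auto

lemma eval_gate_subtree:
  "eval_dtree (gate_subtree U Z V c T) x
    = eval_dtree T (\<lambda>i. if i \<in> U then True else if i \<in> Z then False else if i \<in> V then x i else c)"
  by (induction T) auto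

lemma gate_subtree_size: "dtree_size (gate_subtree U Z V c T) \<le> gate_leaves U Z T"
  by (induction T) auto

text \<open>In a blocked tree every consistent path meets a variable outside \<open>U\<close>,
  \<open>Z\<close> and \<open>V\<close>. At the first one the two choices of \<open>c\<close> part,
  so the two extracted trees use disjoint leaves.\<close>

lemma blocked_gate_leaves:
  "\<not> unblocked U Z V T \<Longrightarrow>
    dtree_size (gate_subtree U Z V False T) + dtree_size (gate_subtree U Z V True T) \<le> gate_leaves U Z T"
proof (induction T)
  case (Query i l r)
  then show ?case
    using gate_subtree_size[of U Z V False l] gate_subtree_size[of U Z V True r]
    by (auto split: if_splits)
qed simp

lemma all_upd:
  fixes x :: "nat \<Rightarrow> bool"
  shows "(\<forall>j\<in>S. (x(i := True)) j) \<longleftrightarrow> (\<forall>j\<in>S - {i}. x j)"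
    and "i \<in> S \<Longrightarrow> \<not> (\<forall>j\<in>S. (x(i := False)) j)"
    and "i \<notin> S \<Longrightarrow> (\<forall>j\<in>S. (x(i := b)) j) \<longleftrightarrow> (\<forall>j\<in>S. x j)"
  by auto

lemma ex_upd:
  fixes x :: "nat \<Rightarrow> bool"
  shows "(\<exists>j\<in>S. (x(i := False)) j) \<longleftrightarrow> (\<exists>j\<in>S - {i}. x j)"
    and "i \<in> S \<Longrightarrow> \<exists>j\<in>S. (x(i := True)) j"
    and "i \<notin> S \<Longrightarrow> (\<exists>j\<in>S. (x(i := b)) j) \<longleftrightarrow> (\<exists>j\<in>S. x j)"
  by auto

text \<open>In the locale below, \<open>U' \<subseteq> U\<close> and \<open>Z' \<subseteq> Z\<close> are the gate variables that have not been
  queried yet.\<close>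

locale gate =
  fixes U Z V :: "nat set"
  assumes fin: "finite U" "finite Z" "finite V"
    and disj: "U \<inter> Z = {}" "U \<inter> V = {}" "Z \<inter> V = {}"
begin

lemma gated_upd_one:
  assumes "i \<in> U'" "U' \<subseteq> U" "Z' \<subseteq> Z" 
  shows "depends_only V g \<Longrightarrow>
      gated U' Z' H g (x(i := True)) = gated (U' - {i}) Z' (\<lambda>x. H (x(i := True))) g x"
    and "gated U' Z' H g (x(i := False)) = ((\<exists>j\<in>Z'. x j) \<and> H (x(i := False)))"
proof -
  have i: "i \<notin> Z'" "i \<notin> V"
    using assms disj by auto
  show "gated U' Z' H g (x(i := True)) = gated (U' - {i}) Z' (\<lambda>x. H (x(i := True))) g x"
    if "depends_only V g"
    unfolding gated_def all_upd(1) ex_upd(3)[OF i(1)] depends_only_update[OF that i(2)] ..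
  show "gated U' Z' H g (x(i := False)) = ((\<exists>j\<in>Z'. x j) \<and> H (x(i := False)))"
    unfolding gated_def ex_upd(3)[OF i(1)] using all_upd(2)[OF assms(1), of x] by blast
qed

lemma gated_upd_zero:
  assumes "i \<in> Z'" "U' \<subseteq> U" "Z' \<subseteq> Z" 
  shows "depends_only V g \<Longrightarrow>
      gated U' Z' H g (x(i := False)) = gated U' (Z' - {i}) (\<lambda>x. H (x(i := False))) g x"
    and "gated U' Z' H g (x(i := True)) = ((\<forall>j\<in>U'. x j) \<or> H (x(i := True)))"
proof -
  have i: "i \<notin> U'" "i \<notin> V"
    using assms disj by auto
  show "gated U' Z' H g (x(i := False)) = gated U' (Z' - {i}) (\<lambda>x. H (x(i := False))) g x"
    if "depends_only V g"
    unfolding gated_def ex_upd(1) all_upd(3)[OF i(1)] depends_only_update[OF that i(2)] ..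
  show "gated U' Z' H g (x(i := True)) = ((\<forall>j\<in>U'. x j) \<or> H (x(i := True)))"
    unfolding gated_def all_upd(3)[OF i(1)] using ex_upd(2)[OF assms(1), of x] by blast
qed

lemma gated_upd_other:
  "i \<notin> U' \<Longrightarrow> i \<notin> Z' \<Longrightarrow>
    gated U' Z' H g (x(i := b)) = gated U' Z' (\<lambda>x. H (x(i := b))) (\<lambda>x. g (x(i := b))) x"
  by (simp only: gated_def all_upd(3)[of i U'] ex_upd(3)[of i Z'] not_False_eq_True)

lemma depends_only_upd: "depends_only V g \<Longrightarrow> depends_only V (\<lambda>x. g (x(i := b)))"
  by (rule depends_onlyI, erule depends_onlyD) auto

lemma read_once_eval:
  assumes "read_once (Query i l r)" "eval_dtree (Query i l r) = F"
  shows "eval_dtree l = (\<lambda>x. F (x(i := False)))" "eval_dtree r = (\<lambda>x. F (x(i := True)))"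
  unfolding assms(2)[symmetric] by (rule ext, use assms(1) in \<open>simp add: eval_dtree_update\<close>)+

text \<open>Consider the path of \<open>\<nu>\<close> with \<open>U\<close> all 1 and
  \<open>Z\<close> all 0. The value there is 0, but it is 1 at the all-ones input, so the path
  cannot end while a variable of \<open>Z'\<close> is open; each query to \<open>Z'\<close> has a
  branch without gate leaves.\<close>

lemma zeros_queried:
  assumes "read_once T" "dtree_vars T \<inter> U \<subseteq> U'" "dtree_vars T \<inter> Z \<subseteq> Z'" "U' \<subseteq> U" "Z' \<subseteq> Z"
    "eval_dtree T = gated U' Z' H g" "depends_only V g" "\<not> g \<nu>"
  shows "card Z' + gate_leaves U Z T \<le> dtree_size T"
  using assms
proof (induction T arbitrary: U' Z' H g)
  case (Leaf u)
  let ?x = "\<lambda>i. if i \<in> U then True else if i \<in> Z then False else \<nu> i"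
  have "g ?x = g \<nu>"
    by (rule depends_onlyD[OF Leaf.prems(7)]) (use disj in auto)
  then have "\<not> gated U' Z' H g ?x"
    using Leaf.prems(4,5,8) disj by (auto simp: gated_def)
  moreover have "gated U' Z' H g (\<lambda>_. True)" if "Z' \<noteq> {}"
    using that by (auto simp: gated_def)
  ultimately have "Z' = {}"
    using fun_cong[OF Leaf.prems(6), of ?x] fun_cong[OF Leaf.prems(6), of "\<lambda>_. True"]
      fun_cong[OF Leaf.prems(6), of "\<lambda>_. False"] by auto
  then show ?case by simp
next
  case (Query i l r)
  note ev = read_once_eval[OF Query.prems(1,6)]
  have ro: "read_once l" "read_once r" "i \<notin> dtree_vars l" "i \<notin> dtree_vars r"
    using Query.prems(1) by auto
  consider "i \<in> U" | "i \<in> Z" "i \<notin> U" | "i \<notin> U" "i \<notin> Z" by blast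
  then show ?case
  proof cases
    case 1
    then have i: "i \<in> U'"
      using Query.prems(2) by auto
    have evr: "eval_dtree r = gated (U' - {i}) Z' (\<lambda>x. H (x(i := True))) g"
      unfolding ev(2) gated_upd_one(1)[OF i Query.prems(4,5,7)] by (rule refl)
    have "card Z' + gate_leaves U Z r \<le> dtree_size r"
      by (rule Query.IH(2)[OF ro(2) _ _ _ _ evr Query.prems(7,8)]) (use Query.prems ro in auto)
    then show ?thesis
      using 1 by simp
  next
    case 2
    then have i: "i \<in> Z'"
      using Query.prems(3) by auto
    have evl: "eval_dtree l = gated U' (Z' - {i}) (\<lambda>x. H (x(i := False))) g"
      unfolding ev(1) gated_upd_zero(1)[OF i Query.prems(4,5,7)] by (rule refl)
    have "card (Z' - {i}) + gate_leaves U Z l \<le> dtree_size l"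
      by (rule Query.IH(1)[OF ro(1) _ _ _ _ evl Query.prems(7,8)]) (use Query.prems ro in auto)
    moreover have "card Z' = Suc (card (Z' - {i}))"
      using i finite_subset[OF Query.prems(5) fin(2)] by (metis card_Suc_Diff1)
    ultimately show ?thesis
      using 2 dtree_size_pos[of r] by (simp del: dtree_size_pos)
  next
    case 3
    then have i: "i \<notin> U'" "i \<notin> Z'"
      using Query.prems(4,5) by auto
    have *: "\<not> g (\<nu>(i := \<nu> i))"
      using Query.prems(8) by simp
    show ?thesis
    proof (cases "\<nu> i")
      case True
      have ev': "eval_dtree r = gated U' Z' (\<lambda>x. H (x(i := True))) (\<lambda>x. g (x(i := True)))"
        unfolding ev(2) gated_upd_other[OF i] by (rule refl)
      have "card Z' + gate_leaves U Z r \<le> dtree_size r"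
        by (rule Query.IH(2)[OF ro(2) _ _ _ _ ev' depends_only_upd[OF Query.prems(7)]])
          (use Query.prems(2-5) True * in \<open>auto simp del: fun_upd_apply\<close>)
      then show ?thesis
        using 3 gate_leaves_le[of U Z l] by simp
    next
      case False
      have ev': "eval_dtree l = gated U' Z' (\<lambda>x. H (x(i := False))) (\<lambda>x. g (x(i := False)))"
        unfolding ev(1) gated_upd_other[OF i] by (rule refl)
      have "card Z' + gate_leaves U Z l \<le> dtree_size l"
        by (rule Query.IH(1)[OF ro(1) _ _ _ _ ev' depends_only_upd[OF Query.prems(7)]])
          (use Query.prems(2-5) False * in \<open>auto simp del: fun_upd_apply\<close>)
      then show ?thesis
        using 3 gate_leaves_le[of U Z r] by simp
    qed
  qed
qed

text \<open>Dual to \<open>zeros_queried\<close>, with the roles of 0 and 1 and of \<open>Z\<close>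
  and \<open>U\<close> exchanged.\<close>

lemma ones_queried:
  assumes "read_once T" "dtree_vars T \<inter> U \<subseteq> U'" "dtree_vars T \<inter> Z \<subseteq> Z'" "U' \<subseteq> U" "Z' \<subseteq> Z"
    "eval_dtree T = gated U' Z' H g" "depends_only V g" "g \<nu>"
  shows "card U' + gate_leaves U Z T \<le> dtree_size T"
  using assms
proof (induction T arbitrary: U' Z' H g)
  case (Leaf u)
  let ?x = "\<lambda>i. if i \<in> U then True else if i \<in> Z then False else \<nu> i"
  have "g ?x = g \<nu>"
    by (rule depends_onlyD[OF Leaf.prems(7)]) (use disj in auto)
  then have "gated U' Z' H g ?x"
    using Leaf.prems(4,5,8) disj by (auto simp: gated_def)
  moreover have "\<not> gated U' Z' H g (\<lambda>_. False)" if "U' \<noteq> {}"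
    using that by (auto simp: gated_def)
  ultimately have "U' = {}"
    using fun_cong[OF Leaf.prems(6), of ?x] fun_cong[OF Leaf.prems(6), of "\<lambda>_. True"]
      fun_cong[OF Leaf.prems(6), of "\<lambda>_. False"] by auto
  then show ?case by simp
next
  case (Query i l r)
  note ev = read_once_eval[OF Query.prems(1,6)]
  have ro: "read_once l" "read_once r" "i \<notin> dtree_vars l" "i \<notin> dtree_vars r"
    using Query.prems(1) by auto
  consider "i \<in> U" | "i \<in> Z" "i \<notin> U" | "i \<notin> U" "i \<notin> Z" by blast
  then show ?case
  proof cases
    case 1
    then have i: "i \<in> U'"
      using Query.prems(2) by auto
    have evr: "eval_dtree r = gated (U' - {i}) Z' (\<lambda>x. H (x(i := True))) g"
      unfolding ev(2) gated_upd_one(1)[OF i Query.prems(4,5,7)] by (rule refl)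
    have "card (U' - {i}) + gate_leaves U Z r \<le> dtree_size r"
      by (rule Query.IH(2)[OF ro(2) _ _ _ _ evr Query.prems(7,8)]) (use Query.prems ro in auto)
    moreover have "card U' = Suc (card (U' - {i}))"
      using i finite_subset[OF Query.prems(4) fin(1)] by (metis card_Suc_Diff1)
    ultimately show ?thesis
      using 1 dtree_size_pos[of l] by (simp del: dtree_size_pos)
  next
    case 2
    then have i: "i \<in> Z'"
      using Query.prems(3) by auto
    have evl: "eval_dtree l = gated U' (Z' - {i}) (\<lambda>x. H (x(i := False))) g"
      unfolding ev(1) gated_upd_zero(1)[OF i Query.prems(4,5,7)] by (rule refl)
    have "card U' + gate_leaves U Z l \<le> dtree_size l"
      by (rule Query.IH(1)[OF ro(1) _ _ _ _ evl Query.prems(7,8)]) (use Query.prems ro in auto)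
    then show ?thesis
      using 2 by simp
  next
    case 3
    then have i: "i \<notin> U'" "i \<notin> Z'"
      using Query.prems(4,5) by auto
    have *: "g (\<nu>(i := \<nu> i))"
      using Query.prems(8) by simp
    show ?thesis
    proof (cases "\<nu> i")
      case True
      have ev': "eval_dtree r = gated U' Z' (\<lambda>x. H (x(i := True))) (\<lambda>x. g (x(i := True)))"
        unfolding ev(2) gated_upd_other[OF i] by (rule refl)
      have "card U' + gate_leaves U Z r \<le> dtree_size r"
        by (rule Query.IH(2)[OF ro(2) _ _ _ _ ev' depends_only_upd[OF Query.prems(7)]])
          (use Query.prems(2-5) True * in \<open>auto simp del: fun_upd_apply\<close>)
      then show ?thesis
        using 3 gate_leaves_le[of U Z l] by simp
    next
      case False
      have ev': "eval_dtree l = gated U' Z' (\<lambda>x. H (x(i := False))) (\<lambda>x. g (x(i := False)))"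
        unfolding ev(1) gated_upd_other[OF i] by (rule refl)
      have "card U' + gate_leaves U Z l \<le> dtree_size l"
        by (rule Query.IH(1)[OF ro(1) _ _ _ _ ev' depends_only_upd[OF Query.prems(7)]])
          (use Query.prems(2-5) False * in \<open>auto simp del: fun_upd_apply\<close>)
      then show ?thesis
        using 3 gate_leaves_le[of U Z r] by simp
    qed
  qed
qed

text \<open>The branches that leave an unblocked path at gate variables compute the deviating
  functions and pay for a certification path of cost \<open>c\<close>. The extra term covers a path
  that ends early: once \<open>g\<close> is constant 1 and all of \<open>U\<close> is confirmed, the
  tree may stop without asking \<open>Z'\<close>, although the certification path still does; dually
  for 0.\<close>

lemma unblocked_lower:
  assumes "read_once T" "dtree_vars T \<inter> U \<subseteq> U'" "dtree_vars T \<inter> Z \<subseteq> Z'" "U' \<subseteq> U" "Z' \<subseteq> Z"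
    "eval_dtree T = gated U' Z' H g" "depends_only V g" "depends_only W H"
    "W \<inter> (U \<union> Z \<union> V) = {}" "unblocked U Z V T"
  shows "\<exists>c. path_cost H U' Z' c \<and> c + gate_leaves U Z T \<le> dtree_size T +
    (if \<forall>x. g x then card Z' else if \<forall>x. \<not> g x then card U' else 0)"
  using assms
proof (induction T arbitrary: U' Z' g)
  case (Leaf u)
  have fin': "finite U'" "finite Z'"
    using Leaf.prems fin finite_subset by blast+
  have g: "g \<nu> = u" for \<nu>
  proof -
    let ?x = "\<lambda>i. if i \<in> U then True else if i \<in> Z then False else \<nu> i"
    have "g ?x = g \<nu>"
      by (rule depends_onlyD[OF Leaf.prems(7)]) (use disj in auto)
    moreover have "gated U' Z' H g ?x = g ?x"
      using Leaf.prems(4,5) disj by (auto simp: gated_def)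
    ultimately show ?thesis
      using fun_cong[OF Leaf.prems(6), of ?x] by simp
  qed
  show ?case
  proof (cases u)
    case True
    have "gated U' Z' H g (\<lambda>_. False)"
      using fun_cong[OF Leaf.prems(6), of "\<lambda>_. False"] True by simp
    then have "U' = {}"
      by (auto simp: gated_def)
    then show ?thesis
      using path_cost_zeros[OF fin'(2), of H] g True by (intro exI[of _ "card Z'"]) simp
  next
    case False
    have "\<not> gated U' Z' H g (\<lambda>_. True)"
      using fun_cong[OF Leaf.prems(6), of "\<lambda>_. True"] False by simp
    then have "Z' = {}"
      by (auto simp: gated_def)
    then show ?thesis
      using path_cost_ones[OF fin'(1), of H] g False by (intro exI[of _ "card U'"]) simp
  qed
next
  case (Query i l r)
  note ev = read_once_eval[OF Query.prems(1,6)]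
  have ro: "read_once l" "read_once r" "i \<notin> dtree_vars l" "i \<notin> dtree_vars r"
    using Query.prems(1) by auto
  have fin': "finite U'" "finite Z'"
    using Query.prems fin finite_subset by blast+
  let ?e = "\<lambda>U' Z' g. if \<forall>x. g x then card Z' else if \<forall>x. \<not> g x then card U' else 0"
  consider "i \<in> U" | "i \<in> Z" "i \<notin> U" | "i \<notin> U" "i \<notin> Z" by blast
  then show ?case
  proof cases
    case 1
    then have i: "i \<in> U'"
      using Query.prems(2) by auto
    have H: "(\<lambda>x. H (x(i := b))) = H" for b
      using 1 Query.prems(8,9) depends_only_update[of W H i] by (auto simp: fun_eq_iff)
    have evr: "eval_dtree r = gated (U' - {i}) Z' H g"
      unfolding ev(2) gated_upd_one(1)[OF i Query.prems(4,5,7)] H by (rule refl)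
    have "\<exists>c. path_cost H (U' - {i}) Z' c \<and>
        c + gate_leaves U Z r \<le> dtree_size r + ?e (U' - {i}) Z' g"
      by (rule Query.IH(2)[OF ro(2) _ _ _ _ evr Query.prems(7-9)]) (use Query.prems ro 1 in auto)
    then obtain c where c: "path_cost H (U' - {i}) Z' c"
        "c + gate_leaves U Z r \<le> dtree_size r + ?e (U' - {i}) Z' g" by blast
    have "eval_dtree l = (\<lambda>x. (\<exists>j\<in>Z'. x j) \<and> H x)"
      unfolding ev(1) gated_upd_one(2)[OF i Query.prems(4,5)] fun_cong[OF H] by (rule refl)
    then have "dt_size (\<lambda>x. (\<exists>j\<in>Z'. x j) \<and> H x) \<le> dtree_size l"
      by (rule dt_size_le)
    moreover have "?e (U' - {i}) Z' g \<le> ?e U' Z' g"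
      using card_mono[OF fin'(1), of "U' - {i}"] by auto
    ultimately show ?thesis
      using path_cost.query_one[OF i c(1)] c(2) 1
      by (intro exI[of _ "c + dt_size (\<lambda>x. (\<exists>j\<in>Z'. x j) \<and> H x)"] conjI) (assumption, simp)
  next
    case 2
    then have i: "i \<in> Z'"
      using Query.prems(3) by auto
    have H: "(\<lambda>x. H (x(i := b))) = H" for b
      using 2 Query.prems(8,9) depends_only_update[of W H i] by (auto simp: fun_eq_iff)
    have evl: "eval_dtree l = gated U' (Z' - {i}) H g"
      unfolding ev(1) gated_upd_zero(1)[OF i Query.prems(4,5,7)] H by (rule refl)
    have "\<exists>c. path_cost H U' (Z' - {i}) c \<and>
        c + gate_leaves U Z l \<le> dtree_size l + ?e U' (Z' - {i}) g"
      by (rule Query.IH(1)[OF ro(1) _ _ _ _ evl Query.prems(7-9)]) (use Query.prems ro 2 in auto)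
    then obtain c where c: "path_cost H U' (Z' - {i}) c"
        "c + gate_leaves U Z l \<le> dtree_size l + ?e U' (Z' - {i}) g" by blast
    have "eval_dtree r = (\<lambda>x. (\<forall>j\<in>U'. x j) \<or> H x)"
      unfolding ev(2) gated_upd_zero(2)[OF i Query.prems(4,5)] fun_cong[OF H] by (rule refl)
    then have "dt_size (\<lambda>x. (\<forall>j\<in>U'. x j) \<or> H x) \<le> dtree_size r"
      by (rule dt_size_le)
    moreover have "?e U' (Z' - {i}) g \<le> ?e U' Z' g"
      using card_mono[OF fin'(2), of "Z' - {i}"] by auto
    ultimately show ?thesis
      using path_cost.query_zero[OF i c(1)] c(2) 2
      by (intro exI[of _ "c + dt_size (\<lambda>x. (\<forall>j\<in>U'. x j) \<or> H x)"] conjI) (assumption, simp)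
  next
    case 3
    then have i: "i \<notin> U'" "i \<notin> Z'"
      using Query.prems(4,5) by auto
    have iV: "i \<in> V"
      using 3 Query.prems(10) by auto
    have H: "(\<lambda>x. H (x(i := b))) = H" for b
      using iV Query.prems(8,9) depends_only_update[of W H i] by (auto simp: fun_eq_iff)
    let ?T = "\<lambda>b. if b then r else l"
    let ?g = "\<lambda>b x. g (x(i := b))"
    have evT: "eval_dtree (?T b) = gated U' Z' H (?g b)" for b
    proof -
      have "eval_dtree (?T b) = (\<lambda>x. gated U' Z' H g (x(i := b)))"
        by (cases b) (simp_all only: ev if_True if_False)
      then show ?thesis
        unfolding gated_upd_other[OF i] H .
    qed
    have sub: "read_once (?T b)" "dtree_vars (?T b) \<inter> U \<subseteq> U'" "dtree_vars (?T b) \<inter> Z \<subseteq> Z'" for b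
      using Query.prems(1-3) by auto
    obtain b where b: "unblocked U Z V (?T b)"
      using 3 Query.prems(10) by (metis unblocked.simps(2))
    have "\<exists>c. path_cost H U' Z' c \<and>
        c + gate_leaves U Z (?T b) \<le> dtree_size (?T b) + ?e U' Z' (?g b)"
    proof (cases b)
      case True
      show ?thesis
        using Query.IH(2)[OF sub[of True, unfolded if_True] Query.prems(4,5)
            evT[of True, unfolded if_True] depends_only_upd[OF Query.prems(7)] Query.prems(8,9)] b True
        by (simp del: fun_upd_apply split del: if_split cong: if_cong)
    next
      case False
      show ?thesis
        using Query.IH(1)[OF sub[of False, unfolded if_False] Query.prems(4,5)
            evT[of False, unfolded if_False] depends_only_upd[OF Query.prems(7)] Query.prems(8,9)] b False
        by (simp del: fun_upd_apply split del: if_split cong: if_cong)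
    qed
    then obtain c where c: "path_cost H U' Z' c"
        "c + gate_leaves U Z (?T b) \<le> dtree_size (?T b) + ?e U' Z' (?g b)" by blast
    \<comment> \<open>If answer \<open>b\<close> makes \<open>g\<close> constant although
      \<open>g\<close> itself is not, the extra term must be earned on the other side. There
      \<open>g\<close> takes the opposite value somewhere, so \<open>zeros_queried\<close> or
      \<open>ones_queried\<close> shows that this side has as many leaves to spare.\<close>
    have "gate_leaves U Z (?T (\<not> b)) + ?e U' Z' (?g b) \<le> dtree_size (?T (\<not> b)) + ?e U' Z' g"
    proof -
      consider (nonconst) "\<exists>x. ?g b x" "\<exists>x. \<not> ?g b x" | (one) "\<forall>x. ?g b x" | (zero) "\<forall>x. \<not> ?g b x"
        by blast
      then show ?thesis
      proof cases
        case nonconst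
        then show ?thesis
          using gate_leaves_le[of U Z "?T (\<not> b)"] by auto
      next
        case one
        show ?thesis
        proof (cases "\<forall>x. g x")
          case True
          then show ?thesis
            using gate_leaves_le[of U Z "?T (\<not> b)"] by auto
        next
          case False
          then obtain \<nu> where \<nu>: "\<not> g \<nu>" by blast
          have upd: "\<nu>(i := c) = \<nu>" if "\<nu> i = c" for c
            using fun_upd_triv[of \<nu> i] unfolding that .
          have "\<nu> i \<noteq> b"
          proof
            assume "\<nu> i = b"
            then show False
              using spec[OF one, of \<nu>] \<nu> unfolding upd[OF \<open>\<nu> i = b\<close>] by blast
          qed
          then have "\<nu>(i := \<not> b) = \<nu>"
            by (intro upd) blast
          then have "\<not> ?g (\<not> b) \<nu>"
            using \<nu> by simp
          then have "card Z' + gate_leaves U Z (?T (\<not> b)) \<le> dtree_size (?T (\<not> b))"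
            using zeros_queried[OF sub Query.prems(4,5) evT depends_only_upd[OF Query.prems(7)]]
            by blast
          moreover have "?e U' Z' (?g b) = card Z'"
            using one by simp
          ultimately show ?thesis by linarith
        qed
      next
        case zero
        show ?thesis
        proof (cases "\<forall>x. \<not> g x")
          case True
          then show ?thesis
            using gate_leaves_le[of U Z "?T (\<not> b)"] by auto
        next
          case False
          then obtain \<nu> where \<nu>: "g \<nu>" by blast
          have upd: "\<nu>(i := c) = \<nu>" if "\<nu> i = c" for c
            using fun_upd_triv[of \<nu> i] unfolding that .
          have "\<nu> i \<noteq> b"
          proof
            assume "\<nu> i = b"
            then show False
              using spec[OF zero, of \<nu>] \<nu> unfolding upd[OF \<open>\<nu> i = b\<close>] by blast
          qed
          then have "\<nu>(i := \<not> b) = \<nu>"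
            by (intro upd) blast
          then have "?g (\<not> b) \<nu>"
            using \<nu> by simp
          then have "card U' + gate_leaves U Z (?T (\<not> b)) \<le> dtree_size (?T (\<not> b))"
            using ones_queried[OF sub Query.prems(4,5) evT depends_only_upd[OF Query.prems(7)]]
            by blast
          moreover have "?e U' Z' (?g b) = card U'"
            using zero by simp
          ultimately show ?thesis by linarith
        qed
      qed
    qed
    moreover have "gate_leaves U Z (Query i l r) = gate_leaves U Z (?T b) + gate_leaves U Z (?T (\<not> b))"
      "dtree_size (Query i l r) = dtree_size (?T b) + dtree_size (?T (\<not> b))"
      using 3 by (cases b; simp)+
    ultimately show ?thesis
      using c by (intro exI[of _ c] conjI) (assumption, linarith)
  qed
qed

text \<open>For the lower bound take an optimal tree. If it is unblocked, the branches off the path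
  and the gate leaves are disjoint and pay for the certification and for \<open>g\<close>. If it is
  blocked, it contains two disjoint trees for \<open>g\<close>, which is at least as much because of
  \<open>large\<close>.\<close>

theorem dt_size_gated:
  assumes g: "depends_only V g" "\<exists>x. g x" "\<exists>x. \<not> g x"
    and W: "finite W" "depends_only W H" "W \<inter> (U \<union> Z \<union> V) = {}"
    and large: "least_path_cost H U Z \<le> dt_size g"
  shows "dt_size (gated U Z H g) = least_path_cost H U Z + dt_size g"
proof (rule antisym)
  obtain T where "eval_dtree T = gated U Z H g" "dtree_size T = least_path_cost H U Z + dt_size g"
    using gated_upper[OF least_path_cost[OF fin(1,2)] W(1,2) g(1) fin(3,1,2)] by blast
  then show "dt_size (gated U Z H g) \<le> least_path_cost H U Z + dt_size g"
    using dt_size_le by metis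
  have dep: "depends_only (U \<union> Z \<union> V \<union> W) (gated U Z H g)"
    unfolding gated_def
    by (intro depends_only_conj depends_only_disj depends_only_ex depends_only_all
        depends_only_mono[OF W(2)] depends_only_mono[OF g(1)]) auto
  obtain T where T: "eval_dtree T = gated U Z H g" "dtree_size T = dt_size (gated U Z H g)"
      "read_once T"
    by (rule read_once_witness[OF _ dep]) (use fin W in auto)
  have sub: "dt_size g \<le> dtree_size (gate_subtree U Z V c T)" for c
  proof (rule dt_size_le, rule ext)
    fix x
    let ?x = "\<lambda>i. if i \<in> U then True else if i \<in> Z then False else if i \<in> V then x i else c"
    have "g ?x = g x"
      by (rule depends_onlyD[OF g(1)]) (use disj in auto)
    then show "eval_dtree (gate_subtree U Z V c T) x = g x"
      unfolding eval_gate_subtree T gated_def using disj by auto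
  qed
  show "least_path_cost H U Z + dt_size g \<le> dt_size (gated U Z H g)"
  proof (cases "unblocked U Z V T")
    case True
    obtain c where c: "path_cost H U Z c" "c + gate_leaves U Z T \<le> dtree_size T +
        (if \<forall>x. g x then card Z else if \<forall>x. \<not> g x then card U else 0)"
      using unblocked_lower[OF T(3) _ _ _ _ T(1) g(1) W(2,3) True] by blast
    have "c + gate_leaves U Z T \<le> dtree_size T"
      using c(2) g(2,3) by (auto split: if_splits)
    then show ?thesis
      using least_path_cost_le[OF c(1)] sub[of True] gate_subtree_size[of U Z V True T] T(2)
      by linarith
  next
    case False
    then show ?thesis
      using blocked_gate_leaves[OF False] sub[of True] sub[of False] gate_leaves_le[of U Z T]
        T(2) large by linarith
  qed
qed

end

lemma least_path_cost_bound:
  assumes "finite U" "finite Z" "finite S" "depends_only S H"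
  shows "least_path_cost H U Z \<le> card Z + card U * (card Z * dt_size H + 1)"
proof -
  have "least_path_cost H U Z \<le> card Z + card U * dt_size (\<lambda>x. (\<exists>j\<in>Z. x j) \<and> H x)"
    by (rule least_path_cost_le[OF path_cost_ones_first[OF assms(1,2)]])
  also have "\<dots> \<le> card Z + card U * (card Z * dt_size H + 1)"
    by (intro add_left_mono mult_le_mono2 dt_size_ex_and_le[OF assms(3,4,2)])
  finally show ?thesis .
qed

section \<open>Influences in tribes with majority blocks\<close>

primrec hits :: "nat set \<Rightarrow> 'a dtree \<Rightarrow> (nat \<Rightarrow> bool) \<Rightarrow> bool" where
  "hits S (Leaf u) x \<longleftrightarrow> False"
| "hits S (Query i l r) x \<longleftrightarrow> i \<in> S \<or> (if x i then hits S r x else hits S l x)"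

primrec hit_prob :: "nat set \<Rightarrow> 'a dtree \<Rightarrow> real" where
  "hit_prob S (Leaf u) = 0"
| "hit_prob S (Query i l r) = (if i \<in> S then 1 else (hit_prob S l + hit_prob S r) / 2)"

primrec hit_within :: "nat set \<Rightarrow> 'a dtree \<Rightarrow> nat \<Rightarrow> real" where
  "hit_within S (Leaf u) d = 0"
| "hit_within S (Query i l r) d = (case d of 0 \<Rightarrow> 0
     | Suc d' \<Rightarrow> if i \<in> S then 1 else (hit_within S l d' + hit_within S r d') / 2)"

text \<open>Probability that at least \<open>d\<close> queries are made.\<close>

primrec depth_prob :: "'a dtree \<Rightarrow> nat \<Rightarrow> real" where
  "depth_prob (Leaf u) d = of_bool (d = 0)"
| "depth_prob (Query i l r) d = (case d of 0 \<Rightarrow> 1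
     | Suc d' \<Rightarrow> (depth_prob l d' + depth_prob r d') / 2)"

lemma hit_prob_le_1: "hit_prob S T \<le> 1"
  by (induction T) auto

lemma hit_prob_le: "hit_prob S T \<le> hit_within S T d + depth_prob T d"
proof (induction T arbitrary: d)
  case (Query i l r)
  show ?case
  proof (cases d)
    case 0
    then show ?thesis
      using hit_prob_le_1[of S "Query i l r"] by (simp del: hit_prob.simps)
  next
    case (Suc d')
    have "0 \<le> depth_prob T d" for T :: "'a dtree" and d
      by (induction T arbitrary: d) (auto split: nat.splits)
    then show ?thesis
      using Suc Query.IH(1)[of d'] Query.IH(2)[of d'] by (simp add: field_simps)
  qed
qed simp

lemma depth_prob_le: "depth_prob T d \<le> real (dtree_size T) / 2 ^ d"
proof (induction T arbitrary: d)
  case (Query i l r)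
  show ?case
  proof (cases d)
    case 0
    have "1 \<le> dtree_size l + dtree_size r"
      using dtree_size_pos[of l] by linarith
    then show ?thesis
      using 0 by (simp del: of_nat_add add: of_nat_add[symmetric])
  next
    case (Suc d')
    then show ?thesis
      using Query.IH(1)[of d'] Query.IH(2)[of d'] by (simp add: add_divide_distrib)
  qed
qed simp

lemma hits_cong: "(\<And>i. i \<in> dtree_vars T \<Longrightarrow> x i = y i) \<Longrightarrow> hits S T x = hits S T y"
  by (induction T) auto

lemma hits_completion [simp]: "hits S (completion n T f) x = hits S T x"
  by (induction T arbitrary: f) auto

lemma cube_prob_hits:
  "read_once T \<Longrightarrow> dtree_vars T \<subseteq> {..<n} \<Longrightarrow> cube_prob n (hits S T) = hit_prob S T"
proof (induction T)
  case (Leaf u)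
  then show ?case by (simp add: cube_prob_def)
next
  case (Query i l r)
  have "hits S T' (x(i := b)) = hits S T' x" if "i \<notin> dtree_vars T'" for T' :: "'a dtree" and x b
    by (rule hits_cong) (use that in auto)
  then have "hits S (Query i l r) (x(i := False)) = hits S l x"
    "hits S (Query i l r) (x(i := True)) = hits S r x" if "i \<notin> S" for x
    using that Query.prems(1) by simp_all
  moreover have "i < n"
    using Query.prems(2) by simp
  ultimately have split: "cube_prob n (hits S (Query i l r))
      = (cube_prob n (hits S l) + cube_prob n (hits S r)) / 2" if "i \<notin> S"
    using that
    by (simp only: cube_prob_split[of i n "hits S (Query i l r)"] not_False_eq_True)
  show ?case
  proof (cases "i \<in> S")
    case True
    then have "hits S (Query i l r) = (\<lambda>_. True)" by auto
    then show ?thesis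
      using True by simp
  next
    case False
    then show ?thesis
      using Query split by (simp del: hits.simps)
  qed
qed

lemma eval_outside:
  "(\<And>i. i \<notin> S \<Longrightarrow> x i = y i) \<Longrightarrow> hits S T x = hits S T y \<and>
    (\<not> hits S T x \<longrightarrow> eval_dtree T x = eval_dtree T y)"
  by (induction T) auto

lemma cube_mean_pm: "cube_mean n (\<lambda>x. pm (P x)) = 2 * cube_prob n P - 1"
proof -
  have "pm b = 2 * of_bool b - 1" for b
    by (simp add: pm_def)
  then show ?thesis
    by (simp add: cube_prob_def cube_mean_diff cube_mean_cmult)
qed

text \<open>There are \<open>B\<close> blocks with \<open>R\<close> tribes of \<open>w\<close>
  variables each; \<open>X (b, c)\<close> is tribe \<open>c\<close> of block \<open>b\<close>, and
  \<open>Y b\<close> holds the \<open>2 * \<kappa> + 1\<close> voters of block \<open>b\<close>, an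
  odd number to exclude ties. \<open>U\<close> and \<open>Z\<close> are the gate variables,
  \<open>V\<close> is reserved for \<open>g\<close>.\<close>

locale tribes_blocks =
  fixes n w B R \<kappa> r :: nat
    and X :: "nat \<times> nat \<Rightarrow> nat set" and Y :: "nat \<Rightarrow> nat set" and U Z V :: "nat set"
    and g :: "(nat \<Rightarrow> bool) \<Rightarrow> bool"
  assumes pos: "0 < B" "0 < w" "0 < r"
    and X: "\<And>t. t \<in> {..<B} \<times> {..<R} \<Longrightarrow> X t \<subseteq> {..<n} \<and> card (X t) = w"
    and X_disj: "disjoint_family_on X ({..<B} \<times> {..<R})"
    and Y: "\<And>b. b < B \<Longrightarrow> Y b \<subseteq> {..<n} \<and> card (Y b) = 2 * \<kappa> + 1"
    and Y_disj: "disjoint_family_on Y {..<B}"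
    and U: "U \<subseteq> {..<n}" "card U = r"
    and Z: "Z \<subseteq> {..<n}" "card Z = r"
    and V: "V \<subseteq> {..<n}" "depends_only V g"
    and XY: "(\<Union>t\<in>{..<B} \<times> {..<R}. X t) \<inter> (\<Union>b<B. Y b) = {}"
    and XU: "(\<Union>t\<in>{..<B} \<times> {..<R}. X t) \<inter> (U \<union> Z \<union> V) = {}"
    and YU: "(\<Union>b<B. Y b) \<inter> (U \<union> Z \<union> V) = {}"
    and UZV: "U \<inter> Z = {}" "U \<inter> V = {}" "Z \<inter> V = {}"
begin

abbreviation "I \<equiv> {..<B} \<times> {..<R}"
abbreviation "XX \<equiv> (\<Union>t\<in>I. X t)"
abbreviation "YY \<equiv> (\<Union>b<B. Y b)"
text \<open>\<open>q\<close> is the probability that a tribe is satisfied, \<open>\<pi>\<close> that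
  it is the only satisfied one; see \<open>prob_sat\<close> and \<open>prob_uniq\<close>.\<close>

abbreviation "q \<equiv> 1 / 2 ^ w :: real"
abbreviation "\<pi> \<equiv> q * (1 - q) ^ (B * R - 1)"

definition sat :: "nat \<times> nat \<Rightarrow> (nat \<Rightarrow> bool) \<Rightarrow> bool" where
  "sat t x \<longleftrightarrow> (\<forall>j\<in>X t. x j)"

definition maj :: "nat \<Rightarrow> (nat \<Rightarrow> bool) \<Rightarrow> bool" where
  "maj b x \<longleftrightarrow> \<kappa> < card {j \<in> Y b. x j}"

definition H :: "(nat \<Rightarrow> bool) \<Rightarrow> bool" where
  "H x \<longleftrightarrow> (\<exists>t\<in>I. \<exists>t'\<in>I. t \<noteq> t' \<and> sat t x \<and> sat t' x) \<or> (\<exists>t\<in>I. sat t x \<and> maj (fst t) x)"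

definition none :: "(nat \<Rightarrow> bool) \<Rightarrow> bool" where
  "none x \<longleftrightarrow> (\<forall>t\<in>I. \<not> sat t x)"

definition uniq :: "nat \<times> nat \<Rightarrow> (nat \<Rightarrow> bool) \<Rightarrow> bool" where
  "uniq t x \<longleftrightarrow> sat t x \<and> (\<forall>t'\<in>I - {t}. \<not> sat t' x)"

definition F :: "(nat \<Rightarrow> bool) \<Rightarrow> bool" where
  "F = gated U Z H g"

lemma fin: "finite U" "finite Z" "finite V" "finite XX" "XX \<subseteq> {..<n}" "YY \<subseteq> {..<n}"
  and fin_X: "t \<in> I \<Longrightarrow> finite (X t)" and fin_Y: "b < B \<Longrightarrow> finite (Y b)"
proof -
  show *: "XX \<subseteq> {..<n}"
    using X by (intro UN_least) simp
  show "YY \<subseteq> {..<n}"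
    using Y by (intro UN_least) simp
  show "finite U" "finite Z" "finite V" "finite XX"
    by (rule finite_subset[OF U(1)] finite_subset[OF Z(1)] finite_subset[OF V(1)]
        finite_subset[OF *], simp)+
  show "finite (X t)" if "t \<in> I"
    by (rule finite_subset[OF conjunct1[OF X[OF that]]]) simp
  show "finite (Y b)" if "b < B"
    by (rule finite_subset[OF conjunct1[OF Y[OF that]]]) simp
qed

lemma H_cong:
  assumes "\<And>t. t \<in> I \<Longrightarrow> sat t x = sat t y" "\<And>t. t \<in> I \<Longrightarrow> maj (fst t) x = maj (fst t) y"
  shows "H x = H y"
  by (simp only: H_def assms cong: bex_cong)

lemma H_uniq:
  assumes "t \<in> I" "uniq t x"
  shows "H x = maj (fst t) x"
proof -
  have s: "sat t x" "t' \<in> I \<Longrightarrow> sat t' x \<Longrightarrow> t' = t" for t'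
    using assms(2) unfolding uniq_def by blast+
  have "\<not> (\<exists>t\<in>I. \<exists>t'\<in>I. t \<noteq> t' \<and> sat t x \<and> sat t' x)"
    using s(2) by metis
  moreover have "(\<exists>t'\<in>I. sat t' x \<and> maj (fst t') x) = maj (fst t) x"
    using s assms(1) by metis
  ultimately show ?thesis
    by (simp only: H_def simp_thms)
qed

lemma H_none: "none x \<Longrightarrow> \<not> H x"
  unfolding H_def none_def by simp

lemma H_many:
  assumes "\<not> none x" "\<And>t. t \<in> I \<Longrightarrow> \<not> uniq t x"
  shows "H x"
proof -
  obtain t where t: "t \<in> I" "sat t x"
    using assms(1) by (auto simp: none_def)
  then obtain t' where "t' \<in> I" "t' \<noteq> t" "sat t' x"
    using assms(2)[OF t(1)] unfolding uniq_def by blast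
  then have "\<exists>t\<in>I. \<exists>t'\<in>I. t \<noteq> t' \<and> sat t x \<and> sat t' x"
    using t by (intro bexI[of _ t] bexI[of _ t']) auto
  then show ?thesis
    by (simp only: H_def simp_thms)
qed

lemma mono_H: "mono H"
proof (rule monoI)
  fix x y :: "nat \<Rightarrow> bool"
  assume "x \<le> y"
  then have xy: "x j \<Longrightarrow> y j" for j
    by (auto simp: le_fun_def)
  have "sat t x \<Longrightarrow> sat t y" for t
    using xy by (auto simp: sat_def)
  moreover have "maj b x \<Longrightarrow> maj b y" if "b < B" for b
  proof -
    have "card {j \<in> Y b. x j} \<le> card {j \<in> Y b. y j}"
      using xy fin_Y[OF that] by (intro card_mono) auto
    then show "maj b x \<Longrightarrow> maj b y"
      by (simp add: maj_def)
  qed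
  ultimately show "H x \<le> H y"
    unfolding H_def le_bool_def by (metis (no_types, lifting) SigmaE fst_conv lessThan_iff)
qed

lemma mono_F: "mono g \<Longrightarrow> mono F"
  using mono_H unfolding F_def gated_def mono_def le_fun_def le_bool_def by blast

lemma dep_sat: "depends_only (X t) (sat t)"
  by (auto simp: depends_only_def sat_def)

lemma sat_cong:
  assumes "t \<in> J" "\<And>j. j \<in> (\<Union>t\<in>J. X t) \<Longrightarrow> x j = y j"
  shows "sat t x = sat t y"
  by (rule depends_onlyD[OF dep_sat], rule assms(2)) (use assms(1) in auto)

lemma dep_no_sat: "depends_only (\<Union>t\<in>J. X t) (\<lambda>x. \<forall>t\<in>J. \<not> sat t x)"
proof (rule depends_onlyI)
  fix x y :: "nat \<Rightarrow> bool"
  assume xy: "\<And>j. j \<in> (\<Union>t\<in>J. X t) \<Longrightarrow> x j = y j"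
  have "sat t x = sat t y" if "t \<in> J" for t
    using that xy by (rule sat_cong)
  then show "(\<forall>t\<in>J. \<not> sat t x) = (\<forall>t\<in>J. \<not> sat t y)"
    by simp
qed

lemma dep_none: "depends_only XX none"
  using dep_no_sat[of I] by (simp add: none_def[abs_def])

lemma dep_uniq:
  assumes "t \<in> I"
  shows "depends_only XX (uniq t)"
proof -
  have "depends_only XX (\<lambda>x. sat t x \<and> (\<forall>t'\<in>I - {t}. \<not> sat t' x))"
    using assms by (intro depends_only_conj depends_only_mono[OF dep_sat]
        depends_only_mono[OF dep_no_sat]) auto
  then show ?thesis
    by (simp only: uniq_def[abs_def])
qed

lemma dep_maj: "depends_only (Y b) (maj b)"
proof (rule depends_onlyI)
  fix x y :: "nat \<Rightarrow> bool"
  assume "\<And>j. j \<in> Y b \<Longrightarrow> x j = y j"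
  then have "{j \<in> Y b. x j} = {j \<in> Y b. y j}" by auto
  then show "maj b x = maj b y"
    by (simp add: maj_def)
qed

lemma dep_H: "depends_only (XX \<union> YY) H"
proof (rule depends_onlyI)
  fix x y :: "nat \<Rightarrow> bool"
  assume xy: "\<And>j. j \<in> XX \<union> YY \<Longrightarrow> x j = y j"
  show "H x = H y"
  proof (rule H_cong)
    show "sat t x = sat t y" if "t \<in> I" for t
      by (rule sat_cong[OF that], rule xy, rule UnI1)
    show "maj (fst t) x = maj (fst t) y" if "t \<in> I" for t
      by (rule depends_onlyD[OF dep_maj], rule xy) (use that in auto)
  qed
qed

lemma dep_F: "depends_only {..<n} F"
  unfolding F_def gated_def
  by (intro depends_only_conj depends_only_disj depends_only_ex depends_only_all U Z
      depends_only_mono[OF dep_H] depends_only_mono[OF V(2) V(1)]) (use fin in auto)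

lemma prob_sat: "t \<in> I \<Longrightarrow> cube_prob n (sat t) = q"
  using cube_prob_all_eq[OF fin_X, of t n True] X[of t] by (simp add: sat_def[abs_def])

lemma prob_none: "J \<subseteq> I \<Longrightarrow> cube_prob n (\<lambda>x. \<forall>t\<in>J. \<not> sat t x) = (1 - q) ^ card J"
proof (induction J rule: infinite_finite_induct)
  case (infinite J)
  then show ?case
    using finite_subset[of J I] by auto
next
  case (insert t J)
  have t: "t \<in> I" using insert by auto
  have "cube_prob n (\<lambda>x. \<not> sat t x \<and> (\<forall>t'\<in>J. \<not> sat t' x))
      = cube_prob n (\<lambda>x. \<not> sat t x) * cube_prob n (\<lambda>x. \<forall>t'\<in>J. \<not> sat t' x)"
  proof (rule cube_prob_conj[of "X t" n "\<Union>t'\<in>J. X t'"])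
    show "X t \<inter> (\<Union>t'\<in>J. X t') = {}"
      using X_disj insert.hyps insert.prems unfolding disjoint_family_on_def by blast
    show "depends_only (\<Union>t'\<in>J. X t') (\<lambda>x. \<forall>t'\<in>J. \<not> sat t' x)"
      by (rule dep_no_sat)
    show "depends_only (X t) (\<lambda>x. \<not> sat t x)"
      by (rule depends_only_comp[OF dep_sat])
  qed (use X[OF t] fin_X[OF t] in auto)
  moreover have "cube_prob n (\<lambda>x. \<not> sat t x) = 1 - q"
    by (simp only: cube_prob_not prob_sat[OF t])
  ultimately show ?case
    using insert by simp
qed simp

lemma prob_uniq: assumes t: "t \<in> I" shows "cube_prob n (uniq t) = \<pi>"
proof -
  have "cube_prob n (\<lambda>x. sat t x \<and> (\<forall>t'\<in>I - {t}. \<not> sat t' x))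
      = cube_prob n (sat t) * cube_prob n (\<lambda>x. \<forall>t'\<in>I - {t}. \<not> sat t' x)"
  proof (rule cube_prob_conj[of "X t" n "\<Union>t'\<in>I - {t}. X t'"])
    show "X t \<inter> (\<Union>t'\<in>I - {t}. X t') = {}"
      using X_disj t unfolding disjoint_family_on_def by blast
    show "depends_only (\<Union>t'\<in>I - {t}. X t') (\<lambda>x. \<forall>t'\<in>I - {t}. \<not> sat t' x)"
      by (rule dep_no_sat)
  qed (use X[OF t] fin_X[OF t] dep_sat in auto)
  moreover have "cube_prob n (sat t) = q"
    by (rule prob_sat[OF t])
  moreover have "cube_prob n (\<lambda>x. \<forall>t'\<in>I - {t}. \<not> sat t' x) = (1 - q) ^ (B * R - 1)"
    using prob_none[of "I - {t}"] t by (simp add: card_cartesian_product)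
  ultimately show ?thesis
    by (simp add: uniq_def[abs_def])
qed

text \<open>A restriction given by the set \<open>D\<close> of fixed variables and their values
  \<open>a\<close>; the order of the queries is forgotten, since energy and influences depend on
  \<open>D\<close> and \<open>a\<close> only.\<close>

definition Fr :: "nat set \<Rightarrow> (nat \<Rightarrow> bool) \<Rightarrow> (nat \<Rightarrow> bool) \<Rightarrow> real" where
  "Fr D a x = pm (F (override_on x a D))"

lemma override_on_upd: "i \<notin> D \<Longrightarrow> override_on (x(i := b)) a D = (override_on x a D)(i := b)"
  by (auto simp: override_on_def fun_eq_iff)

lemma override_on_insert:
  "i \<notin> D \<Longrightarrow> override_on x (a(i := b)) (insert i D) = override_on (x(i := b)) a D"
  by (auto simp: override_on_def fun_eq_iff)

lemma restrict_Fr: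
  assumes "i \<notin> D"
  shows "restrict_var (Fr D a) i b = Fr (insert i D) (a(i := b))"
  by (rule ext) (simp only: restrict_var_def Fr_def override_on_insert[OF assms])

lemma influence_Fr_fixed: "i \<in> D \<Longrightarrow> influence n i (Fr D a) = 0"
  by (rule influence_eq_0)
    (auto simp: depends_only_def Fr_def override_on_def intro!: arg_cong[of _ _ F])

text \<open>Flipping \<open>i\<close> matters only if the other \<open>w - 1\<close> variables of
  its tribe, all still free, are 1.\<close>

lemma influence_X_le:
  assumes D: "D \<inter> XX = {}" and t: "t \<in> I" and i: "i \<in> X t"
  shows "influence n i (Fr D a) \<le> 2 * q"
proof -
  have iD: "i \<notin> D" "i \<in> XX" "i \<notin> U" "i \<notin> Z" "i \<notin> V" "i \<notin> YY"
    using D t i XU XY by blast+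
  have X_iff: "i \<in> X t' \<longleftrightarrow> t' = t" if "t' \<in> I" for t'
    using X_disj t i that unfolding disjoint_family_on_def by blast
  have same: "F (x(i := c)) = F x" if j: "j \<in> X t - {i}" "\<not> x j" for x c j
  proof -
    have "sat t' (x(i := c)) = sat t' x" if "t' \<in> I" for t'
    proof (cases "t' = t")
      case True
      then show ?thesis
        using j by (auto simp: sat_def intro!: bexI[of _ j])
    next
      case False
      then show ?thesis
        by (intro depends_only_update[OF dep_sat]) (simp add: X_iff[OF that])
    qed
    moreover have "maj (fst t') (x(i := c)) = maj (fst t') x" if "t' \<in> I" for t'
      by (intro depends_only_update[OF dep_maj]) (use iD(6) that in auto)
    ultimately have "H (x(i := c)) = H x"
      by (rule H_cong)
    then show ?thesis
      unfolding F_def gated_def all_upd(3)[OF iD(3)] ex_upd(3)[OF iD(4)]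
        depends_only_update[OF V(2) iD(5)] by simp
  qed
  have "influence n i (Fr D a) \<le> cube_prob n (\<lambda>x. \<forall>j\<in>X t - {i}. x j = True)"
    unfolding influence_eq
  proof (rule cube_prob_mono, rule ccontr)
    fix x
    assume ne: "Fr D a x \<noteq> Fr D a (x(i := \<not> x i))" and "\<not> (\<forall>j\<in>X t - {i}. x j = True)"
    then obtain j where j: "j \<in> X t - {i}" "\<not> x j" by auto
    then have "\<not> override_on x a D j"
      using D t by (auto simp: override_on_def)
    from same[of j "override_on x a D" "\<not> x i", OF j(1) this] ne show False
      unfolding Fr_def override_on_upd[OF iD(1)] by simp
  qed
  also have "\<dots> = 1 / 2 ^ (w - 1)"
    using X[OF t] fin_X[OF t] i by (subst cube_prob_all_eq) auto
  also have "\<dots> = 2 * q"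
    using pos(2) by (cases w) auto
  finally show ?thesis .
qed

section \<open>Probability that the gate is decided\<close>

definition prob_U :: "nat set \<Rightarrow> (nat \<Rightarrow> bool) \<Rightarrow> real" where
  "prob_U D a = cube_prob n (\<lambda>x. \<forall>j\<in>U. override_on x a D j)"

definition prob_Z :: "nat set \<Rightarrow> (nat \<Rightarrow> bool) \<Rightarrow> real" where
  "prob_Z D a = cube_prob n (\<lambda>x. \<not> (\<exists>j\<in>Z. override_on x a D j))"

text \<open>Either \<open>U\<close> is entirely fixed to 1, or some variable of it is free or fixed
  to 0. With the dual statement for \<open>Z\<close> this gives the factor 1/4 in
  \<open>influence_Y_ge\<close>.\<close>

lemma prob_U_cases: "prob_U D a = 1 \<or> prob_U D a \<le> 1 / 2"
proof (cases "\<forall>j\<in>U. j \<in> D \<and> a j")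
  case True
  then have "(\<lambda>x. \<forall>j\<in>U. override_on x a D j) = (\<lambda>_. True)"
    by (auto simp: override_on_def)
  then show ?thesis
    by (simp add: prob_U_def)
next
  case False
  then obtain j where j: "j \<in> U" "j \<notin> D \<or> \<not> a j" by blast
  have "prob_U D a \<le> cube_prob n (\<lambda>x. x j = True)"
    unfolding prob_U_def using j by (intro cube_prob_mono) (force simp: override_on_def split: if_splits)
  also have "\<dots> = 1 / 2"
    using j U by (intro cube_prob_coordinate) auto
  finally show ?thesis ..
qed

lemma prob_Z_cases: "prob_Z D a = 1 \<or> prob_Z D a \<le> 1 / 2"
proof (cases "\<forall>j\<in>Z. j \<in> D \<and> \<not> a j")
  case True
  then have "(\<lambda>x. \<not> (\<exists>j\<in>Z. override_on x a D j)) = (\<lambda>_. True)"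
    by (auto simp: override_on_def)
  then show ?thesis
    by (simp add: prob_Z_def)
next
  case False
  then obtain j where j: "j \<in> Z" "j \<notin> D \<or> a j" by blast
  have "prob_Z D a \<le> cube_prob n (\<lambda>x. x j = False)"
    unfolding prob_Z_def using j by (intro cube_prob_mono) (force simp: override_on_def split: if_splits)
  also have "\<dots> = 1 / 2"
    using j Z by (intro cube_prob_coordinate) auto
  finally show ?thesis ..
qed

text \<open>A martingale along the tree, so that the initial value \<open>1 / 2 ^ r\<close> bounds
  the probability of arriving at a decided gate.\<close>

lemma prob_U_split:
  assumes "i < n" "i \<notin> D"
  shows "prob_U D a = (prob_U (insert i D) (a(i := False)) + prob_U (insert i D) (a(i := True))) / 2"
  unfolding prob_U_def override_on_insert[OF assms(2)] by (rule cube_prob_split[OF assms(1)])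

lemma prob_Z_split:
  assumes "i < n" "i \<notin> D"
  shows "prob_Z D a = (prob_Z (insert i D) (a(i := False)) + prob_Z (insert i D) (a(i := True))) / 2"
  unfolding prob_Z_def override_on_insert[OF assms(2)] by (rule cube_prob_split[OF assms(1)])

lemma prob_unique_in_block:
  assumes "b < B"
  shows "cube_prob n (\<lambda>x. \<exists>c<R. uniq (b, c) x) = R * \<pi>"
proof -
  have "of_bool (\<exists>c<R. uniq (b, c) x) = (\<Sum>c<R. of_bool (uniq (b, c) x) :: real)" for x
  proof (cases "\<exists>c<R. uniq (b, c) x")
    case True
    then obtain c where c: "c < R" "uniq (b, c) x" by blast
    have "uniq (b, c') x \<longleftrightarrow> c' = c" if "c' < R" for c'
      using c that assms unfolding uniq_def by auto
    then have "(\<Sum>c'<R. of_bool (uniq (b, c') x) :: real) = (\<Sum>c'<R. if c' = c then 1 else 0)"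
      by (intro sum.cong) auto
    then show ?thesis
      using c True by simp
  qed simp
  then have "cube_prob n (\<lambda>x. \<exists>c<R. uniq (b, c) x) = (\<Sum>c<R. cube_prob n (uniq (b, c)))"
    by (simp only: cube_prob_def cube_mean_sum)
  also have "\<dots> = R * \<pi>"
    using assms by (simp add: prob_uniq)
  finally show ?thesis .
qed

text \<open>Variable \<open>i\<close> is pivotal if four independent events occur: \<open>U\<close>
  is not all 1, \<open>Z\<close> is not all 0, exactly one tribe is satisfied and it belongs to
  block \<open>b\<close>, and the other voters of the block are split evenly.\<close>

lemma influence_Y_ge:
  assumes D: "D \<inter> XX = {}" and b: "b < B" and i: "i \<in> Y b" "i \<notin> D"
    and bad: "prob_U D a \<le> 1 / 2" "prob_Z D a \<le> 1 / 2"
    and ones: "card {j \<in> Y b \<inter> D. a j} \<le> \<kappa>"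
  shows "1 / 4 * (R * \<pi>) * (real (card (Y b - D - {i}) choose (\<kappa> - card {j \<in> Y b \<inter> D. a j})) /
    2 ^ card (Y b - D - {i})) \<le> influence n i (Fr D a)"
proof -
  let ?o = "\<lambda>x. override_on x a D"
  let ?S = "Y b - D - {i}"
  let ?E1 = "\<lambda>x. \<not> (\<forall>j\<in>U. ?o x j)"
  let ?E2 = "\<lambda>x. \<exists>j\<in>Z. ?o x j"
  let ?E3 = "\<lambda>x. \<exists>c<R. uniq (b, c) x"
  \<comment> \<open>Together with the ones already fixed, exactly \<open>\<kappa>\<close> of the
    other \<open>2 * \<kappa>\<close> voters are 1, so bit \<open>i\<close> decides the
    vote.\<close>
  let ?E4 = "\<lambda>x. card {j \<in> ?S. x j} = \<kappa> - card {j \<in> Y b \<inter> D. a j}"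
  have S: "finite ?S" "?S \<subseteq> {..<n}"
    using Y[OF b] fin_Y[OF b] by auto
  have iD: "i \<notin> U" "i \<notin> Z" "i \<notin> XX"
    using b i XY YU by blast+
  have disj: "?S \<inter> (U \<union> (Z \<union> XX)) = {}" "U \<inter> (Z \<union> XX) = {}" "Z \<inter> XX = {}"
    using b XY XU YU UZV by blast+
  have d1: "depends_only U ?E1"
    by (rule depends_onlyI) (auto simp: override_on_def)
  have d2: "depends_only Z ?E2"
    by (rule depends_onlyI) (auto simp: override_on_def)
  have d3: "depends_only XX ?E3"
  proof (rule depends_onlyI)
    fix x y :: "nat \<Rightarrow> bool"
    assume "\<And>j. j \<in> XX \<Longrightarrow> x j = y j"
    then have "uniq (b, c) x = uniq (b, c) y" if "c < R" for c
      using that b by (intro depends_onlyD[OF dep_uniq]) auto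
    then show "?E3 x = ?E3 y" by blast
  qed
  have d4: "depends_only ?S ?E4"
  proof (rule depends_onlyI)
    fix x y :: "nat \<Rightarrow> bool"
    assume "\<And>j. j \<in> ?S \<Longrightarrow> x j = y j"
    then have "{j \<in> ?S. x j} = {j \<in> ?S. y j}" by auto
    then show "?E4 x = ?E4 y" by simp
  qed
  have d23: "depends_only (Z \<union> XX) (\<lambda>x. ?E2 x \<and> ?E3 x)"
    by (intro depends_only_conj depends_only_mono[OF d2] depends_only_mono[OF d3]) auto
  have d123: "depends_only (U \<union> (Z \<union> XX)) (\<lambda>x. ?E1 x \<and> ?E2 x \<and> ?E3 x)"
    by (intro depends_only_conj depends_only_mono[OF d1] depends_only_mono[OF d2]
        depends_only_mono[OF d3]) auto
  have e: "cube_prob n (\<lambda>x. ?E4 x \<and> ?E1 x \<and> ?E2 x \<and> ?E3 x)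
      = cube_prob n ?E4 * (cube_prob n ?E1 * (cube_prob n ?E2 * (R * \<pi>)))"
    unfolding cube_prob_conj[OF S disj(1) d4 d123]
      cube_prob_conj[OF fin(1) U(1) disj(2) d1 d23] cube_prob_conj[OF fin(2) Z(1) disj(3) d2 d3]
      prob_unique_in_block[OF b] ..
  have e4: "cube_prob n ?E4
      = real (card ?S choose (\<kappa> - card {j \<in> Y b \<inter> D. a j})) / 2 ^ card ?S"
    by (rule cube_prob_card_eq[OF S])
  have p1: "1 / 2 \<le> cube_prob n ?E1"
    using bad(1) cube_prob_not[of n "\<lambda>x. \<forall>j\<in>U. ?o x j"] unfolding prob_U_def by linarith
  have p2: "1 / 2 \<le> cube_prob n ?E2"
    using bad(2) cube_prob_not[of n ?E2] unfolding prob_Z_def by linarith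
  have "1 / 4 * c * e \<le> e * (p1 * (p2 * c))"
    if "1 / 2 \<le> p1" "1 / 2 \<le> p2" "0 \<le> c" "0 \<le> e" for p1 p2 c e :: real
  proof -
    have "1 / 2 * (1 / 2) \<le> p1 * p2"
      using that by (intro mult_mono) auto
    then have "c * e * (1 / 4) \<le> c * e * (p1 * p2)"
      using that by (intro mult_left_mono) auto
    then show ?thesis
      by (simp add: ac_simps)
  qed
  from this[OF p1 p2, of "R * \<pi>" "cube_prob n ?E4"]
  have "1 / 4 * (R * \<pi>) * (real (card ?S choose (\<kappa> - card {j \<in> Y b \<inter> D. a j})) /
      2 ^ card ?S) \<le> cube_prob n (\<lambda>x. ?E4 x \<and> ?E1 x \<and> ?E2 x \<and> ?E3 x)"
    unfolding e e4 by (simp del: cube_prob_nonneg)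
  also have "\<dots> \<le> influence n i (Fr D a)"
    unfolding influence_eq
  proof (rule cube_prob_mono)
    fix x
    assume E: "?E4 x \<and> ?E1 x \<and> ?E2 x \<and> ?E3 x"
    then obtain c where c: "c < R" "uniq (b, c) x" by blast
    have val: "F (?o (x(i := v))) = v" for v
    proof -
      let ?y = "?o (x(i := v))"
      have "uniq (b, c) ?y = uniq (b, c) x"
        by (rule depends_onlyD[OF dep_uniq]) (use b c D iD in \<open>auto simp: override_on_def\<close>)
      then have "H ?y = maj b ?y"
        using H_uniq[of "(b, c)" ?y] b c by simp
      moreover have "\<not> (\<forall>j\<in>U. ?y j)" "\<exists>j\<in>Z. ?y j"
        using E iD(1,2) unfolding override_on_def by (auto split: if_splits)
      ultimately have "F ?y = maj b ?y"
        unfolding F_def gated_def by blast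
      moreover have "{j \<in> Y b. ?y j}
          = {j \<in> Y b \<inter> D. a j} \<union> {j \<in> ?S. x j} \<union> (if v then {i} else {})"
        using i by (auto simp: override_on_def)
      moreover have "card ({j \<in> Y b \<inter> D. a j} \<union> {j \<in> ?S. x j} \<union> (if v then {i} else {}))
          = card {j \<in> Y b \<inter> D. a j} + card {j \<in> ?S. x j} + of_bool v"
      proof -
        have f: "finite {j \<in> Y b \<inter> D. a j}" "finite {j \<in> ?S. x j}"
          using fin_Y[OF b] by auto
        have "card ({j \<in> Y b \<inter> D. a j} \<union> {j \<in> ?S. x j})
            = card {j \<in> Y b \<inter> D. a j} + card {j \<in> ?S. x j}"
          using f by (intro card_Un_disjoint) auto
        moreover have "card (({j \<in> Y b \<inter> D. a j} \<union> {j \<in> ?S. x j}) \<union> (if v then {i} else {}))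
            = card ({j \<in> Y b \<inter> D. a j} \<union> {j \<in> ?S. x j}) + card (if v then {i} else {})"
          using f i by (intro card_Un_disjoint) auto
        ultimately show ?thesis by (cases v) simp_all
      qed
      ultimately show ?thesis
        using E ones by (simp add: maj_def)
    qed
    have "x = x(i := x i)" by simp
    then have "F (?o x) = x i"
      using val[of "x i"] by metis
    then show "Fr D a x \<noteq> Fr D a (x(i := \<not> x i))"
      using val[of "\<not> x i"] by (simp add: Fr_def)
  qed
  finally show ?thesis .
qed

section \<open>Imbalance of the blocks and its energy\<close>

definition bias :: "nat \<Rightarrow> nat set \<Rightarrow> (nat \<Rightarrow> bool) \<Rightarrow> real" where
  "bias b D a = (\<Sum>j\<in>Y b \<inter> D. pm (a j))"

definition energy :: "nat set \<Rightarrow> (nat \<Rightarrow> bool) \<Rightarrow> real" where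
  "energy D a = (\<Sum>b<B. (bias b D a)\<^sup>2)"

lemma bias_insert:
  assumes "b < B" "i \<notin> D"
  shows "bias b (insert i D) (a(i := v)) = bias b D a + (if i \<in> Y b then pm v else 0)"
proof -
  have e: "(\<Sum>j\<in>Y b \<inter> D. pm ((a(i := v)) j)) = (\<Sum>j\<in>Y b \<inter> D. pm (a j))"
    using assms(2) by (intro sum.cong) auto
  show ?thesis
  proof (cases "i \<in> Y b")
    case True
    then have "Y b \<inter> insert i D = insert i (Y b \<inter> D)" by auto
    then show ?thesis
      using True assms fin_Y[OF assms(1)] e by (simp add: bias_def del: fun_upd_apply) simp
  next
    case False
    then have "Y b \<inter> insert i D = Y b \<inter> D" by auto
    then show ?thesis
      using False e by (simp add: bias_def del: fun_upd_apply)
  qed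
qed

text \<open>The mean of \<open>(z + 1)\<^sup>2\<close> and \<open>(z - 1)\<^sup>2\<close> is
  \<open>z\<^sup>2 + 1\<close>, and \<open>i\<close> belongs to at most one block.\<close>

lemma energy_split:
  assumes "i \<notin> D"
  shows "(energy (insert i D) (a(i := False)) + energy (insert i D) (a(i := True))) / 2
    \<le> energy D a + 1"
proof -
  have "(energy (insert i D) (a(i := False)) + energy (insert i D) (a(i := True))) / 2
      = (\<Sum>b<B. (bias b D a)\<^sup>2 + of_bool (i \<in> Y b))"
    unfolding energy_def sum.distrib[symmetric] sum_divide_distrib
    using assms by (intro sum.cong) (auto simp: bias_insert pm_def power2_eq_square algebra_simps)
  also have "\<dots> = energy D a + (\<Sum>b<B. of_bool (i \<in> Y b))"
    by (simp add: energy_def sum.distrib)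
  also have "(\<Sum>b<B. of_bool (i \<in> Y b)) \<le> (1 :: real)"
  proof (cases "\<exists>b<B. i \<in> Y b")
    case True
    then obtain b where b: "b < B" "i \<in> Y b" by blast
    then have "(\<Sum>b'<B. of_bool (i \<in> Y b') :: real) = (\<Sum>b'<B. if b' = b then 1 else 0)"
      using Y_disj by (intro sum.cong) (auto simp: disjoint_family_on_def)
    then show ?thesis
      using b by simp
  next
    case False
    then have "(\<Sum>b<B. of_bool (i \<in> Y b) :: real) = 0"
      by (intro sum.neutral) auto
    then show ?thesis by simp
  qed
  finally show ?thesis by simp
qed

lemma bias_eq:
  assumes "b < B"
  shows "bias b D a = 2 * real (card {j \<in> Y b \<inter> D. a j}) - real (card (Y b \<inter> D))"
proof -
  have f: "finite (Y b \<inter> D)" using fin_Y[OF assms] by simp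
  have "pm v = 2 * of_bool v - 1" for v
    by (simp add: pm_def)
  then have "bias b D a = (\<Sum>j\<in>Y b \<inter> D. 2 * of_bool (a j) - 1)"
    by (simp add: bias_def)
  also have "\<dots> = 2 * real (card {j \<in> Y b \<inter> D. a j}) - real (card (Y b \<inter> D))"
  proof -
    have "(\<Sum>j\<in>Y b \<inter> D. of_bool (a j)) = real (card {j \<in> Y b \<inter> D. a j})"
      unfolding of_bool_def sum.inter_filter[OF f, symmetric] by simp
    then show ?thesis
      by (simp only: sum_subtractf sum_distrib_left[symmetric]) simp
  qed
  finally show ?thesis .
qed

end

section \<open>The energy argument\<close>

context tribes_blocks
begin

text \<open>The energy minus the number of queries is a supermartingale along the random path of the
  tree. The first query to a tribe happens only when the energy is large or the gate is decided.\<close>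

lemma hit_within_le:
  fixes T :: "'a dtree" and K :: real
  assumes gap: "\<And>f t. \<kappa> \<le> f \<Longrightarrow> f \<le> 2 * \<kappa> \<Longrightarrow> t \<le> f \<Longrightarrow> (real f - 2 * real t)\<^sup>2 < K \<Longrightarrow>
      2 * q < 1 / 4 * (R * \<pi>) * (real (f choose t) / 2 ^ f)"
    and K: "0 < K" and \<Lambda>: "2 * \<Lambda> \<le> B * (\<kappa> + 1)"
  shows "greedy n T (Fr D a) \<Longrightarrow> D \<inter> XX = {} \<Longrightarrow> finite D \<Longrightarrow> card D + d \<le> \<Lambda> \<Longrightarrow>
    hit_within XX T d \<le> (energy D a + d) * (2 / (B * K)) + prob_U D a + prob_Z D a"
proof (induction T arbitrary: D a d)
  case (Leaf u)
  then show ?case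
    using K by (simp add: energy_def prob_U_def prob_Z_def sum_nonneg)
next
  case (Query i l r)
  have nonneg: "0 \<le> energy D a" "0 \<le> prob_U D a" "0 \<le> prob_Z D a"
    by (simp_all add: energy_def prob_U_def prob_Z_def sum_nonneg)
  show ?case
  proof (cases d)
    case 0
    then show ?thesis
      using nonneg K by simp
  next
    case (Suc d')
    have i: "i < n" "0 < influence n i (Fr D a)"
      and max: "\<And>k. k < n \<Longrightarrow> influence n k (Fr D a) \<le> influence n i (Fr D a)"
      using Query.prems(1) by simp_all
    have iD: "i \<notin> D"
      using i(2) influence_Fr_fixed[of i D a] by auto
    show ?thesis
    proof (cases "i \<in> XX")
      case True
      then obtain t where t: "t \<in> I" "i \<in> X t" by blast
      \<comment> \<open>A query to a tribe is possible only at a decided gate or with energy at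
        least \<open>B * K / 2\<close>, since otherwise some block offers a more influential
        variable.\<close>
      have "1 \<le> energy D a * (2 / (B * K)) + prob_U D a + prob_Z D a"
      proof (cases "prob_U D a = 1 \<or> prob_Z D a = 1")
        case True
        then show ?thesis
          using nonneg K by (auto intro: add_increasing add_increasing2)
      next
        case False
        then have bad: "prob_U D a \<le> 1 / 2" "prob_Z D a \<le> 1 / 2"
          using prob_U_cases prob_Z_cases by blast+
        \<comment> \<open>A block with at most \<open>\<kappa>\<close> queried voters and squared
          bias below \<open>K\<close> has a free voter whose influence exceeds \<open>2 * q\<close>
          by \<open>gap\<close>, contrary to the greedy choice of \<open>i\<close>.\<close>
        have "1 \<le> real (card (Y b \<inter> D)) / (\<kappa> + 1) + (bias b D a)\<^sup>2 / K" if b: "b < B" for b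
        proof (rule ccontr)
          assume neg: "\<not> ?thesis"
          let ?m = "card (Y b \<inter> D)" and ?o = "card {j \<in> Y b \<inter> D. a j}"
          have "real ?m / (\<kappa> + 1) < 1" "(bias b D a)\<^sup>2 / K < 1"
            using neg K by (smt (verit) divide_nonneg_nonneg of_nat_0_le_iff zero_le_power2)+
          then have m: "?m \<le> \<kappa>" and bias: "(bias b D a)\<^sup>2 < K"
            using K by (simp_all add: divide_simps)
          have fY: "finite (Y b)" "card (Y b) = 2 * \<kappa> + 1"
            using Y[OF b] fin_Y[OF b] by auto
          have "Y b - D \<noteq> {}"
          proof
            assume "Y b - D = {}"
            then have "Y b \<inter> D = Y b" by blast
            then show False
              using m fY by simp
          qed
          then obtain j where j: "j \<in> Y b" "j \<notin> D" by blast
          have o: "?o \<le> ?m"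
            using fY by (intro card_mono) auto
          have f: "card (Y b - D - {j}) = 2 * \<kappa> - ?m"
            using fY j by (simp add: card_Diff_subset_Int)
          have bias_f: "(real (2 * \<kappa> - ?m) - 2 * real (\<kappa> - ?o))\<^sup>2 = (bias b D a)\<^sup>2"
            using m o by (simp add: bias_eq[OF b] of_nat_diff)
          have "2 * q < 1 / 4 * (R * \<pi>) * (real (2 * \<kappa> - ?m choose (\<kappa> - ?o)) / 2 ^ (2 * \<kappa> - ?m))"
            by (rule gap) (use m o bias_f bias in auto)
          also have "\<dots> \<le> influence n j (Fr D a)"
            using influence_Y_ge[OF Query.prems(2) b j bad] m o by (simp only: f)
          also have "\<dots> \<le> influence n i (Fr D a)"
            using max j Y[OF b] by blast
          also have "\<dots> \<le> 2 * q"
            by (rule influence_X_le[OF Query.prems(2) t])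
          finally show False by simp
        qed
        then have "real B \<le> (\<Sum>b<B. real (card (Y b \<inter> D)) / (\<kappa> + 1) + (bias b D a)\<^sup>2 / K)"
          using sum_mono[of "{..<B}" "\<lambda>_. 1 :: real"] by simp
        also have "\<dots> = real (\<Sum>b<B. card (Y b \<inter> D)) / (\<kappa> + 1) + energy D a / K"
          by (simp add: sum.distrib sum_divide_distrib[symmetric] energy_def)
        also have "(\<Sum>b<B. card (Y b \<inter> D)) = card (\<Union>b<B. Y b \<inter> D)"
          using Query.prems(3) Y_disj
          by (intro card_UN_disjoint[symmetric]) (auto simp: disjoint_family_on_def)
        also have "card (\<Union>b<B. Y b \<inter> D) \<le> card D"
          using Query.prems(3) by (intro card_mono) auto
        \<comment> \<open>The budget \<open>\<Lambda>\<close> accounts for at most half of the sum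
          over the blocks; the other half must come from the energy.\<close>
        also have "real (card D) / (\<kappa> + 1) \<le> B / 2"
        proof -
          have "2 * card D \<le> B * (\<kappa> + 1)"
            using Query.prems(4) \<Lambda> by linarith
          then have "real (2 * card D) \<le> real (B * (\<kappa> + 1))"
            by (simp only: of_nat_le_iff)
          then show ?thesis
            by (simp add: divide_simps algebra_simps)
        qed
        finally have "B / 2 \<le> energy D a / K"
          using K by (simp add: divide_right_mono field_simps)
        then have "1 \<le> energy D a * (2 / (B * K))"
          using K pos(1) by (simp add: field_simps)
        then show ?thesis
          using nonneg by linarith
      qed
      moreover have "energy D a * (2 / (B * K)) \<le> (energy D a + d) * (2 / (B * K))"
        using K by (intro mult_right_mono) auto
      ultimately show ?thesis
        using True Suc by (simp del: UN_iff)
    next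
      case False
      let ?c = "2 / (B * K)"
      have c: "0 \<le> ?c" using K by simp
      have gr: "greedy n l (Fr (insert i D) (a(i := False)))" "greedy n r (Fr (insert i D) (a(i := True)))"
        using Query.prems(1) by (simp_all add: restrict_Fr[OF iD] del: fun_upd_apply)
      have D': "insert i D \<inter> XX = {}" "finite (insert i D)" "card (insert i D) + d' \<le> \<Lambda>"
        using Query.prems False iD Suc by auto
      have IH: "hit_within XX l d' \<le> (energy (insert i D) (a(i := False)) + d') * ?c
            + prob_U (insert i D) (a(i := False)) + prob_Z (insert i D) (a(i := False))"
        "hit_within XX r d' \<le> (energy (insert i D) (a(i := True)) + d') * ?c
            + prob_U (insert i D) (a(i := True)) + prob_Z (insert i D) (a(i := True))"
        using Query.IH(1)[OF gr(1) D'] Query.IH(2)[OF gr(2) D'] .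
      have "hit_within XX (Query i l r) d = (hit_within XX l d' + hit_within XX r d') / 2"
        using False Suc by (simp del: UN_iff)
      also have "\<dots> \<le> ((energy (insert i D) (a(i := False)) + energy (insert i D) (a(i := True))) / 2 + d') * ?c
          + prob_U D a + prob_Z D a"
      proof -
        have avg: "a0 \<le> x0 + u0 + z0 \<Longrightarrow> a1 \<le> x1 + u1 + z1 \<Longrightarrow>
            (a0 + a1) / 2 \<le> (x0 + x1) / 2 + (u0 + u1) / 2 + (z0 + z1) / 2"
          for a0 a1 x0 x1 u0 u1 z0 z1 :: real
          by (simp add: field_simps)
        have "((e0 + e1) / 2 + d') * c = ((e0 + d') * c + (e1 + d') * c) / 2" for e0 e1 c :: real
          by (simp add: field_simps)
        then show ?thesis
          unfolding prob_U_split[OF i(1) iD, of a] prob_Z_split[OF i(1) iD, of a]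
          by (simp only: avg[OF IH])
      qed
      also have "\<dots> \<le> (energy D a + 1 + d') * ?c + prob_U D a + prob_Z D a"
        using energy_split[OF iD, of a] c by (intro add_right_mono mult_right_mono) auto
      finally show ?thesis
        using Suc by (simp add: add.assoc)
    qed
  qed
qed

section \<open>Error of a guess that ignores the tribes\<close>

lemma cube_prob_maj: assumes "b < B" shows "cube_prob n (maj b) = 1 / 2"
proof -
  \<comment> \<open>The number of voters is odd, so complementing all bits reverses the
    vote.\<close>
  have "maj b (\<lambda>i. if i < n then \<not> x i else x i) = (\<not> maj b x)" for x
  proof -
    have "{j \<in> Y b. if j < n then \<not> x j else x j} = Y b - {j \<in> Y b. x j}"
      using Y[OF assms] by auto
    then have "card {j \<in> Y b. if j < n then \<not> x j else x j} = 2 * \<kappa> + 1 - card {j \<in> Y b. x j}"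
      using Y[OF assms] fin_Y[OF assms] by (simp add: card_Diff_subset)
    then show ?thesis
      unfolding maj_def by linarith
  qed
  then have "cube_prob n (maj b) = 1 - cube_prob n (maj b)"
    unfolding cube_prob_not[symmetric] by (subst cube_prob_def, subst cube_mean_complement)
      (simp add: cube_prob_def)
  then show ?thesis by simp
qed

text \<open>The votes are independent fair signs, so the mixed terms vanish in the mean.\<close>

lemma mean_square_sum_maj:
  "m \<le> B \<Longrightarrow> cube_mean n (\<lambda>x. (\<Sum>b<m. pm (maj b x))\<^sup>2) = m"
proof (induction m)
  case (Suc m)
  let ?S = "\<lambda>x. \<Sum>b<m. pm (maj b x)"
  have mB: "m < B" using Suc.prems by simp
  have "depends_only (\<Union>b<m. Y b) ?S"
  proof (rule depends_onlyI)
    fix x y :: "nat \<Rightarrow> bool"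
    assume xy: "\<And>j. j \<in> (\<Union>b<m. Y b) \<Longrightarrow> x j = y j"
    have "maj b x = maj b y" if "b < m" for b
      by (rule depends_onlyD[OF dep_maj], rule xy) (use that in auto)
    then show "?S x = ?S y"
      by (intro sum.cong) auto
  qed
  moreover have "Y m \<inter> Y b = {}" if "b < m" for b
    using disjoint_family_onD[OF Y_disj, of m b] that mB by auto
  then have "Y m \<inter> (\<Union>b<m. Y b) = {}"
    by blast
  ultimately have "cube_mean n (\<lambda>x. pm (maj m x) * ?S x)
      = cube_mean n (\<lambda>x. pm (maj m x)) * cube_mean n ?S"
    using Y[OF mB] fin_Y[OF mB]
    by (intro cube_mean_mult[of "Y m" n "\<Union>b<m. Y b"] depends_only_comp[OF dep_maj]) auto
  then have 0: "cube_mean n (\<lambda>x. pm (maj m x) * ?S x) = 0"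
    by (simp add: cube_mean_pm cube_prob_maj[OF mB])
  have "(\<Sum>b<Suc m. pm (maj b x))\<^sup>2 = (?S x)\<^sup>2 + (2 * (pm (maj m x) * ?S x) + 1)" for x
    by (simp add: power2_eq_square algebra_simps pm_def)
  then have "cube_mean n (\<lambda>x. (\<Sum>b<Suc m. pm (maj b x))\<^sup>2)
      = cube_mean n (\<lambda>x. (?S x)\<^sup>2) + (2 * cube_mean n (\<lambda>x. pm (maj m x) * ?S x) + 1)"
    by (simp only: cube_mean_add cube_mean_cmult cube_mean_const)
  then show ?case
    using Suc 0 by simp
qed simp

lemma mean_abs_sum_maj: "cube_mean n (\<lambda>x. \<bar>\<Sum>b<B. pm (maj b x)\<bar>) \<le> sqrt B"
proof -
  let ?S = "\<lambda>x. \<Sum>b<B. pm (maj b x)"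
  have s: "0 < sqrt B" "sqrt B * sqrt B = B"
    using pos(1) by auto
  \<comment> \<open>AM-GM; taking means, it bounds the first absolute moment by means of the second
    moment, which is \<open>B\<close>.\<close>
  have "\<bar>z\<bar> \<le> (1 / (2 * sqrt B)) * z\<^sup>2 + sqrt B / 2" for z :: real
  proof -
    have "0 \<le> (\<bar>z\<bar> - sqrt B)\<^sup>2" by simp
    then have "2 * (\<bar>z\<bar> * sqrt B) \<le> z\<^sup>2 + sqrt B * sqrt B"
      by (simp add: power2_eq_square algebra_simps abs_mult_self_eq)
    then show ?thesis
      using s(1) by (simp add: field_simps)
  qed
  then have "cube_mean n (\<lambda>x. \<bar>?S x\<bar>)
      \<le> cube_mean n (\<lambda>x. (1 / (2 * sqrt B)) * (?S x)\<^sup>2 + sqrt B / 2)"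
    by (intro cube_mean_mono)
  also have "\<dots> = (1 / (2 * sqrt B)) * B + sqrt B / 2"
    by (simp only: cube_mean_add cube_mean_cmult cube_mean_const mean_square_sum_maj order_refl)
  also have "\<dots> = sqrt B"
    using s by (simp add: field_simps)
  finally show ?thesis .
qed

text \<open>No satisfied tribe punishes the guess 1 and several satisfied tribes punish the guess 0.
  By \<open>p(1)\<close> the latter is at least as likely, so these two cases contribute at least
  the probability of the former. If exactly one tribe is satisfied, each block is equally likely to
  contain it, and no guess matches many more than half of the votes. By \<open>p(2)\<close> the
  total is close to 1/2.\<close>

lemma error_without_tribes:
  assumes L: "depends_only (- XX) L"
    and p: "(1 - q) ^ (B * R) \<le> 1 - (1 - q) ^ (B * R) - B * R * \<pi>"
      "1 - 2 * (1 - q) ^ (B * R) - B * R * \<pi> \<le> \<eta>"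
  shows "1 / 2 - \<eta> / 2 - 1 / (2 * sqrt B) - 2 / 2 ^ r \<le> cube_prob n (\<lambda>x. F x \<noteq> L x)"
proof -
  let ?p0 = "(1 - q) ^ (B * R)"
  let ?S = "\<lambda>x. \<Sum>b<B. pm (maj b x)"
  let ?N = "\<lambda>x. of_bool (none x) :: real"
  let ?u = "\<lambda>t x. of_bool (uniq t x) :: real"
  let ?l = "\<lambda>x. of_bool (L x) :: real"
  let ?ne = "\<lambda>b x. of_bool (maj b x \<noteq> L x) :: real"
  have indep: "cube_mean n (\<lambda>x. P x * Q x) = cube_mean n P * cube_mean n Q"
    if "depends_only XX P" "depends_only (- XX) Q" for P Q
    by (rule cube_mean_mult[OF fin(4,5) _ that]) blast
  have dep_ne: "depends_only (- XX) (?ne b)" if "b < B" for b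
    by (rule depends_only_comp2[OF depends_only_mono[OF dep_maj] L, where h = "\<lambda>u v. of_bool (u \<noteq> v)"])
      (use that XY in blast)
  have meanN: "cube_mean n ?N = ?p0"
    using prob_none[of I] by (simp add: none_def card_cartesian_product cube_prob_def)
  have meanu: "cube_mean n (?u t) = \<pi>" if "t \<in> I" for t
    using prob_uniq[OF that] by (simp add: cube_prob_def)
  have pointwise: "of_bool (H x \<noteq> L x)
      = ?N x * ?l x + (\<Sum>t\<in>I. ?u t x * ?ne (fst t) x) + (1 - ?N x - (\<Sum>t\<in>I. ?u t x)) * (1 - ?l x)" for x
  proof -
    consider (a) "none x" | (b) t where "t \<in> I" "uniq t x" | (c) "\<not> none x" "\<And>t. t \<in> I \<Longrightarrow> \<not> uniq t x"
      by blast
    then show ?thesis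
    proof cases
      case a
      then have "\<not> uniq t x" if "t \<in> I" for t
        using that by (auto simp: none_def uniq_def)
      then have "(\<Sum>t\<in>I. ?u t x * ?ne (fst t) x) = 0" "(\<Sum>t\<in>I. ?u t x) = 0"
        by (intro sum.neutral; simp)+
      then show ?thesis
        using a H_none[OF a] by simp
    next
      case b
      then have "\<not> none x"
        by (auto simp: none_def uniq_def)
      have u: "uniq t' x \<longleftrightarrow> t' = t" if "t' \<in> I" for t'
        using b that unfolding uniq_def by blast
      have "(\<Sum>t'\<in>I. ?u t' x * ?ne (fst t') x) = (\<Sum>t'\<in>I. if t' = t then ?ne (fst t) x else 0)"
        using u by (intro sum.cong) auto
      moreover have "(\<Sum>t'\<in>I. ?u t' x) = (\<Sum>t'\<in>I. if t' = t then 1 else 0)"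
        using u by (intro sum.cong) auto
      ultimately show ?thesis
        using b(1) \<open>\<not> none x\<close> H_uniq[OF b] by (simp del: mem_Sigma_iff)
    next
      case c
      then have "(\<Sum>t\<in>I. ?u t x * ?ne (fst t) x) = 0" "(\<Sum>t\<in>I. ?u t x) = 0"
        by (intro sum.neutral; simp)+
      then show ?thesis
        using c(1) H_many[OF c] by simp
    qed
  qed
  have m1: "cube_mean n (\<lambda>x. ?N x * ?l x) = ?p0 * cube_mean n ?l"
    unfolding indep[OF depends_only_comp[OF dep_none] depends_only_comp[OF L]] meanN ..
  have m2: "cube_mean n (\<lambda>x. ?u t x * ?ne (fst t) x) = \<pi> * cube_mean n (?ne (fst t))" if "t \<in> I" for t
  proof -
    have "fst t < B" using that by auto
    from indep[OF depends_only_comp[OF dep_uniq[OF that]] dep_ne[OF this], of of_bool]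
    show ?thesis
      unfolding meanu[OF that] .
  qed
  have m3: "cube_mean n (\<lambda>x. (1 - ?N x - (\<Sum>t\<in>I. ?u t x)) * (1 - ?l x))
      = (1 - ?p0 - B * R * \<pi>) * (1 - cube_mean n ?l)"
  proof -
    have "depends_only XX (\<lambda>x. 1 - ?N x - (\<Sum>t\<in>I. ?u t x))"
    proof (rule depends_onlyI)
      fix x y :: "nat \<Rightarrow> bool"
      assume xy: "\<And>j. j \<in> XX \<Longrightarrow> x j = y j"
      have "none x = none y"
        by (rule depends_onlyD[OF dep_none xy])
      moreover have "uniq t x = uniq t y" if "t \<in> I" for t
        by (rule depends_onlyD[OF dep_uniq[OF that] xy])
      ultimately show "1 - ?N x - (\<Sum>t\<in>I. ?u t x) = 1 - ?N y - (\<Sum>t\<in>I. ?u t y)"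
        by (simp cong: sum.cong)
    qed
    moreover have "depends_only (- XX) (\<lambda>x. 1 - ?l x)"
      by (rule depends_only_comp[OF L, of "\<lambda>v. 1 - of_bool v"])
    ultimately have "cube_mean n (\<lambda>x. (1 - ?N x - (\<Sum>t\<in>I. ?u t x)) * (1 - ?l x))
        = cube_mean n (\<lambda>x. 1 - ?N x - (\<Sum>t\<in>I. ?u t x)) * cube_mean n (\<lambda>x. 1 - ?l x)"
      by (rule indep)
    also have "cube_mean n (\<lambda>x. 1 - ?N x - (\<Sum>t\<in>I. ?u t x)) = 1 - ?p0 - (\<Sum>t\<in>I. \<pi>)"
      unfolding cube_mean_diff cube_mean_const cube_mean_sum meanN
      by (simp only: meanu cong: sum.cong)
    also have "(\<Sum>t\<in>I. \<pi>) = B * R * \<pi>"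
      by (simp add: card_cartesian_product)
    finally show ?thesis
      by (simp only: cube_mean_diff cube_mean_const)
  qed
  have sum_ne: "B / 2 - sqrt B / 2 \<le> (\<Sum>b<B. cube_mean n (?ne b))"
  proof -
    have ne: "?ne b x = 1 / 2 - 1 / 2 * (pm (L x) * pm (maj b x))" for b x
      by (cases "L x"; cases "maj b x") (simp_all add: pm_def)
    have e: "(\<Sum>b<B. ?ne b x) = B / 2 - 1 / 2 * (pm (L x) * ?S x)" for x
      unfolding ne by (simp add: sum_subtractf sum_distrib_left[symmetric] sum_divide_distrib[symmetric])
    have "pm (L x) * ?S x \<le> \<bar>?S x\<bar>" for x
      by (auto simp: pm_def)
    then have "B / 2 - 1 / 2 * \<bar>?S x\<bar> \<le> (\<Sum>b<B. ?ne b x)" for x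
      unfolding e by (intro diff_left_mono mult_left_mono) auto
    then have "cube_mean n (\<lambda>x. B / 2 - 1 / 2 * \<bar>?S x\<bar>) \<le> cube_mean n (\<lambda>x. \<Sum>b<B. ?ne b x)"
      by (intro cube_mean_mono)
    then show ?thesis
      using mean_abs_sum_maj unfolding cube_mean_diff cube_mean_const cube_mean_cmult cube_mean_sum
      by linarith
  qed
  have "\<pi> \<ge> 0" by simp
  have q1: "q \<le> 1"
    by simp
  let ?m = "cube_mean n ?l"
  have m01: "0 \<le> ?m" "?m \<le> 1"
    using cube_prob_nonneg[of n L] cube_prob_le_1[of n L] by (simp_all add: cube_prob_def)
  have total: "cube_prob n (\<lambda>x. H x \<noteq> L x)
      = ?p0 * ?m + (\<Sum>t\<in>I. \<pi> * cube_mean n (?ne (fst t))) + (1 - ?p0 - B * R * \<pi>) * (1 - ?m)"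
    unfolding cube_prob_def pointwise cube_mean_add cube_mean_sum m1 m3
    by (simp only: m2 cong: sum.cong)
  have "(\<Sum>t\<in>I. \<pi> * cube_mean n (?ne (fst t))) = (\<Sum>b<B. \<Sum>c<R. \<pi> * cube_mean n (?ne b))"
    by (simp only: sum.cartesian_product split_def)
  also have "\<dots> = R * \<pi> * (\<Sum>b<B. cube_mean n (?ne b))"
    by (simp only: sum_constant card_lessThan sum_distrib_left mult.assoc)
  also have "\<dots> \<ge> R * \<pi> * (B / 2 - sqrt B / 2)"
    using sum_ne \<open>\<pi> \<ge> 0\<close> by (intro mult_left_mono mult_nonneg_nonneg) auto
  finally have blocks: "R * \<pi> * (B / 2 - sqrt B / 2) \<le> (\<Sum>t\<in>I. \<pi> * cube_mean n (?ne (fst t)))" .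
  have "?p0 * ?m + ?p0 * (1 - ?m) \<le> ?p0 * ?m + (1 - ?p0 - B * R * \<pi>) * (1 - ?m)"
    using p(1) m01 by (intro add_left_mono mult_right_mono) auto
  then have "?p0 + R * \<pi> * (B / 2 - sqrt B / 2) \<le> cube_prob n (\<lambda>x. H x \<noteq> L x)"
    unfolding total using blocks by (simp add: algebra_simps)
  moreover have "R * \<pi> * (B / 2 - sqrt B / 2) = B * R * \<pi> / 2 - R * \<pi> * (sqrt B / 2)"
  proof -
    have "r * p * (b / 2 - s / 2) = b * r * p / 2 - r * p * (s / 2)" for r p b s :: real
      by (simp add: algebra_simps)
    then show ?thesis
      unfolding of_nat_mult .
  qed
  ultimately have e1: "?p0 + (B * R * \<pi> / 2 - R * \<pi> * (sqrt B / 2)) \<le> cube_prob n (\<lambda>x. H x \<noteq> L x)"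
    by (simp only:)
  \<comment> \<open>By \<open>p(1)\<close> the probability \<open>B * R * \<pi>\<close> of exactly
    one satisfied tribe is at most 1.\<close>
  have e2: "R * \<pi> * (sqrt B / 2) \<le> 1 / (2 * sqrt B)"
  proof -
    have "0 \<le> ?p0" using q1 by simp
    then have "B * (R * \<pi>) \<le> 1"
      using p(1) unfolding of_nat_mult mult.assoc by linarith
    moreover have "sqrt B * (c * sqrt B) = B * c" for c :: real
    proof -
      have "sqrt B * (c * sqrt B) = (sqrt B * sqrt B) * c"
        by (simp only: ac_simps)
      then show ?thesis by simp
    qed
    ultimately have "sqrt B * (R * \<pi> * sqrt B) \<le> 1"
      by (simp only:)
    then show ?thesis
      using pos(1) by (simp add: field_simps)
  qed
  have "p0 + (x / 2 - y) \<le> P \<Longrightarrow> y \<le> z \<Longrightarrow> 1 - 2 * p0 - x \<le> \<eta> \<Longrightarrow> 1 / 2 - \<eta> / 2 - z \<le> P"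
    for p0 x y z P :: real by (simp add: field_simps)
  from this[OF e1 e2 p(2)]
  have H_err: "1 / 2 - \<eta> / 2 - 1 / (2 * sqrt B) \<le> cube_prob n (\<lambda>x. H x \<noteq> L x)" .
  \<comment> \<open>\<open>F\<close> and \<open>H\<close> can differ only if \<open>U\<close> is all
    1 or \<open>Z\<close> is all 0; each has probability \<open>1 / 2 ^ r\<close>.\<close>
  have "of_bool (H x \<noteq> L x) \<le> of_bool (F x \<noteq> L x) + of_bool (\<forall>i\<in>U. x i = True)
      + (of_bool (\<forall>i\<in>Z. x i = False) :: real)" for x
  proof -
    have "F x = H x" if "\<not> (\<forall>i\<in>U. x i = True)" "\<not> (\<forall>i\<in>Z. x i = False)"
      using that unfolding F_def gated_def by blast
    then show ?thesis
      by (cases "\<forall>i\<in>U. x i = True"; cases "\<forall>i\<in>Z. x i = False") simp_all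
  qed
  then have "cube_prob n (\<lambda>x. H x \<noteq> L x) \<le> cube_prob n (\<lambda>x. F x \<noteq> L x)
      + cube_prob n (\<lambda>x. \<forall>i\<in>U. x i = True) + cube_prob n (\<lambda>x. \<forall>i\<in>Z. x i = False)"
    unfolding cube_prob_def cube_mean_add[symmetric] by (intro cube_mean_mono)
  then show ?thesis
    using H_err unfolding cube_prob_all_eq[OF fin(1) U(1)] cube_prob_all_eq[OF fin(2) Z(1)] U(2) Z(2)
    by simp
qed

text \<open>Error at most \<open>\<epsilon>\<close> forces the random path to hit a tribe with
  probability nearly \<open>1 / 2 - \<epsilon>\<close>. By the energy argument this rarely happens
  within \<open>\<Lambda>\<close> queries, so the path is at least \<open>\<Lambda>\<close> long
  with constant probability, which takes a constant fraction of \<open>2 ^ \<Lambda>\<close>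
  leaves.\<close>

theorem greedy_size_ge:
  fixes T :: "unit dtree" and K :: real
  assumes T: "greedy n T (\<lambda>x. pm (F x))" "approximates n \<epsilon> (completion n T (\<lambda>x. pm (F x))) (\<lambda>x. pm (F x))"
    and gap: "\<And>f t. \<kappa> \<le> f \<Longrightarrow> f \<le> 2 * \<kappa> \<Longrightarrow> t \<le> f \<Longrightarrow> (real f - 2 * real t)\<^sup>2 < K \<Longrightarrow>
      2 * q < 1 / 4 * (R * \<pi>) * (real (f choose t) / 2 ^ f)"
    and K: "0 < K" and \<Lambda>: "2 * \<Lambda> \<le> B * (\<kappa> + 1)"
    and p: "(1 - q) ^ (B * R) \<le> 1 - (1 - q) ^ (B * R) - B * R * \<pi>"
      "1 - 2 * (1 - q) ^ (B * R) - B * R * \<pi> \<le> \<eta>"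
  shows "(1 / 2 - \<epsilon> - \<eta> / 2 - 1 / (2 * sqrt B) - 4 / 2 ^ r - (\<kappa> + 1) / K) * 2 ^ \<Lambda>
    \<le> real (dtree_size T)"
proof -
  let ?f = "\<lambda>x. pm (F x)"
  let ?T = "completion n T ?f"
  \<comment> \<open>A guess that follows the tree but answers with a fixed value as soon as a tribe
    is hit, so it does not depend on the tribes and differs from the tree only on hits.\<close>
  define L where "L x \<longleftrightarrow> (if hits XX T x then True else eval_dtree ?T x = 1)" for x
  have "depends_only (- XX) L"
  proof (rule depends_onlyI)
    fix x y :: "nat \<Rightarrow> bool"
    assume xy: "\<And>j. j \<in> - XX \<Longrightarrow> x j = y j"
    then show "L x = L y"
      using eval_outside[of XX x y ?T] unfolding L_def hits_completion by auto
  qed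
  from error_without_tribes[OF this p]
  have "1 / 2 - \<eta> / 2 - 1 / (2 * sqrt B) - 2 / 2 ^ r \<le> cube_prob n (\<lambda>x. F x \<noteq> L x)" .
  also have "\<dots> \<le> cube_prob n (\<lambda>x. eval_dtree ?T x \<noteq> ?f x) + cube_prob n (hits XX T)"
    unfolding cube_prob_def cube_mean_add[symmetric]
    by (intro cube_mean_mono) (auto simp: L_def pm_def split: if_splits)
  also have "cube_prob n (hits XX T) = hit_prob XX T"
    by (rule cube_prob_hits[OF greedy_read_once[OF T(1)] greedy_vars[OF T(1)]])
  finally have hit: "1 / 2 - \<epsilon> - \<eta> / 2 - 1 / (2 * sqrt B) - 2 / 2 ^ r \<le> hit_prob XX T"
    using T(2) by (simp add: approximates_iff)
  have "Fr {} a = ?f" for a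
    by (simp add: Fr_def[abs_def] override_on_def)
  then have "hit_within XX T \<Lambda> \<le> (energy {} (\<lambda>_. True) + \<Lambda>) * (2 / (B * K))
      + prob_U {} (\<lambda>_. True) + prob_Z {} (\<lambda>_. True)"
    using T(1) by (intro hit_within_le[OF gap K \<Lambda>]) auto
  also have "prob_U {} (\<lambda>_. True) = 1 / 2 ^ r"
    using cube_prob_all_eq[OF fin(1) U(1), of True] U(2) by (simp add: prob_U_def override_on_def)
  also have "prob_Z {} (\<lambda>_. True) = 1 / 2 ^ r"
    using cube_prob_all_eq[OF fin(2) Z(1), of False] Z(2) by (simp add: prob_Z_def override_on_def)
  also have "energy {} (\<lambda>_. True) = 0"
    by (simp add: energy_def bias_def)
  also have "(0 + real \<Lambda>) * (2 / (B * K)) \<le> (\<kappa> + 1) / K"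
  proof -
    have "real (2 * \<Lambda>) \<le> real (B * (\<kappa> + 1))"
      by (simp only: of_nat_le_iff \<Lambda>)
    then have "2 * real \<Lambda> \<le> B * (real \<kappa> + 1)"
      by (simp add: algebra_simps)
    then show ?thesis
      using K pos(1) by (simp add: field_simps)
  qed
  finally have "hit_within XX T \<Lambda> \<le> (\<kappa> + 1) / K + 2 / 2 ^ r"
    by simp
  moreover have "hit_prob XX T \<le> hit_within XX T \<Lambda> + real (dtree_size T) / 2 ^ \<Lambda>"
    using hit_prob_le[of XX T \<Lambda>] depth_prob_le[of T \<Lambda>] by linarith
  moreover have "4 / 2 ^ r = 2 / 2 ^ r + (2 / 2 ^ r :: real)"
    by simp
  ultimately have "1 / 2 - \<epsilon> - \<eta> / 2 - 1 / (2 * sqrt B) - 4 / 2 ^ r - (\<kappa> + 1) / K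
      \<le> real (dtree_size T) / 2 ^ \<Lambda>"
    using hit by linarith
  then show ?thesis
    by (simp add: pos_le_divide_eq)
qed

end

section \<open>Choice of the parameters\<close>

lemma central_binomial_square: "1 \<le> m \<Longrightarrow> 16 ^ m \<le> 4 * m * ((2 * m) choose m)\<^sup>2"
proof (induction m rule: nat_induct_at_least)
  case base
  then show ?case by (simp add: choose_two numeral_2_eq_2)
next
  case (Suc m)
  let ?C = "(2 * m) choose m" and ?D = "(2 * Suc m) choose Suc m"
  have D: "Suc m * ?D = 2 * (2 * m + 1) * ?C"
  proof -
    have e1: "(2 * m + 1) choose Suc m = (2 * m + 1) choose m"
      using binomial_symmetric[of m "2 * m + 1"] by simp
    have e2: "Suc m * ((2 * m + 1) choose Suc m) = (2 * m + 1) * ?C"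
      using Suc_times_binomial_eq[of "2 * m" m] by simp
    have "?D = ((2 * m + 1) choose m) + ((2 * m + 1) choose Suc m)"
      by simp
    then have "Suc m * ?D = (2 * m + 1) * ?C + (2 * m + 1) * ?C"
      by (simp only: e1[symmetric] distrib_left e2)
    then show ?thesis
      by (simp only: mult.assoc mult_2 distrib_right)
  qed
  have "(m + 1) * 16 ^ Suc m \<le> (m + 1) * (16 * (4 * m * ?C\<^sup>2))"
    using mult_le_mono2[OF Suc.IH, of "(m + 1) * 16"] by (simp only: power_Suc mult.assoc)
  also have "\<dots> = 16 * ?C\<^sup>2 * (4 * m * (m + 1))"
    by (simp only: ac_simps)
  \<comment> \<open>The induction rests on \<open>4 * m * (m + 1) <= (2 * m + 1)\<^sup>2\<close>;
    the bound is stated in squared form to stay in the natural numbers.\<close>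
  also have "\<dots> \<le> 16 * ?C\<^sup>2 * (2 * m + 1)\<^sup>2"
    by (intro mult_left_mono) (simp_all add: power2_eq_square algebra_simps)
  also have "\<dots> = 4 * (2 * (2 * m + 1) * ?C)\<^sup>2"
    by (simp only: power_mult_distrib) simp
  also have "\<dots> = (m + 1) * (4 * Suc m * ?D\<^sup>2)"
    unfolding D[symmetric] by (simp only: power2_eq_square Suc_eq_plus1 ac_simps)
  finally show ?case
    by (simp only: mult_le_cancel1)
qed

lemma central_binomial_ge: "1 \<le> m \<Longrightarrow> 2 ^ (2 * m) / (2 * sqrt m) \<le> real ((2 * m) choose m)"
proof -
  assume m: "1 \<le> m"
  have "real (16 ^ m) \<le> real (4 * m * ((2 * m) choose m)\<^sup>2)"
    using central_binomial_square[OF m] by (simp only: of_nat_le_iff)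
  moreover have "(16 :: real) ^ m = (2 ^ (2 * m))\<^sup>2"
  proof -
    have "(2 :: real) ^ (2 * m) = 4 ^ m"
      by (simp add: power_mult)
    then show ?thesis
      by (simp add: power2_eq_square power_mult_distrib[symmetric])
  qed
  ultimately have "(2 ^ (2 * m))\<^sup>2 \<le> (2 * sqrt m * real ((2 * m) choose m))\<^sup>2"
    by (simp add: power_mult_distrib)
  then have "2 ^ (2 * m) \<le> 2 * sqrt m * real ((2 * m) choose m)"
    by (rule power2_le_imp_le) simp
  then show ?thesis
    using m by (simp add: field_simps)
qed

text \<open>The ratios of consecutive coefficients are \<open>(m - j) / (m + j + 1)\<close>, and for
  \<open>j < J\<close> all of them are at least \<open>(m - J) / (m + J)\<close>.\<close>

lemma binomial_off_center:
  assumes "J \<le> m"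
  shows "real ((2 * m) choose m) * ((real m - J) / (m + J)) ^ J \<le> real ((2 * m) choose (m + J))"
proof (cases "m = 0")
  case False
  define \<rho> where "\<rho> = (real m - J) / (m + J)"
  have \<rho>: "0 \<le> \<rho>"
    using assms by (simp add: \<rho>_def)
  have "j \<le> J \<Longrightarrow> real ((2 * m) choose m) * \<rho> ^ j \<le> real ((2 * m) choose (m + j))" for j
  proof (induction j)
    case (Suc j)
    have "real ((2 * m) choose (m + Suc j)) * (m + Suc j) = real ((2 * m) choose (m + j)) * (real m - j)"
    proof -
      have "((2 * m) choose (m + Suc j)) * (m + Suc j) = ((2 * m) choose (m + j)) * (m - j)"
        using binomial_absorb_comp[of "2 * m" "m + j"] binomial_absorption[of "m + j" "2 * m"] Suc.prems assms
        by (simp add: mult.commute)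
      then have "real (((2 * m) choose (m + Suc j)) * (m + Suc j)) = real (((2 * m) choose (m + j)) * (m - j))"
        by (simp only:)
      then show ?thesis
        using Suc.prems assms by (simp add: of_nat_diff algebra_simps)
    qed
    then have "real ((2 * m) choose (m + Suc j)) = real ((2 * m) choose (m + j)) * ((real m - j) / (m + Suc j))"
      by (simp add: field_simps)
    moreover have "\<rho> \<le> (real m - j) / (m + Suc j)"
      unfolding \<rho>_def using Suc.prems assms by (intro frac_le) auto
    ultimately show ?case
      using Suc \<rho> mult_mono[of "real ((2 * m) choose m) * \<rho> ^ j" "real ((2 * m) choose (m + j))" \<rho>
          "(real m - j) / (m + Suc j)"]
      by (simp add: mult_ac)
  qed simp
  then show ?thesis
    unfolding \<rho>_def by blast
qed (use assms in simp)

lemma power_ratio_ge: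
  assumes "4 * J \<le> m" "0 < m"
  shows "exp (- 4 * (real J)\<^sup>2 / m) \<le> ((real m - J) / (m + J)) ^ J"
proof -
  \<comment> \<open>The ratio is at least \<open>1 - x\<close>, and
    \<open>1 - x >= exp (- 2 * x)\<close> holds for \<open>x <= 1 / 2\<close>, i.e. for
    \<open>4 * J <= m\<close>.\<close>
  define x where "x = 2 * real J / m"
  have x: "0 \<le> x" "x \<le> 1 / 2"
    using assms by (auto simp: x_def field_simps)
  have "- (2 * x) \<le> - x - 2 * x\<^sup>2"
    using mult_mono[of "2 * x" 1 x x] x by (simp add: power2_eq_square)
  also have "\<dots> \<le> ln (1 - x)"
    using x by (rule ln_one_minus_pos_lower_bound)
  finally have "exp (- (2 * x)) \<le> 1 - x"
    using x by (simp add: ln_ge_iff)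
  also have "1 - x \<le> (real m - J) / (m + J)"
    using assms by (simp add: x_def field_simps)
  finally have "exp (- (2 * x)) ^ J \<le> ((real m - J) / (m + J)) ^ J"
    by (intro power_mono) auto
  moreover have "exp (- (2 * x)) ^ J = exp (- 4 * (real J)\<^sup>2 / m)"
    by (simp add: exp_of_nat_mult[symmetric] x_def power2_eq_square)
  ultimately show ?thesis by simp
qed

text \<open>A deviation of order \<open>sqrt (\<theta> * \<kappa>)\<close> from the middle costs
  only a factor depending on \<open>\<theta>\<close>. In the application \<open>f\<close> counts the
  free voters of a block besides the one considered, and \<open>t\<close> the ones that they must
  supply.\<close>

lemma binomial_ge:
  fixes \<theta> :: real
  assumes \<theta>: "1 \<le> \<theta>" and \<kappa>: "400 * \<theta> \<le> \<kappa>" and f: "\<kappa> \<le> f" "f \<le> 2 * \<kappa>" and t: "t \<le> f"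
    and dev: "(real f - 2 * real t)\<^sup>2 < \<theta> * (real \<kappa> + 1)"
  shows "exp (- (24 * \<theta>)) / (4 * sqrt \<kappa>) \<le> real (f choose t) / 2 ^ f"
proof -
  define m where "m = f div 2"
  \<comment> \<open>By symmetry only the distance from the middle matters. Passing from
    \<open>f\<close> to the even number \<open>2 * m\<close> loses at most a factor 2.\<close>
  define J where "J = max t (f - t) - m"
  have tm: "max t (f - t) = m + J"
    unfolding J_def m_def using t by linarith
  have sym: "f choose t = f choose (m + J)"
    using binomial_symmetric[OF t] tm[symmetric] by (auto simp: max_def)
  have "2 * real J \<le> \<bar>real f - 2 * real t\<bar> + 1"
    using tm t unfolding m_def by (auto simp: max_def split: if_splits)
  then have "(2 * real J)\<^sup>2 \<le> (\<bar>real f - 2 * real t\<bar> + 1)\<^sup>2"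
    by (intro power_mono) auto
  also have "\<dots> \<le> 2 * (real f - 2 * real t)\<^sup>2 + 2"
  proof -
    have "0 \<le> (\<bar>real f - 2 * real t\<bar> - 1)\<^sup>2" by simp
    then show ?thesis
      by (simp add: power2_eq_square algebra_simps abs_mult_self_eq)
  qed
  finally have J: "4 * (real J)\<^sup>2 \<le> 2 * (\<theta> * (real \<kappa> + 1)) + 2"
    using dev by (simp add: power_mult_distrib)
  have \<kappa>400: "400 \<le> real \<kappa>"
    using \<theta> \<kappa> by linarith
  have m: "real \<kappa> / 4 \<le> real m" "m \<le> \<kappa>" "0 < m"
    using f \<kappa>400 unfolding m_def by linarith+
  have "2 * (\<theta> * (real \<kappa> + 1)) + 2 \<le> 6 * \<theta> * real \<kappa>"
  proof -
    have "2 \<le> 2 * \<theta> * real \<kappa>" "\<theta> \<le> \<theta> * real \<kappa>"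
      using \<theta> \<kappa>400 mult_mono[of 1 \<theta> 1 "real \<kappa>"] mult_left_mono[of 1 "real \<kappa>" \<theta>] by simp_all
    then show ?thesis by (simp add: algebra_simps)
  qed
  moreover have "6 * \<theta> * real \<kappa> \<le> 24 * \<theta> * m"
    using \<theta> m(1) mult_left_mono[of "real \<kappa>" "4 * real m" "6 * \<theta>"] by simp
  ultimately have J2: "4 * (real J)\<^sup>2 \<le> 24 * \<theta> * m"
    using J by linarith
  \<comment> \<open>It suffices that \<open>96 * \<theta> <= m\<close>; as \<open>m\<close> is at
    least \<open>\<kappa> / 4\<close>, this is the origin of the constant 400.\<close>
  have "4 * J \<le> m"
  proof -
    have "96 * \<theta> \<le> m"
      using m(1) \<kappa> \<theta> by linarith
    then have "96 * \<theta> * m \<le> m * real m"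
      by (intro mult_right_mono) auto
    then have "(4 * real J)\<^sup>2 \<le> (real m)\<^sup>2"
      using J2 by (simp add: power2_eq_square)
    then have "4 * real J \<le> real m"
      by (rule power2_le_imp_le) simp
    then show ?thesis by linarith
  qed
  have "exp (- (24 * \<theta>)) \<le> exp (- 4 * (real J)\<^sup>2 / m)"
    using J2 m(3) by (simp add: field_simps)
  also have "\<dots> \<le> ((real m - J) / (m + J)) ^ J"
    by (rule power_ratio_ge[OF \<open>4 * J \<le> m\<close> m(3)])
  finally have ratio: "exp (- (24 * \<theta>)) \<le> ((real m - J) / (m + J)) ^ J" .
  have "2 ^ f / (4 * sqrt \<kappa>) \<le> 2 * 2 ^ (2 * m) / (4 * sqrt m)"
  proof (rule frac_le)
    have "f \<le> Suc (2 * m)" unfolding m_def by linarith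
    then show "(2::real) ^ f \<le> 2 * 2 ^ (2 * m)"
      using power_increasing[of f "Suc (2 * m)" "2 :: real"] by simp
  qed (use m in auto)
  also have "\<dots> = 2 ^ (2 * m) / (2 * sqrt m)" by simp
  also have "\<dots> \<le> real ((2 * m) choose m)"
    using central_binomial_ge m(3) by simp
  finally have "2 ^ f / (4 * sqrt \<kappa>) * exp (- (24 * \<theta>))
      \<le> real ((2 * m) choose m) * ((real m - J) / (m + J)) ^ J"
    using ratio by (intro mult_mono) auto
  also have "\<dots> \<le> real ((2 * m) choose (m + J))"
    using \<open>4 * J \<le> m\<close> by (intro binomial_off_center) simp
  also have "\<dots> \<le> real (f choose (m + J))"
  proof -
    have "2 * m \<le> f" unfolding m_def by simp
    then show ?thesis
      by (intro of_nat_mono binomial_right_mono) 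
  qed
  finally show ?thesis
    unfolding sym by (simp add: field_simps)
qed

text \<open>The number of tribes is chosen such that no tribe and at least two tribes are satisfied with
  almost the same probability.\<close>

context
  fixes q :: real
  assumes q: "0 < q" "q < 1"
begin

definition prob0 :: "nat \<Rightarrow> real" where "prob0 N = (1 - q) ^ N"
definition prob1 :: "nat \<Rightarrow> real" where "prob1 N = N * (q * (1 - q) ^ (N - 1))"
text \<open>Probability of at least two satisfied tribes minus that of none, among \<open>N\<close>
  tribes.\<close>

definition balance :: "nat \<Rightarrow> real" where "balance N = 1 - 2 * prob0 N - prob1 N"

lemma prob0_nonneg: "0 \<le> prob0 N" and prob1_nonneg: "0 \<le> prob1 N"
  using q by (simp_all add: prob0_def prob1_def)

lemma prob_Suc: "prob0 (Suc N) = (1 - q) * prob0 N" "prob1 (Suc N) = (1 - q) * prob1 N + q * prob0 N"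
proof -
  show "prob0 (Suc N) = (1 - q) * prob0 N"
    by (simp add: prob0_def)
  show "prob1 (Suc N) = (1 - q) * prob1 N + q * prob0 N"
    by (cases N) (simp_all add: prob0_def prob1_def algebra_simps)
qed

lemma prob01_le_1: "prob0 N + prob1 N \<le> 1"
proof (induction N)
  case (Suc N)
  have "prob0 (Suc N) + prob1 (Suc N) = prob0 N + prob1 N - q * prob1 N"
    by (simp add: prob_Suc algebra_simps)
  then show ?case
    using Suc q prob1_nonneg[of N] by (smt (verit) mult_nonneg_nonneg)
qed (simp add: prob0_def prob1_def)

text \<open>A further tribe raises the balance by at most \<open>q\<close>, so the first sign change
  is overshot only slightly.\<close>

lemma balance_add: "balance (N + k) \<le> balance N + k * q"
proof (induction k)
  case (Suc k)
  have "balance (N + Suc k) = balance (N + k) + q * (prob0 (N + k) + prob1 (N + k))"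
    by (simp add: balance_def prob_Suc algebra_simps)
  also have "\<dots> \<le> balance (N + k) + q * 1"
    using q prob01_le_1 by (intro add_left_mono mult_left_mono) auto
  finally show ?case
    using Suc by (simp add: algebra_simps)
qed simp

lemma balance_nonneg_large: assumes "4 \<le> N * q" shows "0 \<le> balance N"
proof -
  have N: "0 < N" using assms by (cases N) auto
  have "prob0 N \<le> exp (- q) ^ N"
    unfolding prob0_def using q exp_ge_add_one_self[of "- q"] by (intro power_mono) auto
  also have "\<dots> = exp (- (N * q))"
    by (simp add: exp_of_nat_mult[symmetric])
  finally have p0: "prob0 N \<le> exp (- (N * q))" .
  have "prob1 N \<le> N * q * exp (- (N * q)) * 3"
  proof -
    have "prob1 N \<le> N * (q * exp (- q) ^ (N - 1))"
      unfolding prob1_def using q exp_ge_add_one_self[of "- q"]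
      by (intro mult_left_mono power_mono) auto
    also have "exp (- q) ^ (N - 1) = exp (- (N * q)) * exp q"
      using N by (simp add: exp_of_nat_mult[symmetric] of_nat_diff exp_add[symmetric] algebra_simps)
    also have "N * (q * (exp (- (N * q)) * exp q)) \<le> N * (q * (exp (- (N * q)) * 3))"
    proof -
      have "exp q \<le> exp 1" using q by simp
      then have "exp q \<le> 3" using exp_le by linarith
      then show ?thesis
        using q by (intro mult_left_mono) auto
    qed
    finally show ?thesis by (simp add: mult_ac)
  qed
  then have "2 * prob0 N + prob1 N \<le> (2 + 3 * (N * q)) * exp (- (N * q))"
    using p0 by (simp add: algebra_simps)
  also have "\<dots> \<le> 1"
  proof -
    \<comment> \<open>The claim is \<open>2 + 3 * y <= exp y\<close> for \<open>y >= 4\<close>. The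
      quadratic Taylor bound yields \<open>exp (y / 2) >= 1 + y\<close>, and squaring
      suffices.\<close>
    define y where "y = N * q"
    have y: "4 \<le> y" using assms by (simp add: y_def)
    have "1 + y / 2 + (y / 2)\<^sup>2 / 2 \<le> exp (y / 2)"
      using y by (intro exp_lower_Taylor_quadratic) simp
    then have "(1 + y / 2 + (y / 2)\<^sup>2 / 2)\<^sup>2 \<le> exp (y / 2) ^ 2"
      using y by (intro power_mono) auto
    also have "\<dots> = exp y"
      by (simp add: exp_of_nat_mult[symmetric])
    finally have e: "(1 + y / 2 + (y / 2)\<^sup>2 / 2)\<^sup>2 \<le> exp y" .
    have yy: "4 * y \<le> y * y"
      using y by (intro mult_right_mono) auto
    then have "1 + y / 2 + (y / 2)\<^sup>2 / 2 \<ge> 1 + y"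
      using y by (simp add: power2_eq_square field_simps)
    then have "(1 + y)\<^sup>2 \<le> (1 + y / 2 + (y / 2)\<^sup>2 / 2)\<^sup>2"
      using y by (intro power_mono) auto
    moreover have "2 + 3 * y \<le> (1 + y)\<^sup>2"
    proof -
      have "(1 + y)\<^sup>2 = 1 + 2 * y + y * y"
        by (simp add: power2_eq_square algebra_simps)
      then show ?thesis
        using y yy by linarith
    qed
    ultimately have "2 + 3 * y \<le> exp y"
      using e by linarith
    then show ?thesis
      by (simp add: y_def exp_minus field_simps)
  qed
  finally show ?thesis
    by (simp add: balance_def)
qed

text \<open>\<open>R\<close> is the least number of tribes per block with nonnegative balance. One
  step of \<open>R\<close> adds \<open>B\<close> tribes, hence the overshoot
  \<open>B * q\<close>.\<close>

lemma ex_balanced: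
  fixes B M :: nat
  assumes B: "0 < B" "B * q \<le> 1 / 2" and M: "4 \<le> real (B * M) * q"
  shows "\<exists>R\<le>M. 0 \<le> balance (B * R) \<and> balance (B * R) \<le> B * q \<and> 1 / 10 \<le> prob1 (B * R)"
proof -
  define R where "R = (LEAST R. 0 \<le> balance (B * R))"
  have "0 \<le> balance (B * M)"
    using M by (intro balance_nonneg_large) simp
  then have R: "0 \<le> balance (B * R)" "R \<le> M"
    unfolding R_def by (rule LeastI, rule Least_le)
  have "R \<noteq> 0"
    using R(1) by (auto simp: balance_def prob0_def prob1_def intro!: Nat.gr0I)
  then obtain R' where R': "R = Suc R'"
    by (cases R) auto
  have "\<not> 0 \<le> balance (B * R')"
    using not_less_Least[of R' "\<lambda>R. 0 \<le> balance (B * R)"] R' by (simp add: R_def)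
  then have small: "balance (B * R) \<le> B * q"
    using balance_add[of "B * R'" B] R' by (simp add: algebra_simps)
  let ?N = "B * R"
  have "2 * prob0 ?N \<le> 1"
    using R(1) prob1_nonneg[of ?N] by (simp add: balance_def)
  moreover have "1 - ?N * q \<le> prob0 ?N"
    using Bernoulli_inequality[of "- q" ?N] q by (simp add: prob0_def)
  ultimately have "1 / 2 \<le> ?N * q" by linarith
  moreover have "?N * q * prob0 ?N \<le> prob1 ?N"
  proof -
    have "(1 - q) ^ ?N \<le> (1 - q) ^ (?N - 1)"
      using q by (intro power_decreasing) auto
    then have "?N * q * (1 - q) ^ ?N \<le> ?N * q * (1 - q) ^ (?N - 1)"
      using q by (intro mult_left_mono) auto
    then show ?thesis
      by (simp add: prob0_def prob1_def mult.assoc)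
  qed
  ultimately have "1 / 2 * prob0 ?N \<le> prob1 ?N"
    using mult_right_mono[OF _ prob0_nonneg[of ?N]] by (meson order_trans)
  \<comment> \<open>Combine \<open>2 * prob0 + prob1 >= 1 / 2\<close>, from the small balance, with
    \<open>prob0 <= 2 * prob1\<close>.\<close>
  then have "1 / 10 \<le> prob1 ?N"
    using small B(2) by (simp add: balance_def)
  then show ?thesis
    using R small by blast
qed

end

section \<open>Assembling the hard function\<close>

lemma ex_disjoint_sets:
  assumes "finite I" "finite A" "(\<Sum>i\<in>I. c i) \<le> card A"
  shows "\<exists>S. (\<forall>i\<in>I. S i \<subseteq> A \<and> card (S i) = c i) \<and> disjoint_family_on S I"
  using assms
proof (induction I arbitrary: A rule: finite_induct)
  case empty
  then show ?case by (simp add: disjoint_family_on_def)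
next
  case (insert i I)
  then have "c i \<le> card A" by simp
  then obtain Si where Si: "Si \<subseteq> A" "card Si = c i"
    by (meson obtain_subset_with_card_n)
  have "(\<Sum>i\<in>I. c i) \<le> card (A - Si)"
    using insert Si by (simp add: card_Diff_subset finite_subset)
  then obtain S where S: "\<forall>i\<in>I. S i \<subseteq> A - Si \<and> card (S i) = c i" "disjoint_family_on S I"
    using insert.IH[of "A - Si"] insert.prems by blast
  have "disjoint_family_on (S(i := Si)) (insert i I)"
    using S insert.hyps unfolding disjoint_family_on_def by (auto; blast)
  moreover have "\<forall>j\<in>insert i I. (S(i := Si)) j \<subseteq> A \<and> card ((S(i := Si)) j) = c j"
    using S(1) Si insert.hyps by auto
  ultimately show ?case by blast
qed

lemma ex_dtree_override:
  assumes "finite S" "\<And>a. \<exists>T. eval_dtree T = (\<lambda>x. F (override_on x a S)) \<and> dtree_size T \<le> m"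
  shows "\<exists>T. eval_dtree T = F \<and> dtree_size T \<le> 2 ^ card S * m"
  using assms
proof (induction S arbitrary: F rule: finite_induct)
  case empty
  then show ?case by simp
next
  case (insert i S)
  have "\<exists>T. eval_dtree T = (\<lambda>x. F (x(i := b))) \<and> dtree_size T \<le> 2 ^ card S * m" for b
  proof (rule insert.IH)
    fix a
    have eq: "override_on x (a(i := b)) (insert i S) = (override_on x a S)(i := b)" for x
      using insert.hyps by (auto simp: override_on_def fun_eq_iff)
    show "\<exists>T. eval_dtree T = (\<lambda>x. F ((override_on x a S)(i := b))) \<and> dtree_size T \<le> m"
      using insert.prems[of "a(i := b)"] unfolding eq .
  qed
  then obtain T where T: "eval_dtree (T b) = (\<lambda>x. F (x(i := b)))" "dtree_size (T b) \<le> 2 ^ card S * m"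
    for b by metis
  have "eval_dtree (Query i (T False) (T True)) x = F x" for x
    using fun_upd_triv[of x i] by (cases "x i") (simp_all add: T del: fun_upd_apply fun_upd_triv)
  then show ?case
    using T(2)[of True] T(2)[of False] insert.hyps
    by (intro exI[of _ "Query i (T False) (T True)"]) auto
qed

text \<open>Query all tribes completely; afterwards \<open>H\<close> is constant or the vote of a
  single block.\<close>

lemma (in tribes_blocks) dt_size_H: "dt_size H \<le> 2 ^ (w * (B * R)) * 2 ^ (2 * \<kappa> + 1)"
proof -
  have "\<exists>T. eval_dtree T = (\<lambda>x. H (override_on x a XX)) \<and> dtree_size T \<le> 2 ^ (2 * \<kappa> + 1)" for a
  proof -
    have eq: "sat t (override_on x a XX) = sat t a" if "t \<in> I" for t x
      by (rule depends_onlyD[OF dep_sat]) (use that in \<open>auto simp: override_on_def\<close>)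
    have leaf: ?thesis if "\<And>x. H (override_on x a XX) = v" for v
      using that by (intro exI[of _ "Leaf v"]) (simp add: fun_eq_iff)
    consider (a) "none a" | (b) t where "t \<in> I" "uniq t a" | (c) "\<not> none a" "\<And>t. t \<in> I \<Longrightarrow> \<not> uniq t a"
      by blast
    then show ?thesis
    proof cases
      case a
      then have "none (override_on x a XX)" for x
        using eq by (simp only: none_def cong: ball_cong) simp
      then show ?thesis
        using H_none leaf[of False] by blast
    next
      case b
      have fst: "fst t < B" using b(1) by auto
      have u: "uniq t (override_on x a XX)" for x
        using depends_onlyD[OF dep_uniq[OF b(1)], of "override_on x a XX" a] b(2)
        by (simp add: override_on_def)
      have "H (override_on x a XX) = maj (fst t) x" for x
      proof -
        have "maj (fst t) (override_on x a XX) = maj (fst t) x"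
          by (rule depends_onlyD[OF dep_maj]) (use fst XY in \<open>auto simp: override_on_def\<close>)
        then show ?thesis
          using H_uniq[OF b(1) u] by simp
      qed
      then have "depends_only (Y (fst t)) (\<lambda>x. H (override_on x a XX))"
        using dep_maj by simp
      from ex_dtree[OF fin_Y[OF fst] this] show ?thesis
        using Y[OF fst] by simp
    next
      case c
      have "none (override_on x a XX) = none a" for x
        by (rule depends_onlyD[OF dep_none]) (simp add: override_on_def)
      moreover have "uniq t (override_on x a XX) = uniq t a" if "t \<in> I" for t x
        by (rule depends_onlyD[OF dep_uniq[OF that]]) (simp add: override_on_def)
      ultimately have "H (override_on x a XX)" for x
        using c by (intro H_many) auto
      then show ?thesis
        using leaf[of True] by simp
    qed
  qed
  from ex_dtree_override[OF fin(4) this]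
  obtain T where T: "eval_dtree T = H" "dtree_size T \<le> 2 ^ card XX * 2 ^ (2 * \<kappa> + 1)"
    by blast
  have "card XX = (\<Sum>t\<in>I. card (X t))"
    using fin_X X_disj by (intro card_UN_disjoint) (auto simp: disjoint_family_on_def)
  also have "\<dots> = (\<Sum>t\<in>I. w)"
    using X by (intro sum.cong) auto
  finally have "card XX = w * (B * R)"
    by (simp add: card_cartesian_product)
  then show ?thesis
    using dt_size_le[OF T(1)] T(2) by simp
qed

lemma pm_range: "pm b \<in> {-1, 1}"
  by (simp add: pm_def)

lemma monotone_pm: "mono F \<Longrightarrow> monotone_pm_function n (\<lambda>x. pm (F x))"
  unfolding monotone_pm_function_def
  by (auto simp: pm_def mono_def mono_on_def le_bool_def)

text \<open>The first hypothesis reserves variables for tribes, blocks, gates and \<open>g\<close>,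
  in this order. The lower bound on \<open>s\<close> is twice the estimate of the gate cost from
  \<open>least_path_cost_bound\<close>, plus 2. The exponent is half of
  \<open>B * (\<kappa> + 1)\<close>, the number of queries that the energy argument can
  handle.\<close>

theorem hard_function:
  fixes \<epsilon> :: real
  assumes \<epsilon>: "0 < \<epsilon>" "\<epsilon> < 1 / 2"
  shows "\<exists>w0 r. 0 < r \<and> (\<forall>w\<ge>w0. \<forall>n k s.
    4 * w * 2 ^ w + 2 ^ (w div 4) * (2 * 2 ^ w + 1) + 2 * r + 3 * k \<le> n \<longrightarrow> s \<le> 2 ^ k \<longrightarrow>
    2 * (r + r * (r * 2 ^ (4 * w * 2 ^ w + 2 * 2 ^ w + 1) + 1)) + 2 \<le> s \<longrightarrow>
    (\<exists>f. monotone_pm_function n f \<and> optimal_dt_size n f = s \<and>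
      (1 / 2 - \<epsilon>) / 2 * 2 ^ (2 ^ (w div 4) div 2 * (2 ^ w + 1)) \<le> real (top_down_dt_size n f \<epsilon>)))"
proof -
  define \<delta> where "\<delta> = 1 / 2 - \<epsilon>"
  have \<delta>: "0 < \<delta>" "\<delta> \<le> 1 / 2"
    using \<epsilon> by (simp_all add: \<delta>_def)
  \<comment> \<open>With \<open>K = \<theta> * (\<kappa> + 1)\<close> the probability of a premature
    hit becomes \<open>(\<kappa> + 1) / K = \<delta> / 16\<close>.\<close>
  define \<theta> where "\<theta> = 16 / \<delta>"
  have \<theta>: "1 \<le> \<theta>"
    using \<delta> by (simp add: \<theta>_def field_simps)
  obtain r0 :: nat where r0: "(1 / 2 :: real) ^ r0 < \<delta> / 64"
    using real_arch_pow_inv[of "\<delta> / 64" "1 / 2"] \<delta> by auto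
  define r where "r = Suc r0"
  have r: "0 < r" "4 / 2 ^ r \<le> \<delta> / 16"
    using r0 by (simp_all add: r_def power_one_over field_simps)
  \<comment> \<open>\<open>B > c\<close> serves three purposes: the influence gap, a loss
    \<open>1 / (2 * sqrt B)\<close> of at most \<open>\<delta> / 16\<close>, and the hypothesis
    \<open>400 * \<theta> <= \<kappa>\<close> of \<open>binomial_ge\<close>.\<close>
  define c where "c = 320 * exp (24 * \<theta>) + (8 / \<delta>)\<^sup>2 + 400 * \<theta>"
  obtain v0 :: nat where v0: "c < 2 ^ v0"
    using real_arch_pow[of 2 c] by auto
  define w0 where "w0 = 4 * v0 + 4"
  show ?thesis
  proof (rule exI[of _ w0], rule exI[of _ r], intro conjI allI impI r(1))
    fix w n k s :: nat
    assume w: "w0 \<le> w"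
      and n: "4 * w * 2 ^ w + 2 ^ (w div 4) * (2 * 2 ^ w + 1) + 2 * r + 3 * k \<le> n"
      and s: "s \<le> 2 ^ k" "2 * (r + r * (r * 2 ^ (4 * w * 2 ^ w + 2 * 2 ^ w + 1) + 1)) + 2 \<le> s"
    define v where "v = w div 4"
    \<comment> \<open>Then \<open>B\<^sup>2 <= sqrt \<kappa>\<close>: one factor \<open>B\<close>
      pays for spreading the tribes over \<open>B\<close> blocks, the other for the constants in the
      influence gap.\<close>
    define B :: nat where "B = 2 ^ v"
    define \<kappa> :: nat where "\<kappa> = 2 ^ w"
    define q :: real where "q = 1 / 2 ^ w"
    have v: "v0 < v" "4 * v \<le> w" "v < w"
      using w by (auto simp: v_def w0_def)
    have "(2::real) ^ v0 \<le> 2 ^ v"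
      using v by (intro power_increasing) auto
    from order_less_le_trans[OF v0 this] have Bc: "c < B"
      by (simp add: B_def)
    have B_parts: "320 * exp (24 * \<theta>) < B" "(8 / \<delta>)\<^sup>2 \<le> B" "400 * \<theta> \<le> B" "0 < B"
    proof -
      have "0 \<le> exp (24 * \<theta>)" "0 \<le> (8 / \<delta>)\<^sup>2" "0 \<le> \<theta>"
        using \<theta> by auto
      then show "320 * exp (24 * \<theta>) < B" "(8 / \<delta>)\<^sup>2 \<le> B" "400 * \<theta> \<le> B"
        using Bc \<theta> unfolding c_def by linarith+
      show "0 < B" by (simp add: B_def)
    qed
    have q: "0 < q" "q < 1"
      using v by (auto simp: q_def)
    have B4: "real B ^ 4 \<le> \<kappa>"
    proof -
      have "real B ^ 4 = 2 ^ (4 * v)"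
        by (simp add: B_def power_mult[symmetric] mult.commute)
      also have "\<dots> \<le> 2 ^ w"
        using v by (intro power_increasing) auto
      finally show ?thesis by (simp add: \<kappa>_def)
    qed
    have B2: "(real B)\<^sup>2 \<le> sqrt \<kappa>"
      by (rule real_le_rsqrt) (use B4 in \<open>simp add: power_mult[symmetric]\<close>)
    have B1: "1 \<le> real B"
      using B_parts(4) by simp
    have \<kappa>q: "\<kappa> * q = 1"
      by (simp add: \<kappa>_def q_def)
    have Bq: "B * q \<le> 1 / B"
    proof -
      have "real B * real B \<le> real B ^ 4"
        using B1 power_increasing[of 2 4 "real B"] by (simp add: power2_eq_square)
      from order_trans[OF this B4] have "real B * real B * q \<le> \<kappa> * q"
        using q by (intro mult_right_mono) auto
      then show ?thesis
        using \<kappa>q B1 by (simp add: field_simps)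
    qed
    have sqrtB: "8 / \<delta> \<le> sqrt B"
      by (rule real_le_rsqrt[OF B_parts(2)])
    have sqrtB_le: "sqrt B \<le> B"
      using B1 real_sqrt_le_mono[of "real B" "real B * real B"] mult_left_mono[of 1 "real B" "real B"]
      by simp
    have inv_sqrtB: "1 / sqrt B \<le> \<delta> / 8"
      using sqrtB \<delta> B1 by (simp add: field_simps)
    moreover have "1 / B \<le> 1 / sqrt B"
      using sqrtB_le B1 by (intro divide_left_mono) auto
    ultimately have inv_B: "1 / B \<le> \<delta> / 8" by linarith
    have "B * q \<le> 1 / 2"
      using Bq inv_B \<delta> by linarith
    moreover have BM: "B * (4 * 2 ^ (w - v)) = 4 * 2 ^ w"
      using v by (simp add: B_def power_add[symmetric])
    moreover have "4 \<le> real (B * (4 * 2 ^ (w - v))) * q"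
      unfolding BM by (simp add: q_def)
    ultimately obtain R where R: "R \<le> 4 * 2 ^ (w - v)" "0 \<le> balance q (B * R)"
        "balance q (B * R) \<le> B * q" "1 / 10 \<le> prob1 q (B * R)"
      using ex_balanced[OF q B_parts(4), of "4 * 2 ^ (w - v)"] by blast
    have BR: "B * R \<le> 4 * 2 ^ w"
      using mult_le_mono2[OF R(1), of B] BM by simp
    have wBR: "w * (B * R) \<le> 4 * w * 2 ^ w"
      using mult_le_mono2[OF BR, of w] by (simp add: mult_ac)

    let ?c = "\<lambda>i::nat. [w * (B * R), B * (2 * \<kappa> + 1), r, r, 3 * k] ! i"
    have "{..<5} = {0, 1, 2, 3, 4 :: nat}" by auto
    then have "(\<Sum>i<5. ?c i) = w * (B * R) + B * (2 * \<kappa> + 1) + r + r + 3 * k"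
      by simp
    also have "\<dots> \<le> card {..<n}"
    proof -
      have "B * (2 * \<kappa> + 1) = 2 ^ (w div 4) * (2 * 2 ^ w + 1)"
        by (simp only: B_def v_def \<kappa>_def)
      then show ?thesis
        unfolding card_lessThan using n wBR by linarith
    qed
    finally obtain S where S: "\<forall>i<5. S i \<subseteq> {..<n} \<and> card (S i) = ?c i" "disjoint_family_on S {..<5}"
      using ex_disjoint_sets[of "{..<5}" "{..<n}" ?c] by auto
    define U where "U = S 2"
    define Z where "Z = S 3"
    define V where "V = S 4"
    have sub: "S 0 \<subseteq> {..<n}" "S 1 \<subseteq> {..<n}" "U \<subseteq> {..<n}" "Z \<subseteq> {..<n}" "V \<subseteq> {..<n}"
      and cards: "card (S 0) = w * (B * R)" "card (S 1) = B * (2 * \<kappa> + 1)" "card U = r" "card Z = r"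
        "card V = 3 * k"
      using S(1) by (auto simp: U_def Z_def V_def)
    have "S i \<inter> S j = {}" if "i < 5" "j < 5" "i \<noteq> j" for i j
      using S(2) that by (auto simp: disjoint_family_on_def)
    then have sep: "S 0 \<inter> S 1 = {}" "S 0 \<inter> (U \<union> Z \<union> V) = {}" "S 1 \<inter> (U \<union> Z \<union> V) = {}"
        "U \<inter> Z = {}" "U \<inter> V = {}" "Z \<inter> V = {}"
      unfolding U_def Z_def V_def Int_Un_distrib by simp_all
    have fin_S: "finite (S 0)" "finite (S 1)"
      using sub finite_subset by blast+
    obtain X where X: "\<forall>t\<in>{..<B} \<times> {..<R}. X t \<subseteq> S 0 \<and> card (X t) = w"
        "disjoint_family_on X ({..<B} \<times> {..<R})"
      using ex_disjoint_sets[OF _ fin_S(1), of "{..<B} \<times> {..<R}" "\<lambda>_. w"] cards(1)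
      by (auto simp: card_cartesian_product mult.commute)
    obtain Y where Y: "\<forall>b\<in>{..<B}. Y b \<subseteq> S 1 \<and> card (Y b) = 2 * \<kappa> + 1"
        "disjoint_family_on Y {..<B}"
      using ex_disjoint_sets[OF _ fin_S(2), of "{..<B}" "\<lambda>_. 2 * \<kappa> + 1"] cards(2)
      by (auto simp: mult.commute)
    have XX: "(\<Union>t\<in>{..<B} \<times> {..<R}. X t) \<subseteq> S 0" and YY: "(\<Union>b<B. Y b) \<subseteq> S 1"
      using X(1) Y(1) by blast+
    have loc: "tribes_blocks n w B R \<kappa> r X Y U Z V g" if "depends_only V g" for g
    proof
      show "X t \<subseteq> {..<n} \<and> card (X t) = w" if "t \<in> {..<B} \<times> {..<R}" for t
        using X(1) sub(1) that by blast
      show "Y b \<subseteq> {..<n} \<and> card (Y b) = 2 * \<kappa> + 1" if "b < B" for b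
        using Y(1) sub(2) that by blast
      show "(\<Union>t\<in>{..<B} \<times> {..<R}. X t) \<inter> (\<Union>b<B. Y b) = {}"
        "(\<Union>t\<in>{..<B} \<times> {..<R}. X t) \<inter> (U \<union> Z \<union> V) = {}"
        "(\<Union>b<B. Y b) \<inter> (U \<union> Z \<union> V) = {}"
        using XX YY sep by blast+
    qed (use B_parts r v X(2) Y(2) sub cards sep that in auto)
    define Hf where "Hf = tribes_blocks.H B R \<kappa> X Y"
    let ?W = "(\<Union>t\<in>{..<B} \<times> {..<R}. X t) \<union> (\<Union>b<B. Y b)"
    \<comment> \<open>\<open>H\<close> does not involve \<open>g\<close>, so the locale is entered
      with a dummy first: the real \<open>g\<close> can be chosen only when the gate cost
      \<open>C\<close> is known.\<close>
    interpret dummy: tribes_blocks n w B R \<kappa> r X Y U Z V "\<lambda>_. True"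
      by (rule loc) (simp add: depends_only_def)
    have finW: "finite ?W"
      using XX YY fin_S finite_subset by blast
    have depH: "depends_only ?W Hf"
      unfolding Hf_def by (rule dummy.dep_H)
    have sizeH: "dt_size Hf \<le> 2 ^ (4 * w * 2 ^ w + 2 * 2 ^ w + 1)"
    proof -
      have "dt_size Hf \<le> 2 ^ (w * (B * R)) * 2 ^ (2 * \<kappa> + 1)"
        unfolding Hf_def by (rule dummy.dt_size_H)
      also have "\<dots> = 2 ^ (w * (B * R) + (2 * \<kappa> + 1))"
        by (simp only: power_add)
      also have "\<dots> \<le> 2 ^ (4 * w * 2 ^ w + 2 * 2 ^ w + 1)"
        using wBR by (intro power_increasing) (simp_all add: \<kappa>_def)
      finally show ?thesis .
    qed
    have finUZV: "finite U" "finite Z" "finite V"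
      using sub finite_subset by blast+
    define C where "C = least_path_cost Hf U Z"
    have "C \<le> card Z + card U * (card Z * dt_size Hf + 1)"
      unfolding C_def by (rule least_path_cost_bound[OF finUZV(1,2) finW depH])
    also have "\<dots> \<le> r + r * (r * 2 ^ (4 * w * 2 ^ w + 2 * 2 ^ w + 1) + 1)"
      unfolding cards by (intro add_left_mono mult_le_mono2 add_right_mono sizeH)
    finally have "C \<le> r + r * (r * 2 ^ (4 * w * 2 ^ w + 2 * 2 ^ w + 1) + 1)" .
    \<comment> \<open>This leaves \<open>s - C >= C + 2\<close> for \<open>g\<close>: at least the
      gate cost, as \<open>dt_size_gated\<close> demands, and at least 2.\<close>
    from order_trans[OF add_right_mono[OF mult_le_mono2[OF this]] s(2)] have C: "2 * C + 2 \<le> s" .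
    have "2 \<le> s - C" "s - C \<le> 2 ^ k"
      using C s(1) by linarith+
    then obtain g where g: "depends_only V g" "monotone_nonconst g" "dt_size g = s - C"
      using ex_dt_size[of "s - C" k V] C s(1) finUZV(3) cards(5) by auto
    interpret tribes_blocks n w B R \<kappa> r X Y U Z V g
      by (rule loc[OF g(1)])
    interpret gate U Z V
      using finUZV sep by unfold_locales
    have "dt_size (gated U Z Hf g) = C + dt_size g"
      unfolding C_def
    proof (rule dt_size_gated[OF g(1) _ _ finW depH])
      show "\<exists>x. g x" "\<exists>x. \<not> g x"
        using g(2) by (auto simp: monotone_nonconst_def)
      have "A \<subseteq> B \<Longrightarrow> B \<inter> D = {} \<Longrightarrow> A \<inter> D = {}" for A B D :: "nat set"
        by blast
      from this[OF Un_mono[OF XX YY]] show "?W \<inter> (U \<union> Z \<union> V) = {}"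
        using sep(2,3) by (simp only: Int_Un_distrib2 Un_empty)
      show "least_path_cost Hf U Z \<le> dt_size g"
        using C g(3) by (simp add: C_def)
    qed
    moreover have "F = gated U Z Hf g"
      by (simp add: F_def Hf_def)
    ultimately have sizeF: "dt_size F = s"
      using g(3) C by simp
    let ?f = "\<lambda>x. pm (F x)"
    show "\<exists>f. monotone_pm_function n f \<and> optimal_dt_size n f = s \<and>
      (1 / 2 - \<epsilon>) / 2 * 2 ^ (2 ^ (w div 4) div 2 * (2 ^ w + 1)) \<le> real (top_down_dt_size n f \<epsilon>)"
    proof (intro exI[of _ ?f] conjI)
      show "monotone_pm_function n ?f"
        by (intro monotone_pm mono_F) (use g(2) in \<open>simp add: monotone_nonconst_def\<close>)
      show "optimal_dt_size n ?f = s"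
        using optimal_dt_size_pm[OF dep_F] sizeF by simp
      have K: "0 < \<theta> * (real \<kappa> + 1)"
        using \<theta> by simp
      have \<kappa>_pos: "0 < sqrt \<kappa>"
        by (simp add: \<kappa>_def)
      have gap: "2 * (1 / 2 ^ w) < 1 / 4 * (R * (1 / 2 ^ w * (1 - 1 / 2 ^ w) ^ (B * R - 1))) * (real (f choose t) / 2 ^ f)"
        if f: "\<kappa> \<le> f" "f \<le> 2 * \<kappa>" "t \<le> f" "(real f - 2 * real t)\<^sup>2 < \<theta> * (real \<kappa> + 1)" for f t
      proof -
        have "real B \<le> real B ^ 4"
          using B1 power_increasing[of 1 4 "real B"] by simp
        then have "400 * \<theta> \<le> \<kappa>"
          using B_parts(3) B4 by linarith
        from binomial_ge[OF \<theta> this f]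
        have binom: "exp (- (24 * \<theta>)) / (4 * sqrt \<kappa>) \<le> real (f choose t) / 2 ^ f" .
        have "1 / (10 * B) \<le> R * (1 / 2 ^ w * (1 - 1 / 2 ^ w) ^ (B * R - 1))"
        proof -
          have "1 / 10 \<le> real (B * R) * y \<Longrightarrow> 1 / (10 * B) \<le> R * y" for y :: real
            using B1 by (simp add: field_simps)
          then show ?thesis
            using R(4) unfolding prob1_def[OF q] unfolding q_def by blast
        qed
        then have "1 / 4 * (1 / (10 * B)) * (exp (- (24 * \<theta>)) / (4 * sqrt \<kappa>))
            \<le> 1 / 4 * (R * (1 / 2 ^ w * (1 - 1 / 2 ^ w) ^ (B * R - 1))) * (real (f choose t) / 2 ^ f)"
          using binom by (intro mult_mono) auto
        \<comment> \<open>The constant \<open>320 = 2 * 4 * 10 * 4\<close> collects the factors of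
          both sides; since \<open>1 / q = \<kappa>\<close>, it remains to show
          \<open>320 * exp (24 * \<theta>) * B < sqrt \<kappa>\<close>.\<close>
        moreover have "2 * q < 1 / 4 * (1 / (10 * B)) * (exp (- (24 * \<theta>)) / (4 * sqrt \<kappa>))"
        proof -
          have "320 * exp (24 * \<theta>) * B < real B * real B"
            using B_parts(1) B1 by (intro mult_strict_right_mono) auto
          also have "\<dots> \<le> sqrt \<kappa>"
            using B2 by (simp add: power2_eq_square)
          finally have "320 * exp (24 * \<theta>) * B * sqrt \<kappa> < sqrt \<kappa> * sqrt \<kappa>"
            using \<kappa>_pos by (intro mult_strict_right_mono)
          also have "\<dots> = 1 / q"
            using q by (simp add: \<kappa>_def q_def)
          finally have "320 * exp (24 * \<theta>) * B * sqrt \<kappa> < 1 / q" .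
          then show ?thesis
            using q B1 \<kappa>_pos by (simp add: exp_minus field_simps)
        qed
        ultimately show ?thesis
          by (simp add: q_def)
      qed
      have even: "2 * (2 ^ (w div 4) div 2 * (2 ^ w + 1)) \<le> B * (\<kappa> + 1)"
      proof -
        have "2 * (2 ^ (w div 4) div 2) \<le> B"
          by (simp add: B_def v_def)
        then show ?thesis
          using mult_le_mono1[of "2 * (2 ^ (w div 4) div 2)" B "\<kappa> + 1"] by (simp add: \<kappa>_def mult.assoc)
      qed
      have p: "(1 - 1 / 2 ^ w) ^ (B * R) \<le> 1 - (1 - 1 / 2 ^ w) ^ (B * R) - B * R * (1 / 2 ^ w * (1 - 1 / 2 ^ w) ^ (B * R - 1))"
          "1 - 2 * (1 - 1 / 2 ^ w) ^ (B * R) - B * R * (1 / 2 ^ w * (1 - 1 / 2 ^ w) ^ (B * R - 1)) \<le> B * q"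
        using R(2,3) unfolding balance_def[OF q] prob0_def[OF q] prob1_def[OF q]
        unfolding q_def by linarith+
      \<comment> \<open>Each of the four losses is at most \<open>\<delta> / 16\<close>.\<close>
      have const: "\<delta> / 2 \<le> 1 / 2 - \<epsilon> - B * q / 2 - 1 / (2 * sqrt B) - 4 / 2 ^ r - (\<kappa> + 1) / (\<theta> * (real \<kappa> + 1))"
      proof -
        have "(\<kappa> + 1) / (\<theta> * (real \<kappa> + 1)) = \<delta> / 16"
          using \<delta> by (simp add: \<theta>_def field_simps)
        moreover have "1 / (2 * sqrt B) = 1 / sqrt B / 2" by simp
        moreover have "\<delta> / 2 \<le> 1 / 2 - \<epsilon> - a / 2 - h - z - y"
          if "y = \<delta> / 16" "h = u / 2" "a \<le> \<delta> / 8" "u \<le> \<delta> / 8" "z \<le> \<delta> / 16" for a h u y z :: real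
          using that \<delta>(1) \<delta>_def by (simp add: field_simps)
        ultimately show ?thesis
          using order_trans[OF Bq inv_B] inv_sqrtB r(2) by blast
      qed
      show "(1 / 2 - \<epsilon>) / 2 * 2 ^ (2 ^ (w div 4) div 2 * (2 ^ w + 1)) \<le> real (top_down_dt_size n ?f \<epsilon>)"
      proof (rule top_down_dt_size_ge)
        show "0 < n"
          using n r(1) by linarith
        show "?f \<in> hypercube n \<rightarrow> {-1, 1}"
          using pm_range by blast
        fix T :: "unit dtree"
        assume T: "greedy n T ?f" "approximates n \<epsilon> (completion n T ?f) ?f"
        have "\<delta> / 2 * 2 ^ (2 ^ (w div 4) div 2 * (2 ^ w + 1))
            \<le> (1 / 2 - \<epsilon> - B * q / 2 - 1 / (2 * sqrt B) - 4 / 2 ^ r - (\<kappa> + 1) / (\<theta> * (real \<kappa> + 1)))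
              * 2 ^ (2 ^ (w div 4) div 2 * (2 ^ w + 1))"
          by (intro mult_right_mono const) simp
        also have "\<dots> \<le> real (dtree_size T)"
          by (rule greedy_size_ge[OF T gap K even p])
        finally show "(1 / 2 - \<epsilon>) / 2 * 2 ^ (2 ^ (w div 4) div 2 * (2 ^ w + 1)) \<le> real (dtree_size T)"
          by (simp only: \<delta>_def)
      qed (use \<epsilon> in simp)
    qed
  qed
qed

section \<open>Approximate representation\<close>

text \<open>The power of \<open>log 2 (log 2 s)\<close> makes room for the factor \<open>w\<close>
  in \<open>w * 2 ^ w\<close> and for the polylogarithmic factor in the bound on
  \<open>s\<close>.\<close>

definition width :: "nat \<Rightarrow> nat \<Rightarrow> nat" where
  "width K s = nat \<lfloor>log 2 (log 2 s / log 2 (log 2 s) ^ K)\<rfloor>"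

text \<open>Serves the indices at which \<open>s n\<close> is small, where only the optimal size has
  to be met.\<close>

lemma filler_function:
  assumes "2 \<le> s" "s \<le> 2 ^ k" "3 * k \<le> n"
  shows "\<exists>f. monotone_pm_function n f \<and> optimal_dt_size n f = s"
proof -
  have "3 * k - 2 \<le> card {..<n}"
    using assms(3) by simp
  then obtain g where g: "depends_only {..<n} g" "monotone_nonconst g" "dt_size g = s"
    using ex_dt_size[OF assms(1,2)] by blast
  then show ?thesis
    using optimal_dt_size_pm[OF g(1)]
    by (intro exI[of _ "\<lambda>x. pm (g x)"]) (simp add: monotone_pm monotone_nonconst_def)
qed

lemma const_function: "\<exists>f. monotone_pm_function n f \<and> optimal_dt_size n f = 1"
  using optimal_dt_size_pm[of n "\<lambda>_. True"] dt_size_const[of True]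
  by (intro exI[of _ "\<lambda>x. pm True"]) (simp add: monotone_pm depends_only_def mono_def)

lemma top_down_dt_size_ge_1:
  assumes "0 < n" "monotone_pm_function n f" "0 \<le> \<epsilon>"
  shows "1 \<le> real (top_down_dt_size n f \<epsilon>)"
proof (rule top_down_dt_size_ge)
  show "1 \<le> real (dtree_size T)" for T :: "unit dtree"
    using dtree_size_pos[of T] by linarith
qed (use assms in \<open>auto simp: monotone_pm_function_def\<close>)

lemma log_log_pos: "1 \<le> log 2 (log 2 (real s)) \<Longrightarrow> 0 < log 2 (real s)"
proof (rule ccontr)
  assume "1 \<le> log 2 (log 2 (real s))" "\<not> 0 < log 2 (real s)"
  moreover have "0 \<le> log 2 (real s)"
    by (cases "s = 0") (simp_all add: log_def)
  ultimately have "log 2 (real s) = 0" by linarith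
  \<comment> \<open>By the convention \<open>ln 0 = 0\<close>; thus a bound on the iterated
    logarithm excludes degenerate \<open>s\<close>.\<close>
  then have "log 2 (log 2 (real s)) = 0"
    by (simp only: log_def ln_0 div_0)
  then show False
    using \<open>1 \<le> log 2 (log 2 (real s))\<close> by linarith
qed

lemma width_bounds:
  assumes "1 \<le> log 2 (log 2 s)" "1 \<le> log 2 (log 2 s / log 2 (log 2 s) ^ K)"
  shows "2 ^ width K s \<le> log 2 s / log 2 (log 2 s) ^ K"
    "log 2 s / log 2 (log 2 s) ^ K \<le> 2 * 2 ^ width K s"
    "width K s \<le> log 2 (log 2 s)"
proof -
  let ?L = "log 2 s" and ?l = "log 2 (log 2 s)"
  let ?x = "?L / ?l ^ K"
  have L: "0 < ?L"
    using assms(1) by (rule log_log_pos)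
  have x: "0 < ?x"
    using L assms(1) by simp
  have fl: "real (width K s) \<le> log 2 ?x" "log 2 ?x < real (width K s) + 1"
    using assms(2) unfolding width_def by linarith+
  have "2 powr real (width K s) \<le> ?x"
    using fl(1) x by (simp add: le_log_iff)
  then show "2 ^ width K s \<le> ?x"
    by (simp add: powr_realpow)
  have "?x \<le> 2 powr (real (width K s) + 1)"
    using fl(2) x by (intro less_imp_le) (simp add: log_less_iff)
  then show "?x \<le> 2 * 2 ^ width K s"
    by (simp add: powr_add powr_realpow)
  have "?x \<le> ?L"
    using L assms(1) one_le_power[of ?l K] by (simp add: divide_le_eq)
  then have "log 2 ?x \<le> log 2 ?L"
    using x L by simp
  then show "width K s \<le> ?l"
    using fl(1) by linarith
qed

text \<open>Here 2^w becomes 2^(5w/4); the factor 16 absorbs the roundings in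
  \<open>w div 4\<close>, in halving \<open>B\<close> and in \<open>width\<close>.\<close>

lemma exponent_bound:
  assumes "4 \<le> w" "0 < x" "x \<le> 2 * 2 ^ w"
  shows "x powr (5 / 4) \<le> 16 * real (2 ^ (w div 4) div 2 * (2 ^ w + 1))"
proof -
  obtain j where j: "w div 4 = Suc j"
    using assms(1) by (cases "w div 4") auto
  have "x powr (5 / 4) \<le> (2 powr (1 + real w)) powr (5 / 4)"
    using assms by (intro powr_mono2) (simp_all add: powr_add powr_realpow)
  also have "\<dots> = 2 powr (5 / 4 * (1 + real w))"
    by (simp add: powr_powr mult.commute)
  also have "\<dots> \<le> 2 powr (4 + real j + real w)"
  proof (rule powr_mono)
    have "w \<le> 4 * (w div 4) + 3" by simp
    then have "real w \<le> 4 * real j + 7"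
      using j by linarith
    then show "5 / 4 * (1 + real w) \<le> 4 + real j + real w" by (simp add: field_simps)
  qed simp
  also have "\<dots> = 16 * (2 ^ j * 2 ^ w)"
    by (simp add: powr_add powr_realpow)
  also have "\<dots> \<le> 16 * real (2 ^ (w div 4) div 2 * (2 ^ w + 1))"
    by (simp add: j)
  finally show ?thesis .
qed

text \<open>\<open>s n\<close> need not tend to infinity, and \<open>h\<close> must not depend on
  the sequence. Conditions on large values of \<open>s\<close> are therefore collected in a
  threshold \<open>S0\<close>, below which \<open>h\<close> is 0, separately from those on large
  \<open>n\<close>.\<close>

theorem approximate_lower_bound:
  fixes \<epsilon> :: real
  assumes \<epsilon>: "0 < \<epsilon>" "\<epsilon> < 1 / 2" and b: "b \<in> soft_O (\<lambda>n. real n powr (4 / 5))"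
  shows "\<exists>h \<in> soft_Omega (\<lambda>m. log 2 (real m) powr (1 / 4)).
        \<forall>s :: nat \<Rightarrow> nat. (\<forall>n. 1 \<le> s n \<and> real (s n) \<le> 2 powr b n) \<longrightarrow>
          (\<forall>\<^sub>F n in sequentially. \<exists>f. monotone_pm_function n f \<and>
             optimal_dt_size n f = s n \<and>
             real (top_down_dt_size n f \<epsilon>) \<ge> real (s n) powr h (s n))"
proof -
  obtain C k0 where C: "0 < C"
    and bC: "\<forall>\<^sub>F n in sequentially. b n \<le> C * real n powr (4 / 5) * log 2 (real n powr (4 / 5)) ^ k0"
    using b unfolding soft_O_def by blast
  obtain w0 r where r: "0 < r" and hard: "\<And>w n k s. w0 \<le> w \<Longrightarrow>
      4 * w * 2 ^ w + 2 ^ (w div 4) * (2 * 2 ^ w + 1) + 2 * r + 3 * k \<le> n \<Longrightarrow> s \<le> 2 ^ k \<Longrightarrow>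
      2 * (r + r * (r * 2 ^ (4 * w * 2 ^ w + 2 * 2 ^ w + 1) + 1)) + 2 \<le> s \<Longrightarrow>
      \<exists>f. monotone_pm_function n f \<and> optimal_dt_size n f = s \<and>
        (1 / 2 - \<epsilon>) / 2 * 2 ^ (2 ^ (w div 4) div 2 * (2 ^ w + 1)) \<le> real (top_down_dt_size n f \<epsilon>)"
    using hard_function[OF \<epsilon>] by blast
  define \<delta> where "\<delta> = (1 / 2 - \<epsilon>) / 2"
  have \<delta>: "0 < \<delta>"
    using \<epsilon> by (simp add: \<delta>_def)
  \<comment> \<open>\<open>k0\<close> cancels the logarithms in the bound on \<open>b\<close>; the
    additional 2 absorbs the constants and the factor \<open>w\<close> of the tribe
    variables.\<close>
  define K where "K = k0 + 2"
  define A where "A = real (2 * (r * r) + 4 * r + 2)"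
  have A: "1 \<le> A"
    by (simp add: A_def)
  let ?L = "\<lambda>s :: nat. log 2 (real s)" and ?l = "\<lambda>s :: nat. log 2 (log 2 (real s))"
  have "\<forall>\<^sub>F s :: nat in sequentially. 1 \<le> ?l s"
    by real_asymp
  \<comment> \<open>Ensures \<open>w >= w0\<close> and \<open>w >= 4\<close>, and that the loss
    \<open>log 2 (1 / \<delta>)\<close> is at most half of the exponent.\<close>
  moreover have "\<forall>\<^sub>F s :: nat in sequentially. real w0 + 5 + \<bar>log 2 (1 / \<delta>)\<bar> * 16 \<le> log 2 (?L s / ?l s ^ K)"
    by real_asymp
  \<comment> \<open>Makes \<open>s\<close> exceed its lower bound in \<open>hard\<close>, which is
    at most \<open>A * 2 ^ e\<close> with \<open>e <= 6 * L / l + 1\<close>.\<close>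
  moreover have "\<forall>\<^sub>F s :: nat in sequentially. (log 2 A + 1) + 6 * ?L s / ?l s \<le> ?L s"
    by real_asymp
  ultimately have "\<forall>\<^sub>F s :: nat in sequentially. 1 \<le> ?l s \<and>
      real w0 + 5 + \<bar>log 2 (1 / \<delta>)\<bar> * 16 \<le> log 2 (?L s / ?l s ^ K) \<and>
      (log 2 A + 1) + 6 * ?L s / ?l s \<le> ?L s"
    by eventually_elim simp
  then obtain S0 where S0: "\<And>s. S0 \<le> s \<Longrightarrow> 1 \<le> ?l s"
      "\<And>s. S0 \<le> s \<Longrightarrow> real w0 + 5 + \<bar>log 2 (1 / \<delta>)\<bar> * 16 \<le> log 2 (?L s / ?l s ^ K)"
      "\<And>s. S0 \<le> s \<Longrightarrow> (log 2 A + 1) + 6 * ?L s / ?l s \<le> ?L s"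
    unfolding eventually_sequentially by blast
  \<comment> \<open>The constant 1/32 is 1/16 from \<open>exponent_bound\<close> and 1/2 for the
    loss due to \<open>\<delta>\<close>. The exponent \<open>2 * K\<close> rounds up
    \<open>5 / 4 * K\<close>, as \<open>soft_Omega\<close> admits natural powers only.\<close>
  define h where "h m = (if m < S0 then 0 else 1 / 32 * ?L m powr (1 / 4) / ?l m ^ (2 * K))" for m
  have "h \<in> soft_Omega (\<lambda>m. log 2 (real m) powr (1 / 4))"
    unfolding soft_Omega_def mem_Collect_eq
  proof (intro exI conjI)
    show "0 < 1 / 32 * (1 / 4 :: real) ^ (2 * K)" by simp
    show "\<forall>\<^sub>F m in sequentially. 1 / 32 * (1 / 4) ^ (2 * K) * log 2 (real m) powr (1 / 4) /
        log 2 (log 2 (real m) powr (1 / 4)) ^ (2 * K) \<le> h m"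
    proof (rule eventually_mono[OF eventually_ge_at_top[of S0]])
      fix m
      assume m: "S0 \<le> m"
      have L: "0 < ?L m"
        using S0(1)[OF m] by (rule log_log_pos)
      have eq: "log 2 (?L m powr (1 / 4)) = ?l m / 4"
        using L by (simp add: log_powr)
      show "1 / 32 * (1 / 4) ^ (2 * K) * log 2 (real m) powr (1 / 4) /
          log 2 (log 2 (real m) powr (1 / 4)) ^ (2 * K) \<le> h m"
        unfolding eq using m by (simp add: h_def power_divide)
    qed
  qed
  moreover have "\<forall>\<^sub>F n in sequentially. \<exists>f. monotone_pm_function n f \<and> optimal_dt_size n f = s n \<and>
      real (s n) powr h (s n) \<le> real (top_down_dt_size n f \<epsilon>)"
    if s: "\<forall>n. 1 \<le> s n \<and> real (s n) \<le> 2 powr b n" for s :: "nat \<Rightarrow> nat"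
  proof -
    let ?C = "\<lambda>n::nat. C * real n powr (4 / 5) * log 2 (real n) ^ k0"
    have "\<forall>\<^sub>F n :: nat in sequentially.
        7 * (C * real n powr (4 / 5) * log 2 (real n) ^ k0) + (real (2 * r) + 3) \<le> real n / 2"
      by real_asymp
    moreover have "\<forall>\<^sub>F n :: nat in sequentially. C * 2 ^ K * 6 powr (4 / 5) \<le> log 2 (real n) ^ 2"
      by real_asymp
    moreover have "\<forall>\<^sub>F n :: nat in sequentially. sqrt (real n) \<le> (real n / 6) powr (4 / 5)"
      by real_asymp
    moreover have "\<forall>\<^sub>F n :: nat in sequentially. 1 \<le> log 2 (real n)"
      by real_asymp
    moreover note bC eventually_ge_at_top[of "3 * S0 + 1"]
    ultimately show ?thesis
    proof eventually_elim
      case (elim n)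
      have n: "0 < n" using elim by linarith
      show ?case
      proof (cases "s n < S0")
        case True
        obtain f where f: "monotone_pm_function n f" "optimal_dt_size n f = s n"
        proof (cases "s n = 1")
          case True
          then show thesis
            using const_function[of n] that by auto
        next
          case False
          then have "2 \<le> s n"
            using s[rule_format, of n] by linarith
          moreover have "s n \<le> 2 ^ S0"
            using \<open>s n < S0\<close> less_exp[of S0] by linarith
          moreover have "3 * S0 \<le> n"
            using elim by linarith
          ultimately show thesis
            using filler_function that by blast
        qed
        moreover have "1 \<le> real (top_down_dt_size n f \<epsilon>)"
          using top_down_dt_size_ge_1[OF n f(1)] \<epsilon> by simp
        ultimately show ?thesis
          using True s[rule_format, of n] by (intro exI[of _ f]) (simp add: h_def)
      next
        case False
        then have m: "S0 \<le> s n" by simp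
        define w where "w = width K (s n)"
        define L where "L = ?L (s n)"
        define l where "l = ?l (s n)"
        have l_L: "l = log 2 L"
          by (simp add: l_def L_def)
        have l1: "1 \<le> l"
          using S0(1)[OF m] by (simp add: l_def)
        have sn: "1 \<le> real (s n)"
          using s[rule_format, of n] by simp
        have L0: "0 < L"
          unfolding L_def using S0(1)[OF m] by (rule log_log_pos)
        have x1: "1 \<le> log 2 (?L (s n) / ?l (s n) ^ K)"
          using S0(2)[OF m] by linarith
        note wb = width_bounds[OF S0(1)[OF m] x1, folded w_def L_def l_def]
        have lK: "l \<le> l ^ K" "1 \<le> l ^ K"
          using self_le_power[of l K] one_le_power[of l K] l1 by (simp_all only: K_def zero_less_Suc add_2_eq_Suc' add_2_eq_Suc)
        have w_large: "real w0 + 5 + \<bar>log 2 (1 / \<delta>)\<bar> * 16 < real w + 1"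
          using S0(2)[OF m] x1 unfolding w_def width_def by linarith
        have w2w: "real w * 2 ^ w \<le> L"
        proof -
          have "real w * 2 ^ w \<le> l * (L / l ^ K)"
            using wb L0 l1 by (intro mult_mono) auto
          also have "\<dots> \<le> L"
            using lK L0 l1 by (simp add: field_simps)
          finally show ?thesis .
        qed
        have lK1: "L / l ^ K \<le> L / l" "L / l \<le> L" "l * (L / l ^ K) \<le> L / l"
        proof -
          have "l * l \<le> l ^ K"
            using l1 power_increasing[of 2 K l] by (simp add: K_def power2_eq_square)
          then show "l * (L / l ^ K) \<le> L / l"
            using l1 L0 lK by (simp add: field_simps)
          show "L / l ^ K \<le> L / l"
            using lK l1 L0 by (intro divide_left_mono) auto
          show "L / l \<le> L"
            using l1 L0 by (simp add: divide_le_eq)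
        qed
        have two_w: "2 ^ w \<le> L / l"
          using wb(1) lK1(1) by linarith
        have w2w_l: "real w * 2 ^ w \<le> L / l"
        proof -
          have "real w * 2 ^ w \<le> l * (L / l ^ K)"
            using wb l1 by (intro mult_mono) auto
          then show ?thesis
            using lK1(3) by linarith
        qed
        define D where "D = C * real n powr (4 / 5) * log 2 (real n) ^ k0"
        have LD: "L \<le> D"
        proof -
          have "L \<le> b n"
            using s[rule_format, of n] unfolding L_def by (subst log_le_iff) auto
          also have "\<dots> \<le> C * real n powr (4 / 5) * log 2 (real n powr (4 / 5)) ^ k0"
            using elim by blast
          also have "\<dots> \<le> D"
            unfolding D_def using elim C n by (intro mult_left_mono power_mono) (auto simp: log_powr)
          finally show ?thesis .
        qed
        have sn_eq: "real (s n) = 2 powr L"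
          using sn by (simp add: L_def)
        define k where "k = nat \<lceil>L\<rceil>"
        have k: "L \<le> real k" "real k \<le> L + 1"
          using L0 unfolding k_def by linarith+
        have s_le: "s n \<le> 2 ^ k"
        proof -
          have "real (s n) \<le> 2 powr real k"
            unfolding sn_eq using k by (intro powr_mono) auto
          also have "\<dots> = real (2 ^ k)"
            by (simp add: powr_realpow)
          finally show ?thesis
            by (simp only: of_nat_le_iff)
        qed
        \<comment> \<open>If \<open>L\<close> is at most \<open>sqrt n\<close> there is nothing to
          gain. Otherwise \<open>l\<close> is at least half of \<open>log 2 n\<close>, so dividing
          by \<open>l ^ K\<close> outweighs the polylogarithmic factor in the bound on
          \<open>L\<close>.\<close>
        have two_w_n: "2 ^ w \<le> (real n / 6) powr (4 / 5)"
        proof (cases "L \<le> sqrt n")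
          case True
          then show ?thesis
            using two_w lK1(2) elim(3) by linarith
        next
          case False
          have ln: "1 \<le> log 2 n" using elim by blast
          have "log 2 n / 2 \<le> l"
          proof -
            have "log 2 (sqrt n) \<le> log 2 L"
              using False n L0 by (subst log_le_cancel_iff) auto
            moreover have "log 2 (sqrt n) = log 2 n / 2"
              using n by (simp add: powr_half_sqrt[symmetric] log_powr)
            ultimately show ?thesis
              by (simp add: l_def L_def)
          qed
          then have "(log 2 n / 2) ^ K \<le> l ^ K"
            using ln by (intro power_mono) auto
          then have "L / l ^ K \<le> D / (log 2 n / 2) ^ K"
            using LD L0 ln by (intro frac_le) auto
          also have "\<dots> = C * 2 ^ K * real n powr (4 / 5) / log 2 n ^ 2"
            using ln by (simp add: D_def K_def power_add power_divide power2_eq_square field_simps)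
          also have "\<dots> \<le> real n powr (4 / 5) / 6 powr (4 / 5)"
          proof -
            have "C * 2 ^ K * 6 powr (4 / 5) \<le> log 2 n ^ 2" using elim by blast
            then have "C * 2 ^ K * 6 powr (4 / 5) * real n powr (4 / 5) \<le> log 2 n ^ 2 * real n powr (4 / 5)"
              by (intro mult_right_mono) auto
            then show ?thesis
              using ln by (simp add: divide_simps mult_ac)
          qed
          also have "\<dots> = (real n / 6) powr (4 / 5)"
            by (simp add: powr_divide)
          finally show ?thesis
            using wb(1) by linarith
        qed
        \<comment> \<open>The block variables number about 2^(5w/4), and raising
          \<open>two_w_n\<close> to the power 5/4 makes them fit into half of
          \<open>n\<close>.\<close>
        have vars2: "3 * (2 ^ (w div 4) * 2 ^ w) \<le> real n / 2"
        proof -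
          have "(2 :: real) ^ (w div 4) * 2 ^ w = 2 powr (real (w div 4) + real w)"
            by (simp add: powr_add powr_realpow)
          also have "\<dots> \<le> 2 powr (real w * (5 / 4))"
          proof (intro powr_mono)
            have "4 * (w div 4) \<le> w" by simp
            then show "real (w div 4) + real w \<le> real w * (5 / 4)" by linarith
          qed simp
          also have "\<dots> = (2 ^ w) powr (5 / 4)"
            using powr_powr[of 2 "real w" "5 / 4"] by (simp add: powr_realpow)
          also have "\<dots> \<le> ((real n / 6) powr (4 / 5)) powr (5 / 4)"
            using two_w_n by (intro powr_mono2) auto
          also have "\<dots> = real n / 6"
            using n by (simp add: powr_powr)
          finally show ?thesis by simp
        qed
        have vars: "4 * w * 2 ^ w + 2 ^ (w div 4) * (2 * 2 ^ w + 1) + 2 * r + 3 * k \<le> n"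
        proof -
          have "7 * D + (real (2 * r) + 3) \<le> real n / 2"
            using elim unfolding D_def by blast
          then have "4 * (real w * 2 ^ w) + real (2 * r) + 3 * real k \<le> real n / 2"
            using w2w LD k(2) by linarith
          moreover have "(2 :: real) ^ (w div 4) * (2 * 2 ^ w + 1) \<le> 3 * (2 ^ (w div 4) * 2 ^ w)"
            by (simp add: algebra_simps)
          ultimately have "4 * (real w * 2 ^ w) + 2 ^ (w div 4) * (2 * 2 ^ w + 1) + real (2 * r) + 3 * real k \<le> real n"
            using vars2 by linarith
          then have "real (4 * w * 2 ^ w + 2 ^ (w div 4) * (2 * 2 ^ w + 1) + 2 * r + 3 * k) \<le> real n"
            by (simp add: algebra_simps)
          then show ?thesis
            by (simp only: of_nat_le_iff)
        qed
        have size: "2 * (r + r * (r * 2 ^ (4 * w * 2 ^ w + 2 * 2 ^ w + 1) + 1)) + 2 \<le> s n"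
        proof -
          define e where "e = 4 * w * 2 ^ w + 2 * 2 ^ w + 1"
          have "real e = 4 * (real w * 2 ^ w) + 2 * 2 ^ w + 1"
            by (simp add: e_def)
          then have e: "real e \<le> 6 * (L / l) + 1"
            using w2w_l two_w by linarith
          have "2 * (r + r * (r * 2 ^ e + 1)) + 2 = 2 * (r * r) * 2 ^ e + (4 * r + 2)"
            by (simp add: algebra_simps)
          also have "\<dots> \<le> 2 * (r * r) * 2 ^ e + (4 * r + 2) * 2 ^ e"
          proof -
            have "(4 * r + 2) * 1 \<le> (4 * r + 2) * 2 ^ e"
              by (rule mult_le_mono2) simp
            then show ?thesis
              by (simp only: mult_1_right add_le_cancel_left)
          qed
          also have "\<dots> = (2 * (r * r) + 4 * r + 2) * 2 ^ e"
            by (simp add: algebra_simps)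
          finally have "real (2 * (r + r * (r * 2 ^ e + 1)) + 2) \<le> real ((2 * (r * r) + 4 * r + 2) * 2 ^ e)"
            by (simp only: of_nat_le_iff)
          also have "\<dots> = A * 2 ^ e"
            by (simp only: A_def of_nat_mult of_nat_power of_nat_numeral)
          also have "\<dots> = 2 powr (log 2 A + real e)"
            using A by (simp add: powr_add powr_realpow)
          also have "\<dots> \<le> 2 powr L"
            using S0(3)[OF m, folded l_def L_def] e
            by (intro powr_mono) (simp_all add: mult.commute)
          finally have "real (2 * (r + r * (r * 2 ^ e + 1)) + 2) \<le> real (s n)"
            unfolding sn_eq .
          then show ?thesis
            unfolding e_def by (simp only: of_nat_le_iff)
        qed
        have "w0 \<le> w"
          using w_large by linarith
        from hard[OF this vars s_le size] obtain f where f: "monotone_pm_function n f"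
            "optimal_dt_size n f = s n"
            "\<delta> * 2 ^ (2 ^ (w div 4) div 2 * (2 ^ w + 1)) \<le> real (top_down_dt_size n f \<epsilon>)"
          unfolding \<delta>_def by blast
        define \<Lambda> where "\<Lambda> = 2 ^ (w div 4) div 2 * (2 ^ w + 1 :: nat)"
        have w4: "4 \<le> w"
          using w_large by linarith
        have x_pos: "0 < L / l ^ K"
          using L0 l1 by simp
        have "real w \<le> real \<Lambda>"
        proof -
          have "(1 :: nat) \<le> 2 ^ (w div 4) div 2"
          proof -
            obtain j where "w div 4 = Suc j"
              using w4 by (cases "w div 4") auto
            then show ?thesis by simp
          qed
          then have "1 * (2 ^ w + 1) \<le> \<Lambda>"
            unfolding \<Lambda>_def by (rule mult_le_mono1)
          then have "2 ^ w < \<Lambda>" by simp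
          then have "w \<le> \<Lambda>"
            using less_exp[of w] by (meson less_imp_le less_trans)
          then show ?thesis by simp
        qed
        then have \<Lambda>_large: "2 * \<bar>log 2 (1 / \<delta>)\<bar> \<le> real \<Lambda>"
          using w_large by linarith
        have "L * h (s n) \<le> real \<Lambda> / 2"
        proof -
          have "L * h (s n) = 1 / 32 * (L powr (5 / 4) / l ^ (2 * K))"
          proof -
            have "L * L powr (1 / 4) = L powr (1 + 1 / 4)"
              using L0 by (simp only: powr_add) simp
            then show ?thesis
              using m l_L by (simp add: h_def L_def[symmetric])
          qed
          also have "L powr (5 / 4) / l ^ (2 * K) \<le> L powr (5 / 4) / (l ^ K) powr (5 / 4)"
          proof (intro divide_left_mono)
            have "(l ^ K) powr (5 / 4) \<le> (l ^ K) powr 2"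
              using lK by (intro powr_mono) auto
            also have "\<dots> = l ^ (2 * K)"
              using l1 by (simp add: powr_numeral power_mult[symmetric] mult.commute)
            finally show "(l ^ K) powr (5 / 4) \<le> l ^ (2 * K)" .
          qed (use l1 in auto)
          also have "\<dots> = (L / l ^ K) powr (5 / 4)"
            using L0 l1 by (simp add: powr_divide)
          also have "\<dots> \<le> 16 * real \<Lambda>"
            unfolding \<Lambda>_def by (rule exponent_bound[OF w4 x_pos wb(2)])
          finally show ?thesis by simp
        qed
        then have "L * h (s n) \<le> real \<Lambda> - log 2 (1 / \<delta>)"
          using \<Lambda>_large by linarith
        then have "2 powr (L * h (s n)) \<le> 2 powr (real \<Lambda> - log 2 (1 / \<delta>))"
          by (intro powr_mono) auto
        also have "\<dots> = \<delta> * 2 ^ \<Lambda>"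
          using \<delta> by (simp add: powr_diff powr_realpow)
        also have "\<dots> \<le> real (top_down_dt_size n f \<epsilon>)"
          using f(3) by (simp only: \<Lambda>_def)
        finally have "real (s n) powr h (s n) \<le> real (top_down_dt_size n f \<epsilon>)"
          by (simp add: sn_eq powr_powr)
        then show ?thesis
          using f(1,2) by blast
      qed
    qed
  qed
  ultimately show ?thesis by blast
qed

section \<open>Exact representation\<close>

lemma influence_pm: "influence n k (\<lambda>x. pm (G x)) = cube_prob n (\<lambda>x. G x \<noteq> G (x(k := \<not> x k)))"
  by (simp add: influence_eq)

lemma depends_only_flip:
  assumes "depends_only S G" "k \<notin> - S"
  shows "depends_only S (\<lambda>x. G x \<noteq> G (x(k := \<not> x k)))"
proof (rule depends_onlyI)
  fix x y :: "nat \<Rightarrow> bool"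
  assume xy: "\<And>i. i \<in> S \<Longrightarrow> x i = y i"
  have "G x = G y"
    by (rule depends_onlyD[OF assms(1) xy])
  moreover have "G (x(k := \<not> x k)) = G (y(k := \<not> y k))"
    by (rule depends_onlyD[OF assms(1)]) (use xy assms(2) in auto)
  ultimately show "(G x \<noteq> G (x(k := \<not> x k))) = (G y \<noteq> G (y(k := \<not> y k)))"
    by simp
qed

lemma cube_prob_coordinate_conj:
  assumes "i < n" "depends_only (- {i}) Q"
  shows "cube_prob n (\<lambda>x. x i = b \<and> Q x) = 1 / 2 * cube_prob n Q"
proof -
  have "depends_only {i} (\<lambda>x. x i = b)"
    by (simp add: depends_only_def)
  then have "cube_prob n (\<lambda>x. x i = b \<and> Q x) = cube_prob n (\<lambda>x. x i = b) * cube_prob n Q"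
    using assms by (intro cube_prob_conj[of "{i}" n "- {i}"]) simp_all
  then show ?thesis
    by (simp only: cube_prob_coordinate[OF assms(1)])
qed

text \<open>The fresh variables of a conjunction (\<open>\<alpha> = True\<close>) or disjunction (\<open>\<alpha> = False\<close>) with \<open>G\<close> are more
  influential than the variables of \<open>G\<close> and hence are queried first.\<close>

lemma greedy_gate1:
  assumes a: "a < n" and G: "depends_only (- {a}) G"
    and inf: "\<And>k. k < n \<Longrightarrow> influence n k (\<lambda>x. pm (G x)) < 2 * cube_prob n (\<lambda>x. G x = \<alpha>)"
    and T: "greedy n T (\<lambda>x. pm (if x a = \<alpha> then G x else \<not> \<alpha>))"
      "exact_on n T (\<lambda>x. pm (if x a = \<alpha> then G x else \<not> \<alpha>))"
  shows "\<exists>T'. greedy n T' (\<lambda>x. pm (G x)) \<and> exact_on n T' (\<lambda>x. pm (G x)) \<and> dtree_size T' \<le> dtree_size T"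
proof -
  let ?f = "\<lambda>x. if x a = \<alpha> then G x else \<not> \<alpha>"
  have Gu: "G (x(a := v)) = G x" for x v
    by (rule depends_only_update[OF G]) simp
  have "?f x \<noteq> ?f (x(a := \<not> x a)) \<longleftrightarrow> G x = \<alpha>" for x
    using Gu[of x] by (cases \<alpha>; cases "x a"; simp)
  then have inf_a: "influence n a (\<lambda>x. pm (?f x)) = cube_prob n (\<lambda>x. G x = \<alpha>)"
    by (simp add: influence_pm)
  \<comment> \<open>A variable \<open>k\<close> of \<open>G\<close> is effective only on the half of
    the inputs with \<open>x a = \<alpha>\<close>, hence the factor 2 in \<open>inf\<close>.\<close>
  have inf_k: "influence n k (\<lambda>x. pm (?f x)) < cube_prob n (\<lambda>x. G x = \<alpha>)" if k: "k < n" "k \<noteq> a" for k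
  proof -
    have "?f x \<noteq> ?f (x(k := \<not> x k)) \<longleftrightarrow> x a = \<alpha> \<and> G x \<noteq> G (x(k := \<not> x k))" for x
      using k by (cases "x a = \<alpha>") simp_all
    then have "influence n k (\<lambda>x. pm (?f x)) = cube_prob n (\<lambda>x. x a = \<alpha> \<and> G x \<noteq> G (x(k := \<not> x k)))"
      by (simp only: influence_pm)
    also have "\<dots> = 1 / 2 * influence n k (\<lambda>x. pm (G x))"
      unfolding influence_pm using k by (intro cube_prob_coordinate_conj a depends_only_flip[OF G]) simp
    finally show ?thesis
      using inf[OF k(1)] by simp
  qed
  have pos: "0 < cube_prob n (\<lambda>x. G x = \<alpha>)"
    using inf[OF a] influence_nonneg[of n a "\<lambda>x. pm (G x)"] by simp
  show ?thesis
  proof (cases T)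
    case (Leaf u)
    then show ?thesis
      using exact_on_Leaf[of n u "\<lambda>x. pm (?f x)" a] T(2) a inf_a pos by simp
  next
    case (Query i l r)
    have "i = a"
    proof (rule ccontr)
      assume "i \<noteq> a"
      moreover have "i < n" "influence n a (\<lambda>x. pm (?f x)) \<le> influence n i (\<lambda>x. pm (?f x))"
        using T(1) a unfolding Query by auto
      ultimately show False
        using inf_k[of i] inf_a by simp
    qed
    have res: "restrict_var (\<lambda>x. pm (?f x)) a \<alpha> = (\<lambda>x. pm (G x))"
      by (rule ext) (simp add: restrict_var_def Gu)
    note ex = exact_on_Query[OF T[unfolded Query \<open>i = a\<close>]]
    show ?thesis
    proof (cases \<alpha>)
      case True
      then show ?thesis
        using T(1) ex(2) res unfolding Query \<open>i = a\<close> by (intro exI[of _ r]) auto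
    next
      case False
      then show ?thesis
        using T(1) ex(1) res unfolding Query \<open>i = a\<close> by (intro exI[of _ l]) auto
    qed
  qed
qed

text \<open>Ties permit \<open>a\<close> or \<open>b\<close> to come first; after either of them the
  situation is that of \<open>greedy_gate1\<close>.\<close>

lemma greedy_gate2:
  assumes ab: "a < n" "b < n" "a \<noteq> b" and G: "depends_only (- {a, b}) G"
    and inf: "\<And>k. k < n \<Longrightarrow> influence n k (\<lambda>x. pm (G x)) < 2 * cube_prob n (\<lambda>x. G x = \<alpha>)"
    and T: "greedy n T (\<lambda>x. pm (if x a = \<alpha> \<and> x b = \<alpha> then G x else \<not> \<alpha>))"
      "exact_on n T (\<lambda>x. pm (if x a = \<alpha> \<and> x b = \<alpha> then G x else \<not> \<alpha>))"
  shows "\<exists>T'. greedy n T' (\<lambda>x. pm (G x)) \<and> exact_on n T' (\<lambda>x. pm (G x)) \<and> dtree_size T' \<le> dtree_size T"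
proof -
  let ?f = "\<lambda>x. if x a = \<alpha> \<and> x b = \<alpha> then G x else \<not> \<alpha>"
  let ?p = "cube_prob n (\<lambda>x. G x = \<alpha>)"
  have Gu: "G (x(c := v)) = G x" if "c \<in> {a, b}" for x c v
    by (rule depends_only_update[OF G]) (use that in simp)
  have Ga: "depends_only (- {a}) G" and Gb: "depends_only (- {b}) G"
    by (rule depends_only_mono[OF G], force)+
  have flip: "?f x \<noteq> ?f (x(a := \<not> x a)) \<longleftrightarrow> x b = \<alpha> \<and> G x = \<alpha>" for x
    using Gu[of a x] ab(3) by (cases \<alpha>; cases "x a"; cases "x b"; simp)
  have inf_a: "influence n a (\<lambda>x. pm (?f x)) = 1 / 2 * ?p"
  proof -
    have "influence n a (\<lambda>x. pm (?f x)) = cube_prob n (\<lambda>x. x b = \<alpha> \<and> G x = \<alpha>)"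
      by (simp only: influence_pm flip)
    also have "\<dots> = 1 / 2 * ?p"
      by (rule cube_prob_coordinate_conj[OF ab(2) depends_only_comp[OF Gb]])
    finally show ?thesis .
  qed
  have inf_k: "influence n k (\<lambda>x. pm (?f x)) < 1 / 2 * ?p" if k: "k < n" "k \<noteq> a" "k \<noteq> b" for k
  proof -
    let ?E = "\<lambda>x. G x \<noteq> G (x(k := \<not> x k))"
    have "?f x \<noteq> ?f (x(k := \<not> x k)) \<longleftrightarrow> x a = \<alpha> \<and> x b = \<alpha> \<and> ?E x" for x
      using k by (cases "x a = \<alpha>"; cases "x b = \<alpha>") simp_all
    then have "influence n k (\<lambda>x. pm (?f x)) = cube_prob n (\<lambda>x. x a = \<alpha> \<and> x b = \<alpha> \<and> ?E x)"
      by (simp only: influence_pm)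
    also have "\<dots> = 1 / 2 * cube_prob n (\<lambda>x. x b = \<alpha> \<and> ?E x)"
    proof (rule cube_prob_coordinate_conj[OF ab(1) depends_only_conj])
      have "depends_only (- {a}) (\<lambda>x. x b)"
        using ab(3) by (intro depends_only_coordinate) simp
      then show "depends_only (- {a}) (\<lambda>x. x b = \<alpha>)"
        by (rule depends_only_comp)
      show "depends_only (- {a}) ?E"
        by (rule depends_only_flip[OF Ga]) (use k in simp)
    qed
    also have "cube_prob n (\<lambda>x. x b = \<alpha> \<and> ?E x) = 1 / 2 * cube_prob n ?E"
      by (rule cube_prob_coordinate_conj[OF ab(2) depends_only_flip[OF Gb]]) (use k in simp)
    also have "cube_prob n ?E = influence n k (\<lambda>x. pm (G x))"
      by (simp only: influence_pm)
    finally show ?thesis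
      using inf[OF k(1)] by simp
  qed
  have pos: "0 < ?p"
    using inf[OF ab(1)] influence_nonneg[of n a "\<lambda>x. pm (G x)"] by simp
  show ?thesis
  proof (cases T)
    case (Leaf u)
    then show ?thesis
      using exact_on_Leaf[of n u "\<lambda>x. pm (?f x)" a] T(2) ab inf_a pos by simp
  next
    case (Query i l r)
    have i: "i = a \<or> i = b"
    proof (rule ccontr)
      assume "\<not> ?thesis"
      moreover have "i < n" "influence n a (\<lambda>x. pm (?f x)) \<le> influence n i (\<lambda>x. pm (?f x))"
        using T(1) ab unfolding Query by auto
      ultimately show False
        using inf_k[of i] inf_a by simp
    qed
    define c where "c = (if i = a then b else a)"
    have c: "c < n" "depends_only (- {c}) G"
      using ab Ga Gb by (auto simp: c_def)
    have res: "restrict_var (\<lambda>x. pm (?f x)) i \<alpha> = (\<lambda>x. pm (if x c = \<alpha> then G x else \<not> \<alpha>))"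
      using i ab(3) by (intro ext) (auto simp: restrict_var_def Gu c_def)
    note ex = exact_on_Query[OF T[unfolded Query]]
    let ?T = "if \<alpha> then r else l"
    have "greedy n ?T (\<lambda>x. pm (if x c = \<alpha> then G x else \<not> \<alpha>))"
      "exact_on n ?T (\<lambda>x. pm (if x c = \<alpha> then G x else \<not> \<alpha>))"
      unfolding res[symmetric] using T(1) ex unfolding Query by (cases \<alpha>; simp)+
    from greedy_gate1[OF c inf this] show ?thesis
      unfolding Query by (cases \<alpha>) fastforce+
  qed
qed

text \<open>In the selector \<open>(w, z)\<close> with \<open>w\<close> a disjunction and \<open>z\<close> a conjunction of two variables, \<open>y\<close> is
  the most influential variable of \<open>ladder (Suc j)\<close>, but \<open>ladder j\<close> survives both restrictions of
  \<open>y\<close>. Asking for \<open>z\<close> and \<open>w\<close> first would need only one copy of \<open>ladder j\<close>.\<close>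

primrec ladder :: "nat \<Rightarrow> (nat \<Rightarrow> bool) \<Rightarrow> bool" where
  "ladder 0 x \<longleftrightarrow> x 0"
| "ladder (Suc j) x \<longleftrightarrow>
     (if x (5 * j + 4) then
        if x (5 * j + 5) then
          if x (5 * j + 2) then True else if x (5 * j + 3) then True else ladder j x
        else if x (5 * j + 2) then x (5 * j + 1) else if x (5 * j + 3) then x (5 * j + 1) else False
      else if x (5 * j + 2) then x (5 * j + 1) else if x (5 * j + 3) then x (5 * j + 1) else False)"

lemma depends_only_if:
  assumes "depends_only S P" "depends_only S Q" "depends_only S R"
  shows "depends_only S (\<lambda>x. if P x then Q x else R x)"
proof (rule depends_onlyI)
  fix x y :: "nat \<Rightarrow> bool"
  assume xy: "x i = y i" if "i \<in> S" for i
  have "P x = P y" "Q x = Q y" "R x = R y"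
    by (rule depends_onlyD[OF assms(1) xy] depends_onlyD[OF assms(2) xy] depends_onlyD[OF assms(3) xy];
        assumption)+
  then show "(if P x then Q x else R x) = (if P y then Q y else R y)"
    by simp
qed

lemma depends_only_const: "depends_only S (\<lambda>x. c)"
  by (simp add: depends_only_def)

lemma dep_ladder: "depends_only {..5 * j} (ladder j)"
proof (induction j)
  case (Suc j)
  have "depends_only {..5 * Suc j} (ladder j)"
    by (rule depends_only_mono[OF Suc]) auto
  then have "depends_only {..5 * Suc j} (\<lambda>x. ladder (Suc j) x)"
    unfolding ladder.simps
    by (intro depends_only_if depends_only_coordinate depends_only_const) auto
  then show ?case .
qed (simp add: depends_only_def)

lemma ladder_update: "5 * j < i \<Longrightarrow> ladder j (x(i := b)) = ladder j x"
  by (rule depends_only_update[OF dep_ladder]) simp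

lemma mono_ladder: "mono (ladder j)"
proof (induction j)
  case (Suc j)
  show ?case
  proof (rule monoI)
    fix x y :: "nat \<Rightarrow> bool"
    assume xy: "x \<le> y"
    then have "x i \<Longrightarrow> y i" for i
      by (auto simp: le_fun_def)
    moreover have "ladder j x \<Longrightarrow> ladder j y"
      using monoD[OF Suc xy] unfolding le_bool_def by blast
    ultimately show "ladder (Suc j) x \<le> ladder (Suc j) y"
      unfolding ladder.simps le_bool_def by (auto split: if_splits)
  qed
qed (rule monoI, simp add: le_fun_def)

text \<open>\<open>ladder\<close> is written as nested tests of single variables so that this rule
  evaluates its probabilities.\<close>

lemma cube_prob_if:
  assumes "a < n" "depends_only (- {a}) P" "depends_only (- {a}) Q"
  shows "cube_prob n (\<lambda>x. if x a then P x else Q x) = (cube_prob n P + cube_prob n Q) / 2"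
  using depends_only_update[OF assms(2), of a] depends_only_update[OF assms(3), of a]
  by (subst cube_prob_split[OF assms(1)]) simp

lemma dep_ladder_other: "5 * j < a \<Longrightarrow> depends_only (- {a}) (ladder j)"
  by (rule depends_only_mono[OF dep_ladder]) auto

lemmas dep_intros = depends_only_if depends_only_coordinate depends_only_const dep_ladder_other

lemma cube_prob_ladder: "5 * j < n \<Longrightarrow> cube_prob n (ladder j) = 1 / 2"
proof (induction j)
  case 0
  then show ?case
    using cube_prob_coordinate[of 0 n True] by simp
next
  case (Suc j)
  have n: "5 * j + 1 < n" "5 * j + 2 < n" "5 * j + 3 < n" "5 * j + 4 < n" "5 * j + 5 < n"
    using Suc.prems by auto
  have IH: "cube_prob n (\<lambda>x. ladder j x) = 1 / 2"
    using Suc by simp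
  have y: "cube_prob n (\<lambda>x. x (5 * j + 1)) = 1 / 2"
    using cube_prob_coordinate[OF n(1), of True] by simp
  have "cube_prob n (\<lambda>x. ladder (Suc j) x) = 1 / 2"
    unfolding ladder.simps
    apply (subst cube_prob_if[OF n(4)], (intro dep_intros; simp)+)
    apply (subst cube_prob_if[OF n(5)], (intro dep_intros; simp)+)
    apply (subst cube_prob_if[OF n(2)], (intro dep_intros; simp)+)+
    apply (subst cube_prob_if[OF n(3)], (intro dep_intros; simp)+)+
    by (simp only: IH y) simp
  then show ?case by simp
qed

text \<open>\<open>y\<close> is pivotal exactly if \<open>w = 1\<close> and \<open>z = 0\<close>,
  each of probability 3/4. For a variable of \<open>w\<close> or \<open>z\<close> to be pivotal, its
  partner must have a fixed value, and a variable of a lower level needs \<open>z = 1\<close>; this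
  gives at most 1/2.\<close>

lemma influence_ladder:
  assumes "5 * Suc j < n"
  shows "influence n (5 * j + 1) (\<lambda>x. pm (ladder (Suc j) x)) = 9 / 16"
    and "k < n \<Longrightarrow> k \<noteq> 5 * j + 1 \<Longrightarrow> influence n k (\<lambda>x. pm (ladder (Suc j) x)) \<le> 1 / 2"
proof -
  have n: "5 * j + 1 < n" "5 * j + 2 < n" "5 * j + 3 < n" "5 * j + 4 < n" "5 * j + 5 < n"
    using assms by auto
  have flip: "ladder (Suc j) x \<noteq> ladder (Suc j) (x(5 * j + 1 := \<not> x (5 * j + 1))) \<longleftrightarrow>
     (if x (5 * j + 4) then
        if x (5 * j + 5) then False
        else if x (5 * j + 2) then True else if x (5 * j + 3) then True else False
      else if x (5 * j + 2) then True else if x (5 * j + 3) then True else False)" for x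
    by (simp add: ladder_update)
  show "influence n (5 * j + 1) (\<lambda>x. pm (ladder (Suc j) x)) = 9 / 16"
    unfolding influence_pm flip
    apply (subst cube_prob_if[OF n(4)], (intro dep_intros; simp)+)
    apply (subst cube_prob_if[OF n(5)], (intro dep_intros; simp)+)
    apply (subst cube_prob_if[OF n(2)], (intro dep_intros; simp)+)+
    apply (subst cube_prob_if[OF n(3)], (intro dep_intros; simp)+)+
    by simp
  have half: "influence n k (\<lambda>x. pm (ladder (Suc j) x)) \<le> 1 / 2"
    if "i < n" "\<And>x. ladder (Suc j) x \<noteq> ladder (Suc j) (x(k := \<not> x k)) \<Longrightarrow> x i = v" for i k v
  proof -
    have "influence n k (\<lambda>x. pm (ladder (Suc j) x)) \<le> cube_prob n (\<lambda>x. x i = v)"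
      unfolding influence_pm by (rule cube_prob_mono) (rule that(2))
    then show ?thesis
      by (simp only: cube_prob_coordinate[OF that(1)])
  qed
  assume k: "k < n" "k \<noteq> 5 * j + 1"
  consider "k = 5 * j + 2" | "k = 5 * j + 3" | "k = 5 * j + 4" | "k = 5 * j + 5" |
    "k \<notin> {5 * j + 1, 5 * j + 2, 5 * j + 3, 5 * j + 4, 5 * j + 5}"
    using k(2) by blast
  then show "influence n k (\<lambda>x. pm (ladder (Suc j) x)) \<le> 1 / 2"
  proof cases
    case 1
    then show ?thesis
      by (intro half[OF n(3), of k False]) (auto simp: ladder_update split: if_splits)
  next
    case 2
    then show ?thesis
      by (intro half[OF n(2), of k False]) (auto simp: ladder_update split: if_splits)
  next
    case 3
    then show ?thesis
      by (intro half[OF n(5), of k True]) (auto simp: ladder_update split: if_splits)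
  next
    case 4
    then show ?thesis
      by (intro half[OF n(4), of k True]) (auto simp: ladder_update split: if_splits)
  next
    case 5
    then show ?thesis
      by (intro half[OF n(4), of k True]) (auto split: if_splits)
  qed
qed

text \<open>After \<open>y\<close> there remains either w OR (z AND \<open>ladder j\<close>) or z
  AND (w OR \<open>ladder j\<close>). Both are two nested gates, through which
  \<open>greedy_gate2\<close> leads to \<open>ladder j\<close>. The induction starts at 1 because
  \<open>ladder 0\<close> is a single variable of influence 1, too much for the strict inequality
  \<open>inf_j\<close>.\<close>

lemma greedy_ladder:
  fixes T :: "unit dtree"
  assumes "5 * j < n" "1 \<le> j" "greedy n T (\<lambda>x. pm (ladder j x))" "exact_on n T (\<lambda>x. pm (ladder j x))"
  shows "2 ^ j \<le> dtree_size T"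
  using assms(2,1,3,4)
proof (induction j arbitrary: T rule: nat_induct_at_least)
  case base
  have inf: "influence n 1 (\<lambda>x. pm (ladder 1 x)) = 9 / 16"
    using influence_ladder(1)[of 0 n] base(1) by simp
  show ?case
  proof (cases T)
    case (Leaf u)
    then show ?thesis
      using exact_on_Leaf[of n u "\<lambda>x. pm (ladder 1 x)" 1] base inf by simp
  next
    case (Query i l r)
    then show ?thesis
      using dtree_size_pos[of l] dtree_size_pos[of r]
      by (simp only: Query dtree_size.simps power_one_right)
  qed
next
  case (Suc j)
  have n: "5 * j + 1 < n" "5 * j + 2 < n" "5 * j + 3 < n" "5 * j + 4 < n" "5 * j + 5 < n"
    using Suc.prems(1) by auto
  let ?f = "\<lambda>x. pm (ladder (Suc j) x)"
  let ?y = "5 * j + 1"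
  note inf = influence_ladder[OF Suc.prems(1)]
  obtain i l r where T: "T = Query i l r"
    using exact_on_Leaf[of n _ ?f ?y] Suc.prems(3) n(1) inf(1) by (cases T) auto
  have "i = ?y"
  proof (rule ccontr)
    assume "i \<noteq> ?y"
    moreover have "i < n" "influence n ?y ?f \<le> influence n i ?f"
      using Suc.prems(2) n(1) unfolding T by auto
    ultimately show False
      using inf(1) inf(2)[of i] by simp
  qed
  note T = T[unfolded this]
  note ex = exact_on_Query[OF Suc.prems(2,3)[unfolded T]]
  have gr: "greedy n l (restrict_var ?f ?y False)" "greedy n r (restrict_var ?f ?y True)"
    using Suc.prems(2) unfolding T by simp_all
  have inf_j: "influence n k (\<lambda>x. pm (ladder j x)) < 2 * cube_prob n (\<lambda>x. ladder j x = \<alpha>)"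
    if "k < n" for k \<alpha>
  proof -
    obtain j' where j': "j = Suc j'"
      using Suc.hyps by (cases j) auto
    have "influence n k (\<lambda>x. pm (ladder j x)) \<le> 9 / 16"
      using influence_ladder(1)[of j' n] influence_ladder(2)[of j' n k] that Suc.prems(1)
      unfolding j' by (cases "k = 5 * j' + 1") auto
    moreover have "cube_prob n (\<lambda>x. ladder j x = \<alpha>) = 1 / 2"
      using cube_prob_ladder[of j n] cube_prob_not[of n "ladder j"] Suc.prems(1) by (cases \<alpha>) simp_all
    ultimately show ?thesis by simp
  qed
  define G where "G a b \<alpha> = (\<lambda>x. if x a = \<alpha> \<and> x b = \<alpha> then ladder j x else \<not> \<alpha>)" for a b \<alpha>
  \<comment> \<open>For the outer gate no finer estimate is necessary: the inner gate alone
    determines the value with probability 3/4, and twice this exceeds 1.\<close>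
  have G_inf: "influence n k (\<lambda>x. pm (G a b \<alpha> x)) < 2 * cube_prob n (\<lambda>x. G a b \<alpha> x = (\<not> \<alpha>))"
    if "a < n" "b < n" "a \<noteq> b" for a b k \<alpha>
  proof -
    have "1 - 1 / 2 ^ card {a, b} = cube_prob n (\<lambda>x. \<not> (\<forall>i\<in>{a, b}. x i = \<alpha>))"
      using that by (subst cube_prob_not, subst cube_prob_all_eq) auto
    also have "\<dots> \<le> cube_prob n (\<lambda>x. G a b \<alpha> x = (\<not> \<alpha>))"
      by (rule cube_prob_mono) (auto simp: G_def)
    finally have "3 / 4 \<le> cube_prob n (\<lambda>x. G a b \<alpha> x = (\<not> \<alpha>))"
      using that by (simp add: power2_eq_square)
    moreover have "influence n k (\<lambda>x. pm (G a b \<alpha> x)) \<le> 1"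
      by (simp add: influence_pm)
    ultimately show ?thesis by linarith
  qed
  have G_dep: "depends_only (- {c, d}) (G a b \<alpha>)"
    if "a \<notin> {c, d}" "b \<notin> {c, d}" "5 * j < c" "5 * j < d" for a b c d \<alpha>
    unfolding G_def
    by (intro depends_only_if depends_only_const depends_only_mono[OF dep_ladder]
        depends_only_conj[OF depends_only_comp[where h = "\<lambda>v. v = \<alpha>"] depends_only_comp[where h = "\<lambda>v. v = \<alpha>"]]
        depends_only_coordinate)
      (use that in auto)
  have lad_dep: "depends_only (- {c, d}) (ladder j)" if "5 * j < c" "5 * j < d" for c d
    by (rule depends_only_mono[OF dep_ladder]) (use that in auto)
  have res_True: "restrict_var ?f ?y True
      = (\<lambda>x. pm (if x (5 * j + 2) = False \<and> x (5 * j + 3) = False then G (5 * j + 4) (5 * j + 5) True x else \<not> False))"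
    by (rule ext) (auto simp: restrict_var_def G_def ladder_update)
  have res_False: "restrict_var ?f ?y False
      = (\<lambda>x. pm (if x (5 * j + 4) = True \<and> x (5 * j + 5) = True then G (5 * j + 2) (5 * j + 3) False x else \<not> True))"
    by (rule ext) (auto simp: restrict_var_def G_def ladder_update)
  have "\<exists>T'. greedy n T' (\<lambda>x. pm (G (5 * j + 4) (5 * j + 5) True x)) \<and>
      exact_on n T' (\<lambda>x. pm (G (5 * j + 4) (5 * j + 5) True x)) \<and> dtree_size T' \<le> dtree_size r"
    by (rule greedy_gate2[OF n(2,3) _ _ _ gr(2)[unfolded res_True] ex(2)[unfolded res_True]])
      (use n G_dep G_inf[of "5 * j + 4" "5 * j + 5" _ True] in simp_all)
  then obtain T1 where T1: "greedy n T1 (\<lambda>x. pm (G (5 * j + 4) (5 * j + 5) True x))"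
      "exact_on n T1 (\<lambda>x. pm (G (5 * j + 4) (5 * j + 5) True x))" "dtree_size T1 \<le> dtree_size r"
    by blast
  have "\<exists>T'. greedy n T' (\<lambda>x. pm (ladder j x)) \<and> exact_on n T' (\<lambda>x. pm (ladder j x)) \<and>
      dtree_size T' \<le> dtree_size T1"
    by (rule greedy_gate2[OF n(4,5) _ lad_dep inf_j T1(1,2)[unfolded G_def]]) simp_all
  then have "2 ^ j \<le> dtree_size r"
    using Suc.IH T1(3) Suc.prems(1) by fastforce
  moreover
  have "\<exists>T'. greedy n T' (\<lambda>x. pm (G (5 * j + 2) (5 * j + 3) False x)) \<and>
      exact_on n T' (\<lambda>x. pm (G (5 * j + 2) (5 * j + 3) False x)) \<and> dtree_size T' \<le> dtree_size l"
    by (rule greedy_gate2[OF n(4,5) _ _ _ gr(1)[unfolded res_False] ex(1)[unfolded res_False]])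
      (use n G_dep G_inf[of "5 * j + 2" "5 * j + 3" _ False] in simp_all)
  then obtain T2 where T2: "greedy n T2 (\<lambda>x. pm (G (5 * j + 2) (5 * j + 3) False x))"
      "exact_on n T2 (\<lambda>x. pm (G (5 * j + 2) (5 * j + 3) False x))" "dtree_size T2 \<le> dtree_size l"
    by blast
  have "\<exists>T'. greedy n T' (\<lambda>x. pm (ladder j x)) \<and> exact_on n T' (\<lambda>x. pm (ladder j x)) \<and>
      dtree_size T' \<le> dtree_size T2"
    by (rule greedy_gate2[OF n(2,3) _ lad_dep inf_j T2(1,2)[unfolded G_def]]) simp_all
  then have "2 ^ j \<le> dtree_size l"
    using Suc.IH T2(3) Suc.prems(1) by fastforce
  ultimately show ?case
    unfolding T by simp
qed

section \<open>Optimal size of the ladder\<close>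

primrec ladder_tree :: "nat \<Rightarrow> bool dtree" where
  "ladder_tree 0 = Query 0 (Leaf False) (Leaf True)"
| "ladder_tree (Suc j) =
    (let y = Query (5 * j + 1) (Leaf False) (Leaf True);
         wy = Query (5 * j + 2) (Query (5 * j + 3) (Leaf False) y) y
     in Query (5 * j + 4) wy (Query (5 * j + 5) wy
          (Query (5 * j + 2) (Query (5 * j + 3) (ladder_tree j) (Leaf True)) (Leaf True))))"

lemma eval_ladder_tree: "eval_dtree (ladder_tree j) x = ladder j x"
  by (induction j) (auto simp: Let_def)

lemma dtree_size_ladder_tree: "dtree_size (ladder_tree j) = 12 * j + 2"
  by (induction j) (auto simp: Let_def)

lemma card_dtree_vars: "card (dtree_vars T) < dtree_size T"
proof (induction T)
  case (Query i l r)
  have "card (dtree_vars (Query i l r)) \<le> Suc (card (dtree_vars l \<union> dtree_vars r))"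
    by (simp add: card_insert_if)
  also have "\<dots> \<le> Suc (card (dtree_vars l) + card (dtree_vars r))"
    using card_Un_le by simp
  finally show ?case
    using Query by simp
qed simp

lemma ladder_relevant: "j < m \<Longrightarrow> \<exists>x. ladder m (x(5 * j + 1 := True)) \<noteq> ladder m (x(5 * j + 1 := False))"
proof (induction m)
  case (Suc m)
  show ?case
  proof (cases "j = m")
    case True
    \<comment> \<open>An input with \<open>w = 1\<close> and \<open>z = 0\<close>, where
      \<open>y\<close> decides.\<close>
    then show ?thesis
      by (intro exI[of _ "\<lambda>i. i = 5 * m + 2"]) simp
  next
    case False
    then have "j < m"
      using Suc.prems by simp
    from Suc.IH[OF this] obtain x where x: "ladder m (x(5 * j + 1 := True)) \<noteq> ladder m (x(5 * j + 1 := False))"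
      by blast
    \<comment> \<open>The new level is set to \<open>z = 1\<close> and \<open>w = 0\<close>, so that
      it passes on the value of \<open>ladder m\<close>.\<close>
    let ?x = "\<lambda>i. if i \<le> 5 * m then x i else i = 5 * m + 4 \<or> i = 5 * m + 5"
    have "ladder m (?x(5 * j + 1 := b)) = ladder m (x(5 * j + 1 := b))" for b
      by (rule depends_onlyD[OF dep_ladder]) simp
    then have *: "ladder (Suc m) (?x(5 * j + 1 := b)) = ladder m (x(5 * j + 1 := b))" for b
      using False Suc.prems by simp
    then show ?thesis
      using x by (intro exI[of _ ?x]) (simp only: * not_False_eq_True)
  qed
qed simp

text \<open>For the lower bound, every variable \<open>5 * j + 1\<close> with \<open>j < m\<close>
  is relevant, so a tree has at least \<open>m\<close> inner nodes.\<close>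

lemma dt_size_ladder: "m + 1 \<le> dt_size (ladder m)" "dt_size (ladder m) \<le> 12 * m + 2"
proof -
  show "dt_size (ladder m) \<le> 12 * m + 2"
    using dt_size_le[of "ladder_tree m" "ladder m"] by (simp add: eval_ladder_tree fun_eq_iff dtree_size_ladder_tree)
  obtain T where T: "eval_dtree T = ladder m" "dtree_size T = dt_size (ladder m)"
    using dt_size_witness[OF _ dep_ladder] by blast
  have "5 * j + 1 \<in> dtree_vars T" if j: "j < m" for j
  proof (rule ccontr)
    assume *: "5 * j + 1 \<notin> dtree_vars T"
    then have "ladder m (x(5 * j + 1 := b)) = ladder m x" for x b
      using eval_dtree_update[OF *, of x b] by (simp only: T(1))
    then show False
      using ladder_relevant[OF j] by simp
  qed
  then have "(\<lambda>j. 5 * j + 1) ` {..<m} \<subseteq> dtree_vars T" by auto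
  then have "card ((\<lambda>j. 5 * j + 1) ` {..<m}) \<le> card (dtree_vars T)"
    by (intro card_mono) auto
  moreover have "card ((\<lambda>j :: nat. 5 * j + 1) ` {..<m}) = m"
    by (subst card_image) (auto simp: inj_on_def)
  ultimately show "m + 1 \<le> dt_size (ladder m)"
    using card_dtree_vars[of T] T(2) by linarith
qed

theorem exact_lower_bound:
  "\<exists>(N :: nat set) (F :: nat \<Rightarrow> (nat \<Rightarrow> bool) \<Rightarrow> real) (c\<^sub>1 :: real) (c\<^sub>2 :: real) (c\<^sub>3 :: real).
       infinite N \<and> c\<^sub>1 > 0 \<and> c\<^sub>2 > 0 \<and> c\<^sub>3 > 0 \<and>
       (\<forall>n\<in>N. monotone_pm_function n (F n) \<and>
          c\<^sub>1 * real n \<le> real (optimal_dt_size n (F n)) \<and>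
          real (optimal_dt_size n (F n)) \<le> c\<^sub>2 * real n \<and>
          real (top_down_dt_size n (F n) 0) \<ge> 2 powr (c\<^sub>3 * real (optimal_dt_size n (F n))))"
proof -
  let ?N = "(\<lambda>m. 5 * m + 1) ` {1 :: nat..}"
  let ?F = "\<lambda>n x. pm (ladder ((n - 1) div 5) x)"
  have "infinite ?N"
    by (subst finite_image_iff) (auto simp: inj_on_def infinite_Ici)
  \<comment> \<open>The constants come from \<open>n = 5 * m + 1\<close> and an optimal size between
    \<open>m + 1\<close> and \<open>12 * m + 2\<close>, which is at most \<open>14 * m\<close> as
    \<open>m >= 1\<close>.\<close>
  moreover have "monotone_pm_function n (?F n) \<and>
      1 / 5 * real n \<le> real (optimal_dt_size n (?F n)) \<and>
      real (optimal_dt_size n (?F n)) \<le> 3 * real n \<and>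
      real (top_down_dt_size n (?F n) 0) \<ge> 2 powr (1 / 14 * real (optimal_dt_size n (?F n)))"
    if "n \<in> ?N" for n
  proof -
    obtain m where m: "1 \<le> m" "n = 5 * m + 1"
      using \<open>n \<in> ?N\<close> by auto
    have F: "?F n = (\<lambda>x. pm (ladder m x))"
      by (simp add: m)
    have "depends_only {..<n} (ladder m)"
      by (rule depends_only_mono[OF dep_ladder]) (auto simp: m)
    then have opt: "optimal_dt_size n (?F n) = dt_size (ladder m)"
      unfolding F by (rule optimal_dt_size_pm)
    have "2 ^ m \<le> real (top_down_dt_size n (?F n) 0)"
    proof (rule top_down_dt_size_ge)
      show "?F n \<in> hypercube n \<rightarrow> {-1, 1}"
        using pm_range by blast
      fix T :: "unit dtree"
      assume T: "greedy n T (?F n)" "approximates n 0 (completion n T (?F n)) (?F n)"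
      have "2 ^ m \<le> dtree_size T"
        by (rule greedy_ladder[OF _ m(1) T(1)[unfolded F] T(2)[folded exact_on_iff, unfolded F]]) (simp add: m)
      then show "2 ^ m \<le> real (dtree_size T)"
        by (metis of_nat_le_iff of_nat_numeral of_nat_power)
    qed (simp_all add: m)
    moreover have "2 powr (1 / 14 * real (optimal_dt_size n (?F n))) \<le> 2 powr real m"
      using dt_size_ladder(2)[of m] m(1) unfolding opt by (intro powr_mono) linarith+
    then have "2 powr (1 / 14 * real (optimal_dt_size n (?F n))) \<le> 2 ^ m"
      by (simp only: powr_realpow zero_less_numeral)
    moreover have "monotone_pm_function n (?F n)"
      unfolding F by (rule monotone_pm[OF mono_ladder])
    ultimately show ?thesis
      using dt_size_ladder[of m] m(2) unfolding opt by linarith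
  qed
  ultimately show ?thesis
    by (intro exI[of _ ?N] exI[of _ ?F] exI[of _ "1 / 5"] exI[of _ 3] exI[of _ "1 / 14"]) auto
qed

theorem theorem2p5:
  shows
    "(\<exists>(N :: nat set) (F :: nat \<Rightarrow> (nat \<Rightarrow> bool) \<Rightarrow> real) (c\<^sub>1 :: real) (c\<^sub>2 :: real) (c\<^sub>3 :: real).
       infinite N \<and> c\<^sub>1 > 0 \<and> c\<^sub>2 > 0 \<and> c\<^sub>3 > 0 \<and>
       (\<forall>n\<in>N. monotone_pm_function n (F n) \<and>
          c\<^sub>1 * real n \<le> real (optimal_dt_size n (F n)) \<and>
          real (optimal_dt_size n (F n)) \<le> c\<^sub>2 * real n \<and>
          real (top_down_dt_size n (F n) 0) \<ge> 2 powr (c\<^sub>3 * real (optimal_dt_size n (F n)))))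
     \<and>
     (\<forall>\<epsilon>::real. 0 < \<epsilon> \<and> \<epsilon> < 1 / 2 \<longrightarrow>
       (\<forall>b \<in> soft_O (\<lambda>n. real n powr (4 / 5)).
        \<exists>h \<in> soft_Omega (\<lambda>m. log 2 (real m) powr (1 / 4)).
        \<forall>s :: nat \<Rightarrow> nat. (\<forall>n. 1 \<le> s n \<and> real (s n) \<le> 2 powr b n) \<longrightarrow>
          (\<forall>\<^sub>F n in sequentially. \<exists>f. monotone_pm_function n f \<and>
             optimal_dt_size n f = s n \<and>
             real (top_down_dt_size n f \<epsilon>) \<ge> real (s n) powr h (s n))))"
  using exact_lower_bound approximate_lower_bound by blast

end
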